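(* Let $M$ be an $s\times n$ integer matrix with columns $m_1,\ldots,m_n\in\mathbb{Z}^s$ that span $\mathbb{R}^s$ and whose convex hull does not contain the origin, and let $\Omega$ be a fundamental $M$-cone. For $0\le \mu\le n-s$ let $p_{\mu,\Omega}$ denote the homogeneous part of degree $n-s-\mu$ of the polynomial $P_e f_\Omega(\cdot|M)$. Then for $x\in\Omega$, $$p_{0,\Omega}(x)=T(x|M),$$ and for $1\le\mu\le n-s$, $$p_{\mu,\Omega}(x)=-\sum_{j=0}^{\mu-1}\Big(\sum_{u\in\mathbb{Z}_+^s,\ |u|=\mu-j} D^u p_{j,\Omega}(x)\,(-i)^{|u|}\,D^u\widehat{B}(0|M)/u!\Big).$$
   Context: Columns of $M$ are treated as a multiset; a "subset $Y\subset M$" means a submatrix formed by some of the columns, and $M\setminus Y$ the remaining columns. Discrete truncated power: $t(\alpha|M)=\#\{\beta\in\mathbb{Z}_+^n: M\beta=\alpha\}$ for $\alpha\in\mathbb{Z}^s$. Multivariate truncated power: $T(\cdot|M)$ is the function on $\mathbb{R}^s$ with $\int T(x|M)\phi(x)dx=\int_{\mathbb{R}_+^n}\phi(Mu)du$ for test functions $\phi$ (equivalently $T(x|M)=\mathrm{vol}_{n-s}(\{u\in\mathbb{R}_+^n:Mu=x\})/\sqrt{\det(MM^T)}$). Box spline $B(\cdot|M)$: $\int B(x|M)\phi(x)dx=\int_{[0,1)^n}\phi(Mu)du$; its Fourier transform is $\widehat{B}(\zeta|M)=\prod_{j=1}^n\frac{1-\exp(-i\zeta^Tm_j)}{i\zeta^Tm_j}$,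 $\zeta\in\mathbb{C}^s$ (an entire function), and $D^u\widehat B(0|M)$ denotes its derivative at $\zeta=0$. For $u\in\mathbb{Z}_+^s$: $D^u=D_1^{u_1}\cdots D_s^{u_s}$ (partial derivatives), $|u|=u_1+\cdots+u_s$, $u!=u_1!\cdots u_s!$. $[[M]]=\{\sum_j a_jm_j:0\le a_j\le1\}$; $\mathrm{cone}(M)=\{\sum_j a_jm_j: a_j\ge 0\}$, $\mathrm{cone}^\circ(M)$ its interior. $\mathscr{Y}(M)$ is the set of $Y\subset M$ such that $M\setminus Y$ does not span $\mathbb{R}^s$; $c(M)$ is the union of $\mathrm{cone}(M\setminus Y)$ over $Y\in\mathscr{Y}(M)$; a fundamental $M$-cone is a connected component of $\mathrm{cone}^\circ(M)\setminus c(M)$. For $\Omega$ a fundamental $M$-cone, $v(\Omega|M)=\mathbb{Z}^s\cap(\Omega-[[M]])$. For $f:\mathbb{Z}^s\to\mathbb{C}$ and $y\in\mathbb{Z}^s$, $\nabla_yf=f-f(\cdot-y)$, $\nabla_Y=\prod_{y\in Y}\nabla_y$; $\nabla(M)=\{f:\mathbb{Z}^s\to\mathbb{C}:\nabla_Yf=0\ \forall Y\in\mathscr{Y}(M)\}$. It is known (Dahmen–Micchelli) that there is a unique $f_\Omega(\cdot|M)\in\nabla(M)$ agreeing with $t(\cdot|M)$ on $v(\Omega|M)$. For $\theta\in(\mathbb{C}\setminus0)^s$ and $\alpha\in\mathbb{Z}^s$, $\theta^\alpha=\prod_j\theta_j^{\alpha_j}$; $M_\theta=\{m\in M:\theta^m=1\}$;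 $A(M)=\{\theta\in(\mathbb{C}\setminus 0)^s:\mathrm{span}(M_\theta)=\mathbb{R}^s\}$ (a finite set); $e=(1,\ldots,1)\in A(M)$. Every $f\in\nabla(M)$ can be written uniquely as $f(\alpha)=\sum_{\theta\in A(M)}\theta^\alpha p_\theta(\alpha)$ with polynomials $p_\theta$; one writes $P_\theta f:=p_\theta$. *)

theory Defs
  imports "HOL-Analysis.Analysis" "HOL-Library.Poly_Mapping"
begin

text \<open>
  A matrix with rows indexed by \<open>'s\<close> and columns indexed by \<open>'n\<close> has type \<open>int^'n^'s\<close>.
  Since columns form a multiset, a submatrix is represented by the set of indices of its columns.
\<close>

definition rvec :: "int^'s \<Rightarrow> real^'s" where
  "rvec a = (\<chi> i. real_of_int (a $ i))"

definition cvec :: "real^'s \<Rightarrow> complex^'s" where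
  "cvec x = (\<chi> i. complex_of_real (x $ i))"

definition rmat :: "int^'n^'s \<Rightarrow> real^'n^'s" where
  "rmat M = (\<chi> i j. real_of_int (M $ i $ j))"

definition rcol :: "int^'n^'s \<Rightarrow> 'n \<Rightarrow> real^'s" where
  "rcol M j = column j (rmat M)"


subsection \<open>Cones\<close>

definition subcone :: "int^'n^'s \<Rightarrow> 'n set \<Rightarrow> (real^'s) set" where
  "subcone M J = {\<Sum>j\<in>J. a j *\<^sub>R rcol M j | a. \<forall>j\<in>J. 0 \<le> a j}"

definition zonotope :: "int^'n^'s \<Rightarrow> (real^'s) set" where
  "zonotope M = {rmat M *v a | a. \<forall>j. 0 \<le> a $ j \<and> a $ j \<le> 1}"

definition nonspanning_complements :: "int^'n^'s \<Rightarrow> 'n set set" where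
  "nonspanning_complements M = {Y. span (rcol M ` (UNIV - Y)) \<noteq> UNIV}"

definition cut_set :: "int^'n^'s \<Rightarrow> (real^'s) set" where
  "cut_set M = (\<Union>Y\<in>nonspanning_complements M. subcone M (UNIV - Y))"

definition fundamental_cones :: "int^'n^'s \<Rightarrow> (real^'s) set set" where
  "fundamental_cones M = components (interior (subcone M UNIV) - cut_set M)"

definition v_set :: "int^'n^'s \<Rightarrow> (real^'s) set \<Rightarrow> (int^'s) set" where
  "v_set M \<Omega> = {\<alpha>. \<exists>w\<in>\<Omega>. \<exists>z\<in>zonotope M. rvec \<alpha> = w - z}"


subsection \<open>Truncated powers\<close>

definition discrete_truncated_power :: "int^'n^'s \<Rightarrow> int^'s \<Rightarrow> nat" where
  "discrete_truncated_power M \<alpha> = card {\<beta> :: nat^'n. M *v (\<chi> j. int (\<beta> $ j)) = \<alpha>}"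

text \<open>
  The \<open>dim V\<close>-dimensional volume of a subset \<open>S\<close> of a nonempty affine subspace \<open>V\<close>: Lebesgue
  measure in orthonormal coordinates on \<open>V\<close>.  It depends neither on the base point nor on the
  orthonormal basis chosen.  For a single point \<open>V\<close> it is the counting measure.
\<close>

definition affine_volume :: "'a::euclidean_space set \<Rightarrow> 'a set \<Rightarrow> real" where
  "affine_volume V S =
    (let a = (SOME a. a \<in> V);
         B = (SOME B. pairwise orthogonal B \<and> (\<forall>b\<in>B. norm b = 1) \<and> span B = (\<lambda>v. v - a) ` V)
     in measure (Pi\<^sub>M B (\<lambda>_. lborel)) {c \<in> B \<rightarrow>\<^sub>E UNIV. a + (\<Sum>b\<in>B. c b *\<^sub>R b) \<in> S})"

text \<open>
  The property \<open>\<integral> T(x|M) \<phi>(x) dx = \<integral>\<^bsub>u \<ge> 0\<^esub> \<phi>(Mu) du\<close> fixes \<open>T\<close> only almost everywhere;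
  the volume formula is the representative with pointwise values.
\<close>

definition truncated_power :: "int^'n^'s \<Rightarrow> real^'s \<Rightarrow> real" where
  "truncated_power M x =
     affine_volume {u. rmat M *v u = x} {u. (\<forall>j. 0 \<le> u $ j) \<and> rmat M *v u = x}
       / sqrt (det (rmat M ** transpose (rmat M)))"


subsection \<open>Difference operators\<close>

definition nabla :: "int^'s \<Rightarrow> (int^'s \<Rightarrow> complex) \<Rightarrow> int^'s \<Rightarrow> complex" where
  "nabla y f = (\<lambda>\<alpha>. f \<alpha> - f (\<alpha> - y))"

text \<open>The operators \<open>nabla y\<close> commute, so the fold does not depend on an order of the columns.\<close>

definition nabla_set :: "int^'n^'s \<Rightarrow> 'n set \<Rightarrow> (int^'s \<Rightarrow> complex) \<Rightarrow> int^'s \<Rightarrow> complex" where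
  "nabla_set M Y f = Finite_Set.fold (\<lambda>j. nabla (column j M)) f Y"

definition nabla_space :: "int^'n^'s \<Rightarrow> (int^'s \<Rightarrow> complex) set" where
  "nabla_space M = {f. \<forall>Y\<in>nonspanning_complements M. nabla_set M Y f = (\<lambda>_. 0)}"


subsection \<open>Multi-indices, polynomials and exponential polynomials\<close>

definition mabs :: "nat^'s \<Rightarrow> nat" where
  "mabs u = (\<Sum>i\<in>UNIV. u $ i)"

definition mfact :: "nat^'s \<Rightarrow> nat" where
  "mfact u = (\<Prod>i\<in>UNIV. fact (u $ i))"

text \<open>A polynomial in variables indexed by \<open>'s\<close>, as a finitely supported family of coefficients.\<close>

type_synonym 's cpoly = "(nat^'s) \<Rightarrow>\<^sub>0 complex"

definition peval :: "'s::finite cpoly \<Rightarrow> complex^'s \<Rightarrow> complex" where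
  "peval p z = (\<Sum>u\<in>Poly_Mapping.keys p. Poly_Mapping.lookup p u * (\<Prod>i\<in>UNIV. (z $ i) ^ (u $ i)))"

definition hom_part :: "nat \<Rightarrow> 's::finite cpoly \<Rightarrow> complex^'s \<Rightarrow> complex" where
  "hom_part d p z =
     (\<Sum>u\<in>{u \<in> Poly_Mapping.keys p. mabs u = d}.
        Poly_Mapping.lookup p u * (\<Prod>i\<in>UNIV. (z $ i) ^ (u $ i)))"

definition vpowi :: "complex^'s \<Rightarrow> int^'s \<Rightarrow> complex" where
  "vpowi \<theta> \<alpha> = (\<Prod>i\<in>UNIV. (\<theta> $ i) powi (\<alpha> $ i))"

definition A_set :: "int^'n^'s \<Rightarrow> (complex^'s) set" where
  "A_set M = {\<theta>. (\<forall>i. \<theta> $ i \<noteq> 0) \<and> span (rcol M ` {j. vpowi \<theta> (column j M) = 1}) = UNIV}"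


subsection \<open>Derivatives and the transform of the box spline\<close>

definition partial_deriv :: "'s::finite \<Rightarrow> (complex^'s \<Rightarrow> complex) \<Rightarrow> complex^'s \<Rightarrow> complex" where
  "partial_deriv i F z = deriv (\<lambda>t. F (z + axis i t)) 0"

text \<open>
  \<open>D\<^sup>u\<close> differentiates \<open>u $ i\<close> times in direction \<open>i\<close>, following a list of directions; for entire
  functions the order of the list is immaterial.  Polynomials are differentiated as
  functions on complex vectors, which gives the usual partial derivatives at real points.
\<close>

definition mderiv :: "nat^'s \<Rightarrow> (complex^'s \<Rightarrow> complex) \<Rightarrow> complex^'s \<Rightarrow> complex" where
  "mderiv u F = foldr partial_deriv (SOME is. \<forall>i. count_list is i = u $ i) F"

text \<open>Each factor is extended by its limit \<open>1\<close> at the removable singularity.\<close>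

definition box_spline_transform :: "int^'n^'s \<Rightarrow> complex^'s \<Rightarrow> complex" where
  "box_spline_transform M \<zeta> =
     (\<Prod>j\<in>UNIV. let w = (\<Sum>i\<in>UNIV. \<zeta> $ i * of_int (M $ i $ j))
                in if w = 0 then 1 else (1 - exp (- \<i> * w)) / (\<i> * w))"

end

theory Submission
  imports Defs
begin

text \<open>
  Write \<open>q\<close> for the polynomial attached to the trivial character. Splitting a nonnegative
  integer vector into its parity and its half, \<open>\<beta> = \<gamma> + 2 \<beta>'\<close>, gives
  \<open>t(x) = \<Sum>\<gamma> t((x - M \<gamma>) / 2)\<close>, where \<open>\<gamma>\<close> runs over the bit vectors with
  \<open>x - M \<gamma>\<close> even. All arguments stay in the set where \<open>t\<close> agrees with \<open>f\<close>, so comparing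
  the components of the trivial character yields
  \<open>2\<^sup>s q(z) = \<Sum>\<gamma> q((z - M \<gamma>) / 2)\<close>, the sum now being over all bit vectors. Hence the average
  \<open>\<integral> q(z - M u) du\<close> over the unit cube is homogeneous of degree \<open>n - s\<close>. Expanding it by Taylor's
  formula, with the moments of the box spline as coefficients, its homogeneous parts
  of lower degree are exactly the asserted recursion, and \<open>q\<close> has degree at most \<open>n - s\<close>.

  For the leading part, \<open>T\<close> is monotone along the cone and the integral of \<open>T\<close> over a small cube in \<open>\<Omega>\<close> is the
  volume of a region of the positive orthant. Filling this region with small lattice cells turns the volume
  into a sum of values of \<open>t\<close> over a large cube, and averaging over the residue classes
  leaves only the leading part of \<open>q\<close>.
\<close>

section \<open>Polynomial functions\<close>

text \<open>On one residue class modulo the order of the characters \<open>f\<close> is a single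
  polynomial, and averaging over the classes projects onto the trivial character. Halving needs
  residues modulo twice the order: the factor \<open>2 ^ s\<close> in the relation for
  \<open>q\<close> is the ratio of the numbers of classes before and after halving. The box spline
  satisfies a matching two-scale relation with \<open>2 ^ n\<close> subcubes of the unit cube.
  Together they give the degree \<open>n - s\<close>, at first only for scalings by powers of 2,
  which suffices for polynomials.

  The limit of the rescaled counts is delicate for two reasons. Other characters might contribute
  terms of degree above \<open>n - s\<close>, invisible in \<open>q\<close>. They do not: on each
  class the leading part is a limit of counts, hence nonnegative on \<Omega>, while the average of
  these parts is a part of \<open>q\<close>, which vanishes in that degree. Moreover
  \<open>T\<close> is a pointwise volume, and monotonicity does the work of continuity: cubes near
  \<open>x + \<sigma> x\<close> and \<open>x - \<sigma> x\<close> lie entirely above and below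
  \<open>x\<close> in the order of the cone, which squeezes \<open>T x\<close>.\<close>

lemma sum_vec_prod:
  fixes g :: "'i::finite \<Rightarrow> 'b \<Rightarrow> 'c::comm_semiring_1"
  assumes "\<And>i. finite (X i)"
  shows "(\<Sum>r\<in>{r. \<forall>i. r $ i \<in> X i}. \<Prod>i\<in>UNIV. g i (r $ i)) = (\<Prod>i\<in>UNIV. \<Sum>k\<in>X i. g i k)"
proof -
  have "(\<Sum>r\<in>{r. \<forall>i. r $ i \<in> X i}. \<Prod>i\<in>UNIV. g i (r $ i)) = (\<Sum>h\<in>PiE UNIV X. \<Prod>i\<in>UNIV. g i (h i))"
    by (rule sum.reindex_bij_witness[where i = vec_lambda and j = vec_nth]) auto
  also have "\<dots> = (\<Prod>i\<in>UNIV. \<Sum>k\<in>X i. g i k)"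
    by (rule prod_sum_PiE[symmetric]) (use assms in auto)
  finally show ?thesis .
qed

lemma finite_vec_box:
  fixes X :: "'i::finite \<Rightarrow> 'b set"
  assumes "\<And>i. finite (X i)"
  shows "finite {r :: 'b^'i. \<forall>i. r $ i \<in> X i}"
proof -
  have "{r :: 'b^'i. \<forall>i. r $ i \<in> X i} = vec_lambda ` (PiE UNIV X)"
    by (auto simp: image_iff intro!: bexI[of _ "vec_nth _"])
  then show ?thesis using assms by (simp add: finite_PiE)
qed

definition monom_at :: "complex^'s \<Rightarrow> nat^'s \<Rightarrow> complex" where
  "monom_at z u = (\<Prod>i\<in>UNIV. (z $ i) ^ (u $ i))"

text \<open>Exponents and coefficients are kept apart, so that a homogeneous part is the same
  coefficient function on a smaller set of exponents.\<close>

definition pfun :: "(nat^'s) set \<Rightarrow> (nat^'s \<Rightarrow> complex) \<Rightarrow> complex^'s \<Rightarrow> complex" where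
  "pfun U a z = (\<Sum>u\<in>U. a u * monom_at z u)"

text \<open>A predicate closed under sums, products and substitutions, for identities in which the
  coefficients themselves do not matter.\<close>

definition polyfun :: "(complex^'s \<Rightarrow> complex) \<Rightarrow> bool" where
  "polyfun F \<longleftrightarrow> (\<exists>U a. finite U \<and> F = pfun U a)"

lemma pfun_superset:
  assumes "finite V" "U \<subseteq> V" "\<And>u. u \<in> V - U \<Longrightarrow> a u = 0"
  shows "pfun V a z = pfun U a z"
  unfolding pfun_def by (rule sum.mono_neutral_right) (use assms in auto)

lemma polyfun_pfun: "finite U \<Longrightarrow> polyfun (pfun U a)"
  unfolding polyfun_def by auto

lemma monom_at_add: "monom_at z (u + v) = monom_at z u * monom_at z v"
  by (simp add: monom_at_def power_add prod.distrib)

lemma monom_at_scale: "monom_at (\<chi> i. c * z $ i) u = c ^ mabs u * monom_at z u"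
  by (simp add: monom_at_def power_mult_distrib prod.distrib mabs_def power_sum)

lemma polyfun_add:
  assumes "polyfun F" "polyfun G" shows "polyfun (\<lambda>z. F z + G z)"
proof -
  obtain U a V b where F: "finite U" "F = pfun U a" and G: "finite V" "G = pfun V b"
    using assms unfolding polyfun_def by blast
  \<comment> \<open>Outside its own exponent set a coefficient function is arbitrary, hence the
    guards.\<close>
  let ?c = "\<lambda>u. (if u \<in> U then a u else 0) + (if u \<in> V then b u else 0)"
  have "pfun (U \<union> V) ?c z = F z + G z" for z
  proof -
    have "pfun (U \<union> V) ?c z = pfun (U \<union> V) (\<lambda>u. if u \<in> U then a u else 0) z
        + pfun (U \<union> V) (\<lambda>u. if u \<in> V then b u else 0) z"
      by (simp add: pfun_def distrib_right sum.distrib)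
    also have "\<dots> = pfun U (\<lambda>u. if u \<in> U then a u else 0) z
        + pfun V (\<lambda>u. if u \<in> V then b u else 0) z"
      using F G by (intro arg_cong2[where f="(+)"] pfun_superset) auto
    also have "\<dots> = F z + G z"
      by (simp add: F G pfun_def)
    finally show ?thesis .
  qed
  then show ?thesis unfolding polyfun_def using F(1) G(1)
    by (intro exI[of _ "U \<union> V"] exI[of _ ?c]) auto
qed

lemma polyfun_0: "polyfun (\<lambda>z. 0)"
  unfolding polyfun_def by (rule exI[of _ "{}"]) (auto simp: pfun_def fun_eq_iff)

lemma polyfun_sum:
  assumes "\<And>x. x \<in> S \<Longrightarrow> polyfun (F x)" shows "polyfun (\<lambda>z. \<Sum>x\<in>S. F x z)"
  using assms by (induction S rule: infinite_finite_induct) (auto intro: polyfun_0 polyfun_add)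

lemma polyfun_term: "polyfun (\<lambda>z. c * monom_at z u)"
  unfolding polyfun_def by (rule exI[of _ "{u}"], rule exI[of _ "\<lambda>_. c"]) (auto simp: pfun_def)

lemma polyfun_mult:
  assumes "polyfun F" "polyfun G" shows "polyfun (\<lambda>z. F z * G z)"
proof -
  obtain U a V b where F: "finite U" "F = pfun U a" and G: "finite V" "G = pfun V b"
    using assms unfolding polyfun_def by blast
  have "F z * G z = (\<Sum>u\<in>U. \<Sum>v\<in>V. (a u * b v) * monom_at z (u + v))" for z
    unfolding F G pfun_def by (simp add: sum_product monom_at_add algebra_simps)
  then have eq: "(\<lambda>z. F z * G z) = (\<lambda>z. \<Sum>u\<in>U. \<Sum>v\<in>V. (a u * b v) * monom_at z (u + v))" by auto
  show ?thesis unfolding eq by (intro polyfun_sum polyfun_term)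
qed

lemma polyfun_const: "polyfun (\<lambda>z. c)"
  using polyfun_term[of c 0] by (simp add: monom_at_def)

lemma polyfun_coord: "polyfun (\<lambda>z. z $ i)"
proof -
  have "monom_at z (axis i 1) = z $ i" for z :: "complex^'a"
  proof -
    have "monom_at z (axis i 1) = (\<Prod>j\<in>UNIV. if j = i then z $ i else 1)"
      unfolding monom_at_def by (intro prod.cong) (auto simp: axis_def)
    then show ?thesis by simp
  qed
  then show ?thesis using polyfun_term[of 1 "axis i 1"] by simp
qed

lemma polyfun_prod:
  assumes "\<And>x. x \<in> S \<Longrightarrow> polyfun (F x)" shows "polyfun (\<lambda>z. \<Prod>x\<in>S. F x z)"
  using assms by (induction S rule: infinite_finite_induct) (auto intro: polyfun_const polyfun_mult)

lemma polyfun_power: "polyfun F \<Longrightarrow> polyfun (\<lambda>z. F z ^ k)"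
  by (induction k) (auto intro: polyfun_const polyfun_mult)

lemma polyfun_diff:
  assumes "polyfun F" "polyfun G" shows "polyfun (\<lambda>z. F z - G z)"
  using polyfun_add[OF assms(1) polyfun_mult[OF polyfun_const[of "-1"] assms(2)]] by simp

lemma polyfun_subst:
  assumes "polyfun F" "\<And>i. polyfun (\<lambda>z. h z $ i)"
  shows "polyfun (\<lambda>z. F (h z))"
proof -
  obtain U a where F: "finite U" "F = pfun U a" using assms unfolding polyfun_def by blast
  show ?thesis unfolding F pfun_def monom_at_def
    by (intro polyfun_sum polyfun_mult polyfun_const polyfun_prod polyfun_power assms)
qed

text \<open>Taking the \<open>k\<close>-th coefficient is a linear functional on polynomials of
  degree at most \<open>K\<close>, so it is a combination of the values at any \<open>K + 1\<close>
  points; the weight of a point is the \<open>k\<close>-th coefficient of its Lagrange basis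
  polynomial.\<close>

lemma lagrange_weights:
  fixes X :: "complex set"
  assumes "finite X" "card X > K" "k \<le> K"
  obtains w where "\<And>m. m \<le> K \<Longrightarrow> (\<Sum>x\<in>X. w x * x ^ m) = (if m = k then 1 else 0)"
proof -
  obtain Y where Y: "Y \<subseteq> X" "card Y = Suc K" "finite Y"
    using assms by (metis Suc_leI obtain_subset_with_card_n)
  define L where "L x = (\<Prod>y\<in>Y-{x}. smult (1/(x-y)) [:-y, 1:])" for x
  have Lx: "poly (L x) y = (if x = y then 1 else 0)" if "x \<in> Y" "y \<in> Y" for x y
    using that Y(3) by (auto simp: L_def poly_prod diff_divide_distrib[symmetric] intro!: prod.neutral prod_zero)
  have degL: "degree (L x) \<le> K" if "x \<in> Y" for x
  proof -
    have "degree (L x) \<le> (\<Sum>y\<in>Y-{x}. degree (smult (1/(x-y)) [:-y, 1:]))"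
      unfolding L_def by (rule degree_prod_sum_le[unfolded o_def]) (use Y in auto)
    also have "\<dots> \<le> (\<Sum>y\<in>Y-{x}. 1)" by (intro sum_mono) auto
    also have "\<dots> = K" using that Y by simp
    finally show ?thesis .
  qed
  \<comment> \<open>Points beyond the chosen \<open>K + 1\<close> get weight 0.\<close>
  define w where "w x = (if x \<in> Y then coeff (L x) k else 0)" for x
  show ?thesis
  proof (rule that)
    fix m assume m: "m \<le> K"
    have "monom 1 m = (\<Sum>x\<in>Y. smult (x ^ m) (L x))"
    proof (rule poly_eqI_degree[where A = Y])
      fix x assume "x \<in> Y"
      have "poly (\<Sum>y\<in>Y. smult (y ^ m) (L y)) x = (\<Sum>y\<in>Y. if y = x then x ^ m else 0)"
        unfolding poly_sum by (intro sum.cong) (auto simp: Lx \<open>x \<in> Y\<close>)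
      then show "poly (monom 1 m) x = poly (\<Sum>x\<in>Y. smult (x ^ m) (L x)) x"
        using \<open>x \<in> Y\<close> Y by (simp add: poly_monom)
    next
      show "degree (monom (1::complex) m) < card Y" using m Y by (simp add: degree_monom_eq)
      have "degree (\<Sum>x\<in>Y. smult (x ^ m) (L x)) \<le> K"
        by (intro degree_sum_le) (use Y degL in \<open>auto intro: order.trans[OF degree_smult_le]\<close>)
      then show "degree (\<Sum>x\<in>Y. smult (x ^ m) (L x)) < card Y" using Y by simp
    qed
    then have "coeff (monom 1 m) k = (\<Sum>x\<in>Y. x ^ m * coeff (L x) k)"
      by (simp add: coeff_sum)
    moreover have "(\<Sum>x\<in>X. w x * x ^ m) = (\<Sum>x\<in>Y. x ^ m * coeff (L x) k)"
      by (rule sum.mono_neutral_cong_right) (use Y assms in \<open>auto simp: w_def\<close>)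
    ultimately show "(\<Sum>x\<in>X. w x * x ^ m) = (if m = k then 1 else 0)" by (simp add: eq_commute)
  qed
qed

text \<open>The product over the coordinates of the one-variable coefficient functionals is a
  weighted sum of values on the grid. Applied to the polynomial it returns \<open>a v\<close>, and
  all the values it uses are zero.\<close>

lemma pfun_grid_zero:
  fixes X :: "'s::finite \<Rightarrow> complex set"
  assumes U: "finite U" "\<And>u i. u \<in> U \<Longrightarrow> u $ i \<le> K"
    and X: "\<And>i. finite (X i)" "\<And>i. card (X i) > K"
    and zero: "\<And>z. (\<forall>i. z $ i \<in> X i) \<Longrightarrow> pfun U a z = 0"
    and v: "v \<in> U"
  shows "a v = 0"
proof -
  have "\<exists>w. \<forall>m\<le>K. (\<Sum>x\<in>X i. w x * x ^ m) = (if m = v $ i then 1 else 0)" for i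
    using lagrange_weights[OF X(1)[of i] X(2)[of i] U(2)[OF v]] by metis
  then obtain w where w: "\<And>i m. m \<le> K \<Longrightarrow> (\<Sum>x\<in>X i. w i x * x ^ m) = (if m = v $ i then 1 else 0)"
    by metis
  let ?S = "{z. \<forall>i. z $ i \<in> X i}"
  have "0 = (\<Sum>z\<in>?S. (\<Prod>i\<in>UNIV. w i (z $ i)) * pfun U a z)"
    using zero by simp
  also have "\<dots> = (\<Sum>u\<in>U. a u * (\<Sum>z\<in>?S. \<Prod>i\<in>UNIV. w i (z $ i) * (z $ i) ^ (u $ i)))"
    unfolding pfun_def sum_distrib_left by (subst sum.swap) (simp add: monom_at_def prod.distrib algebra_simps)
  also have "\<dots> = (\<Sum>u\<in>U. a u * (if u = v then 1 else 0))"
  proof (intro sum.cong refl arg_cong2[where f="(*)"])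
    fix u assume u: "u \<in> U"
    have "(\<Sum>z\<in>?S. \<Prod>i\<in>UNIV. w i (z $ i) * (z $ i) ^ (u $ i)) = (\<Prod>i\<in>UNIV. \<Sum>x\<in>X i. w i x * x ^ (u $ i))"
      by (rule sum_vec_prod) (rule X)
    also have "\<dots> = (\<Prod>i\<in>UNIV. if u $ i = v $ i then 1 else 0)"
      by (intro prod.cong refl w U u)
    also have "\<dots> = (if u = v then 1 else 0)"
      by (auto simp: vec_eq_iff)
    finally show "(\<Sum>z\<in>?S. \<Prod>i\<in>UNIV. w i (z $ i) * (z $ i) ^ (u $ i)) = (if u = v then 1 else 0)" .
  qed
  also have "\<dots> = a v" using v U(1) by (simp add: if_distrib cong: if_cong)
  finally show ?thesis by simp
qed

lemma cvec_nth [simp]: "cvec x $ i = complex_of_real (x $ i)" by (simp add: cvec_def)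
lemma rvec_nth [simp]: "rvec x $ i = real_of_int (x $ i)" by (simp add: rvec_def)

text \<open>A conical open set contains arbitrarily large cubes, and these meet every residue class.\<close>

lemma pfun_cone_zero:
  fixes \<Omega> :: "(real^'s) set" and r :: "int^'s"
  assumes op: "open \<Omega>" "\<Omega> \<noteq> {}" and cone: "\<And>x c. x \<in> \<Omega> \<Longrightarrow> c > 0 \<Longrightarrow> c *\<^sub>R x \<in> \<Omega>"
    and N: "N > 0" and U: "finite U"
    and zero: "\<And>\<alpha>. rvec \<alpha> \<in> \<Omega> \<Longrightarrow> \<forall>i. \<alpha> $ i mod int N = r $ i mod int N \<Longrightarrow> pfun U a (cvec (rvec \<alpha>)) = 0"
    and v: "v \<in> U"
  shows "a v = 0"
proof -
  obtain x where x: "x \<in> \<Omega>" using op by blast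
  obtain \<rho> where \<rho>: "\<rho> > 0" "ball x \<rho> \<subseteq> \<Omega>" using op(1) x open_contains_ball by blast
  define K where "K = (\<Sum>u\<in>U. \<Sum>i\<in>UNIV. u $ i)"
  have K: "u $ i \<le> K" if "u \<in> U" for u i
  proof -
    have "u $ i \<le> (\<Sum>i\<in>UNIV. u $ i)" by (rule member_le_sum) auto
    also have "\<dots> \<le> K" unfolding K_def using that U by (intro member_le_sum) auto
    finally show ?thesis .
  qed
  \<comment> \<open>Bounds the distance of a grid point from \<open>k x\<close>: in each coordinate
    the residue, plus \<open>N\<close> times the rounding error and an offset of at most
    \<open>K\<close>; the factor \<open>CARD('s)\<close> comes from the sum norm.\<close>
  define C where "C = real CARD('s) * ((\<Sum>i\<in>UNIV. \<bar>real_of_int (r $ i)\<bar>) + real N * (K + 2))"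
  obtain k :: nat where k: "k > 0" "C / \<rho> < k"
    using reals_Archimedean2 by (metis gr0I le_less_trans linorder_not_less max.cobounded1 max.cobounded2 of_nat_0_less_iff of_nat_max not_less_iff_gr_or_eq max_less_iff_conj zero_less_Suc lessI of_nat_less_iff less_trans)
  \<comment> \<open>\<open>K + 1\<close> consecutive members of the residue class of
    \<open>r $ i\<close>, starting near \<open>k * x $ i\<close>.\<close>
  define b where "b i j = r $ i + int N * (\<lfloor>k * x $ i / N\<rfloor> + int j)" for i j
  define X where "X i = (\<lambda>j. complex_of_int (b i j)) ` {..K}" for i
  show ?thesis
  proof (rule pfun_grid_zero[OF U K, where X = X])
    show "finite (X i)" for i by (simp add: X_def)
    have "inj_on (\<lambda>j. complex_of_int (b i j)) {..K}" for i
      using N by (auto simp: inj_on_def b_def)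
    then show "card (X i) > K" for i by (simp add: X_def card_image)
    show "v \<in> U" by fact
    fix z assume z: "\<forall>i. z $ i \<in> X i"
    then have "\<forall>i. \<exists>j\<le>K. z $ i = of_int (b i j)" unfolding X_def by auto
    then obtain j where j: "\<And>i. j i \<le> K" "\<And>i. z $ i = of_int (b i (j i))" by metis
    define \<alpha> where "\<alpha> = (\<chi> i. b i (j i))"
    have za: "z = cvec (rvec \<alpha>)" by (simp add: vec_eq_iff \<alpha>_def j)
    have "norm (rvec \<alpha> - real k *\<^sub>R x) \<le> C"
    proof -
      have "norm (rvec \<alpha> - real k *\<^sub>R x) \<le> (\<Sum>i\<in>UNIV. \<bar>(rvec \<alpha> - real k *\<^sub>R x) $ i\<bar>)"
        by (rule norm_le_l1_cart)
      also have "\<dots> \<le> (\<Sum>i\<in>(UNIV::'s set). (\<Sum>i\<in>UNIV. \<bar>real_of_int (r $ i)\<bar>) + real N * (K + 2))"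
      proof (rule sum_mono)
        fix i
        define y where "y = real k * x $ i / N"
        have e: "real k * x $ i = real N * y" using N by (simp add: y_def)
        have "(rvec \<alpha> - real k *\<^sub>R x) $ i = r $ i + real N * (real_of_int \<lfloor>y\<rfloor> - y + j i)"
          by (simp add: \<alpha>_def b_def y_def[symmetric] e algebra_simps)
        also have "\<bar>\<dots>\<bar> \<le> \<bar>real_of_int (r $ i)\<bar> + real N * \<bar>real_of_int \<lfloor>y\<rfloor> - y + j i\<bar>"
          by (metis abs_mult abs_of_nat abs_triangle_ineq)
        also have "\<dots> \<le> (\<Sum>i\<in>UNIV. \<bar>real_of_int (r $ i)\<bar>) + real N * (K + 2)"
        proof (intro add_mono mult_left_mono)
          show "\<bar>real_of_int (r $ i)\<bar> \<le> (\<Sum>i\<in>UNIV. \<bar>real_of_int (r $ i)\<bar>)"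
            by (rule member_le_sum) auto
          have "real (j i) \<le> K" using j by simp
          then show "\<bar>real_of_int \<lfloor>y\<rfloor> - y + real (j i)\<bar> \<le> real (K + 2)" by linarith
        qed auto
        finally show "\<bar>(rvec \<alpha> - real k *\<^sub>R x) $ i\<bar> \<le> (\<Sum>i\<in>UNIV. \<bar>real_of_int (r $ i)\<bar>) + real N * (K + 2)" by simp
      qed
      also have "\<dots> = C" by (simp add: C_def)
      finally show ?thesis .
    qed
    moreover have "C < k * \<rho>" using k \<rho> by (simp add: field_simps)
    ultimately have "norm (rvec \<alpha> - real k *\<^sub>R x) < k * \<rho>" by simp
    moreover have "rvec \<alpha> - real k *\<^sub>R x = real k *\<^sub>R ((1/k) *\<^sub>R rvec \<alpha> - x)"
      using k by (simp add: scaleR_diff_right)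
    ultimately have "norm ((1/k) *\<^sub>R rvec \<alpha> - x) < \<rho>" using k by simp
    then have "(1/k) *\<^sub>R rvec \<alpha> \<in> \<Omega>" using \<rho> by (auto simp: dist_norm norm_minus_commute subset_iff)
    from cone[OF this, of k] have "rvec \<alpha> \<in> \<Omega>" using k by simp
    then show "pfun U a z = 0" unfolding za
      by (rule zero) (auto simp: \<alpha>_def b_def mod_mult_self2)
  qed
qed

lemma polyfun_cone_zero:
  fixes \<Omega> :: "(real^'s) set" and r :: "int^'s"
  assumes op: "open \<Omega>" "\<Omega> \<noteq> {}" and cone: "\<And>x c. x \<in> \<Omega> \<Longrightarrow> c > 0 \<Longrightarrow> c *\<^sub>R x \<in> \<Omega>"
    and N: "N > 0" and F: "polyfun F"
    and zero: "\<And>\<alpha>. rvec \<alpha> \<in> \<Omega> \<Longrightarrow> \<forall>i. \<alpha> $ i mod int N = r $ i mod int N \<Longrightarrow> F (cvec (rvec \<alpha>)) = 0"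
  shows "F z = 0"
proof -
  obtain U a where Ua: "finite U" "F = pfun U a" using F unfolding polyfun_def by blast
  have "a v = 0" if "v \<in> U" for v
    by (rule pfun_cone_zero[OF op cone N Ua(1) _ that, of r]) (use zero in \<open>auto simp: Ua\<close>)
  then show ?thesis by (simp add: Ua pfun_def)
qed

section \<open>Characters of finite order and cones\<close>

lemma rvec_diff: "rvec (x - y) = rvec x - rvec y" by (simp add: vec_eq_iff)

definition lattice_image :: "int^'n^'s \<Rightarrow> nat^'n \<Rightarrow> int^'s" where
  "lattice_image M \<beta> = M *v (\<chi> j. int (\<beta> $ j))"

lemma lattice_image_nth: "lattice_image M \<beta> $ i = (\<Sum>j\<in>UNIV. M $ i $ j * int (\<beta> $ j))"
  by (simp add: lattice_image_def matrix_vector_mult_def)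

lemma rmat_nth [simp]: "rmat M $ i $ j = real_of_int (M $ i $ j)" by (simp add: rmat_def)

lemma rcol_nth [simp]: "rcol M j $ i = real_of_int (M $ i $ j)" by (simp add: rcol_def column_def)

lemma rmat_mult: "rmat M *v u = (\<Sum>j\<in>UNIV. u $ j *\<^sub>R rcol M j)"
  by (simp add: vec_eq_iff matrix_vector_mult_def mult.commute)

lemma rvec_lattice_image: "rvec (lattice_image M \<beta>) = rmat M *v (\<chi> j. real (\<beta> $ j))"
  by (simp add: vec_eq_iff lattice_image_nth matrix_vector_mult_def)

text \<open>The coefficients are indexed by \<open>J\<close> and not by the vectors, because columns
  may coincide.\<close>

lemma span_image_coeffs:
  fixes g :: "'j \<Rightarrow> 'v::real_vector"
  assumes "finite J" "x \<in> span (g ` J)"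
  obtains a where "x = (\<Sum>j\<in>J. a j *\<^sub>R g j)"
proof -
  let ?S = "{\<Sum>j\<in>J. a j *\<^sub>R g j | a. True}"
  have "subspace ?S"
  proof (rule subspaceI)
    show "0 \<in> ?S" by (auto intro: exI[of _ "\<lambda>_. 0"])
    show "x + y \<in> ?S" if "x \<in> ?S" "y \<in> ?S" for x y
    proof -
      from that obtain a b where "x = (\<Sum>j\<in>J. a j *\<^sub>R g j)" "y = (\<Sum>j\<in>J. b j *\<^sub>R g j)" by auto
      then have "x + y = (\<Sum>j\<in>J. (a j + b j) *\<^sub>R g j)" by (simp add: scaleR_add_left sum.distrib)
      then show ?thesis by (intro CollectI exI[of _ "\<lambda>j. a j + b j"]) auto
    qed
    show "c *\<^sub>R x \<in> ?S" if "x \<in> ?S" for c x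
    proof -
      from that obtain a where "x = (\<Sum>j\<in>J. a j *\<^sub>R g j)" by auto
      then have "c *\<^sub>R x = (\<Sum>j\<in>J. (c * a j) *\<^sub>R g j)" by (simp add: scaleR_sum_right)
      then show ?thesis by (intro CollectI exI[of _ "\<lambda>j. c * a j"]) auto
    qed
  qed
  moreover have "g ` J \<subseteq> ?S"
  proof
    fix y assume "y \<in> g ` J"
    then obtain i where i: "i \<in> J" "y = g i" by auto
    have "(\<Sum>j\<in>J. (if j = i then 1 else 0) *\<^sub>R g j) = (\<Sum>j\<in>J. if j = i then g j else 0)"
      by (intro sum.cong) auto
    also have "\<dots> = y" using i assms(1) by simp
    finally show "y \<in> ?S" by (intro CollectI exI[of _ "\<lambda>j. if j = i then 1 else 0"]) auto
  qed
  ultimately have "span (g ` J) \<subseteq> ?S" by (rule span_minimal[rotated])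
  then show ?thesis using assms(2) that by blast
qed

text \<open>Pigeonhole: the multiples of a unit vector meet only finitely many points of the half-open
  zonotope modulo the lattice spanned by the columns.\<close>

lemma lattice_multiple:
  fixes M :: "int^'n^'s"
  assumes "span (rcol M ` J) = UNIV"
  shows "\<exists>d > 0. \<exists>c. \<forall>k. (if k = i then int d else 0) = (\<Sum>j\<in>J. c j * M $ k $ j)"
proof -
  have "axis i 1 \<in> span (rcol M ` J)" using assms by simp
  then obtain a where a: "axis i 1 = (\<Sum>j\<in>J. a j *\<^sub>R rcol M j)"
    by (rule span_image_coeffs[rotated]) auto
  have ak: "(if k = i then 1 else 0) = (\<Sum>j\<in>J. a j * M $ k $ j)" for k
    using arg_cong[OF a, of "\<lambda>v. v $ k"] by (simp add: axis_def sum_component)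
  \<comment> \<open>Removing the integer parts of the coefficients of \<open>m\<close> times the
    unit vector leaves an integer vector whose size does not depend on \<open>m\<close>. Where two
    values coincide, the differences of the integer parts are the coefficients sought.\<close>
  define \<phi> :: "nat \<Rightarrow> int^'s" where
    "\<phi> m = (\<chi> k. (if k = i then int m else 0) - (\<Sum>j\<in>J. \<lfloor>m * a j\<rfloor> * M $ k $ j))" for m
  define C where "C = (\<Sum>k\<in>UNIV. \<Sum>j\<in>UNIV. \<bar>M $ k $ j\<bar>)"
  have bound: "\<bar>\<phi> m $ k\<bar> \<le> C" for m k
  proof -
    have "real_of_int (\<phi> m $ k) = real m * (if k = i then (1::real) else 0) - (\<Sum>j\<in>J. real_of_int \<lfloor>m * a j\<rfloor> * real_of_int (M $ k $ j))"
      by (simp add: \<phi>_def)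
    also have "\<dots> = (\<Sum>j\<in>J. frac (m * a j) * M $ k $ j)"
      by (simp only: ak frac_def sum_distrib_left sum_subtractf left_diff_distrib mult.assoc)
    finally have "\<bar>real_of_int (\<phi> m $ k)\<bar> = \<bar>\<Sum>j\<in>J. frac (m * a j) * M $ k $ j\<bar>" by simp
    also have "\<dots> \<le> (\<Sum>j\<in>J. \<bar>frac (m * a j) * M $ k $ j\<bar>)" by (rule sum_abs)
    also have "\<dots> \<le> (\<Sum>j\<in>J. \<bar>real_of_int (M $ k $ j)\<bar>)"
      by (intro sum_mono) (auto simp: abs_mult frac_lt_1 less_imp_le intro!: mult_left_le_one_le)
    also have "\<dots> \<le> (\<Sum>j\<in>UNIV. \<bar>real_of_int (M $ k $ j)\<bar>)" by (intro sum_mono2) auto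
    also have "\<dots> = of_int (\<Sum>j\<in>UNIV. \<bar>M $ k $ j\<bar>)" by simp
    also have "\<dots> \<le> of_int C" unfolding C_def of_int_le_iff
      by (rule member_le_sum) (auto intro: sum_nonneg)
    finally show ?thesis by linarith
  qed
  have "finite (range \<phi>)"
  proof (rule finite_subset)
    show "range \<phi> \<subseteq> {r. \<forall>k. r $ k \<in> {-C..C}}" using bound by (auto simp: abs_le_iff minus_le_iff)
    show "finite {r :: int^'s. \<forall>k. r $ k \<in> {-C..C}}" by (rule finite_vec_box) auto
  qed
  then have "\<not> inj \<phi>" using finite_imageD infinite_UNIV_nat by blast
  then obtain m m' where m: "\<phi> m = \<phi> m'" "m < m'"
    unfolding inj_def by (metis linorder_neqE_nat)
  show ?thesis
  proof (intro exI conjI allI)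
    show "m' - m > 0" using m by simp
    fix k
    show "(if k = i then int (m' - m) else 0) = (\<Sum>j\<in>J. (\<lfloor>m' * a j\<rfloor> - \<lfloor>m * a j\<rfloor>) * M $ k $ j)"
      using arg_cong[OF m(1), of "\<lambda>v. v $ k"] m(2)
      by (auto simp: \<phi>_def of_nat_diff left_diff_distrib sum_subtractf split: if_splits)
  qed
qed

lemma power_int_sum:
  fixes x :: "'a::field"
  assumes "x \<noteq> 0"
  shows "x powi (\<Sum>j\<in>J. c j) = (\<Prod>j\<in>J. x powi (c j))"
  using assms by (induction J rule: infinite_finite_induct) (auto simp: power_int_add)

lemma prod_power_int:
  fixes g :: "'i \<Rightarrow> 'a::field"
  shows "(\<Prod>i\<in>I. g i) powi c = (\<Prod>i\<in>I. g i powi c)"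
  by (induction I rule: infinite_finite_induct) (auto simp: power_int_mult_distrib)

lemma vpowi_comb:
  fixes M :: "int^'n^'s"
  assumes "\<And>i. \<theta> $ i \<noteq> 0"
  shows "vpowi \<theta> (\<chi> k. \<Sum>j\<in>J. c j * M $ k $ j) = (\<Prod>j\<in>J. vpowi \<theta> (column j M) powi (c j))"
proof -
  have "vpowi \<theta> (\<chi> k. \<Sum>j\<in>J. c j * M $ k $ j) = (\<Prod>k\<in>UNIV. \<Prod>j\<in>J. \<theta> $ k powi (M $ k $ j * c j))"
    using assms by (simp add: vpowi_def power_int_sum mult.commute)
  also have "\<dots> = (\<Prod>j\<in>J. vpowi \<theta> (column j M) powi (c j))"
    by (subst prod.swap) (simp add: vpowi_def column_def prod_power_int power_int_mult)
  finally show ?thesis .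
qed

text \<open>A character that is 1 on the columns in \<open>J\<close> is 1 on their integer
  combinations, among them a multiple \<open>d\<close> of each unit vector, so its coordinates are
  roots of unity. There are finitely many sets \<open>J\<close>, and the product of all the
  multiples serves every character at once.\<close>

lemma A_set_order:
  fixes M :: "int^'n^'s"
  obtains N :: nat where "N > 0" "\<And>\<theta> i. \<theta> \<in> A_set M \<Longrightarrow> \<theta> $ i ^ N = 1"
proof -
  define \<J> where "\<J> = {J. span (rcol M ` J) = UNIV}"
  have "\<exists>d. d > 0 \<and> (\<exists>c. \<forall>k. (if k = i then int d else 0) = (\<Sum>j\<in>J. c j * M $ k $ j))"
    if "J \<in> \<J>" for J i
    using that unfolding \<J>_def by (intro lattice_multiple) simp
  then obtain d where d: "\<And>J i. J \<in> \<J> \<Longrightarrow> d J i > 0"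
    "\<And>J i. J \<in> \<J> \<Longrightarrow> \<exists>c. \<forall>k. (if k = i then int (d J i) else 0) = (\<Sum>j\<in>J. c j * M $ k $ j)"
    by metis
  define N where "N = (\<Prod>J\<in>\<J>. \<Prod>i\<in>UNIV. d J i)"
  show ?thesis
  proof (rule that)
    show "N > 0" using d(1) by (simp add: N_def prod_pos)
    fix \<theta> i assume \<theta>: "\<theta> \<in> A_set M"
    define J where "J = {j. vpowi \<theta> (column j M) = 1}"
    have J: "J \<in> \<J>" and nz: "\<And>i. \<theta> $ i \<noteq> 0" using \<theta> by (auto simp: A_set_def \<J>_def J_def)
    obtain c where c: "\<And>k. (if k = i then int (d J i) else 0) = (\<Sum>j\<in>J. c j * M $ k $ j)"
      using d(2)[OF J, of i] by auto
    have "vpowi \<theta> (\<chi> k. if k = i then int (d J i) else 0) = 1"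
      unfolding c vpowi_comb[OF nz] by (rule prod.neutral) (auto simp: J_def)
    moreover have "vpowi \<theta> (\<chi> k. if k = i then int (d J i) else 0) = (\<Prod>k\<in>UNIV. if k = i then \<theta> $ k ^ d J i else 1)"
      unfolding vpowi_def by (intro prod.cong) auto
    ultimately have "\<theta> $ i ^ d J i = 1" by simp
    moreover have "d J i dvd N"
      unfolding N_def using J by (meson UNIV_I dvd_prodI dvd_trans finite)
    ultimately show "\<theta> $ i ^ N = 1" by (metis dvdE power_mult power_one)
  qed
qed

lemma finite_A_set: "finite (A_set (M :: int^'n^'s))"
proof -
  obtain N where N: "N > 0" "\<And>\<theta> i. \<theta> \<in> A_set M \<Longrightarrow> \<theta> $ i ^ N = 1" using A_set_order by blast
  have sub: "A_set M \<subseteq> {\<theta>. \<forall>i. \<theta> $ i \<in> {z. z ^ N = 1}}" using N by auto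
  have "finite {z::complex. z ^ N = 1}" using finite_roots_unity[of N] N by simp
  then have "finite {\<theta> :: complex^'s. \<forall>i. \<theta> $ i \<in> {z. z ^ N = 1}}" by (intro finite_vec_box)
  with sub show ?thesis by (rule finite_subset)
qed

lemma root_sum_zero:
  fixes w :: complex
  assumes "w ^ m = 1" "w \<noteq> 1"
  shows "(\<Sum>k<m. w ^ k) = 0"
  using assms by (simp add: sum_gp_strict)

lemma root_sum:
  fixes w :: complex
  assumes "w ^ N = 1"
  shows "(\<Sum>k\<in>{0..<2 * int N}. w powi k) = (if w = 1 then 2 * of_nat N else 0)"
proof -
  have "(\<Sum>k\<in>{0..<2 * int N}. w powi k) = (\<Sum>k<2*N. w ^ k)"
    by (rule sum.reindex_bij_witness[where i = int and j = nat]) (auto simp: power_int_def)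
  moreover have "w ^ (2*N) = 1" using assms by (metis mult.commute power_mult power_one)
  ultimately show ?thesis using root_sum_zero by auto
qed

text \<open>As \<open>k\<close> runs through two periods with the parity of \<open>b\<close>, the
  half of \<open>k - b\<close> runs through one complete residue system modulo \<open>N\<close>. The
  value for \<open>w = 1\<close> is therefore half of that in \<open>root_sum\<close>; over all
  coordinates this ratio becomes the factor \<open>2 ^ s\<close>.\<close>

lemma root_half_sum:
  fixes w :: complex and b :: int
  assumes "w ^ N = 1" "N > 0"
  shows "(\<Sum>k\<in>{0..<2 * int N}. if even (k - b) then w powi ((k - b) div 2) else 0)
    = (if w = 1 then of_nat N else 0)"
proof -
  have w0: "w \<noteq> 0" using assms by (auto simp: power_0_left)
  have no: "2 * y \<noteq> (1::int)" for y by presburger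
  define e where "e = b mod 2"
  define c where "c = b div 2"
  have b: "b = 2 * c + e" "e = 0 \<or> e = 1" by (auto simp: e_def c_def)
  have "(\<Sum>k\<in>{0..<2 * int N}. if even (k - b) then w powi ((k - b) div 2) else 0)
      = (\<Sum>k\<in>{k\<in>{0..<2 * int N}. even (k - b)}. w powi ((k - b) div 2))"
    by (rule sum.inter_filter[symmetric]) auto
  also have "\<dots> = (\<Sum>j<N. w powi (int j - c))"
    by (rule sum.reindex_bij_witness[where i = "\<lambda>j. 2 * int j + e" and j = "\<lambda>k. nat (k div 2)"])
      (use b in \<open>auto simp: no elim!: evenE oddE\<close>)
  also have "\<dots> = w powi (- c) * (\<Sum>j<N. w ^ j)"
    using w0 by (simp add: sum_distrib_left power_int_diff power_int_minus field_simps)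
  also have "\<dots> = (if w = 1 then of_nat N else 0)" using root_sum_zero[OF assms(1)] by auto
  finally show ?thesis .
qed

lemma peval_pfun: "peval p = pfun (Poly_Mapping.keys p) (Poly_Mapping.lookup p)"
  by (auto simp: peval_def pfun_def monom_at_def)

lemma polyfun_peval: "polyfun (peval p)"
  unfolding peval_pfun by (rule polyfun_pfun) simp

section \<open>Cones spanned by columns and the chambers between them\<close>

lemma scaleR_subcone:
  assumes "x \<in> subcone M J" "c \<ge> 0" shows "c *\<^sub>R x \<in> subcone M J"
proof -
  from assms obtain a where "x = (\<Sum>j\<in>J. a j *\<^sub>R rcol M j)" and nn: "\<forall>j\<in>J. 0 \<le> a j"
    by (auto simp: subcone_def)
  then have "c *\<^sub>R x = (\<Sum>j\<in>J. (c * a j) *\<^sub>R rcol M j)" by (simp add: scaleR_sum_right)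
  then show ?thesis unfolding subcone_def using nn assms
    by (intro CollectI exI[of _ "\<lambda>j. c * a j"]) auto
qed

text \<open>It is the convex cone hull of finitely many points. That the cuts are closed is what
  makes the fundamental cones open.\<close>

lemma closed_subcone: "closed (subcone M J)"
proof -
  let ?S = "subcone M J"
  have "?S = convex_cone hull (rcol M ` J)"
  proof
    show "?S \<subseteq> convex_cone hull (rcol M ` J)"
    proof
      fix x assume "x \<in> ?S"
      then obtain a where a: "x = (\<Sum>j\<in>J. a j *\<^sub>R rcol M j)" "\<forall>j\<in>J. 0 \<le> a j"
        by (auto simp: subcone_def)
      have "finite K \<Longrightarrow> K \<subseteq> J \<Longrightarrow> (\<Sum>j\<in>K. a j *\<^sub>R rcol M j) \<in> convex_cone hull (rcol M ` J)" for K
        by (induction K rule: finite_induct)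
          (use a(2) in \<open>auto simp: convex_cone_hull_contains_0 hull_inc
            intro!: convex_cone_hull_add convex_cone_hull_mul\<close>)
      then show "x \<in> convex_cone hull (rcol M ` J)" using a by simp
    qed
    show "convex_cone hull (rcol M ` J) \<subseteq> ?S"
    proof (rule hull_minimal)
      show "rcol M ` J \<subseteq> ?S"
      proof
        fix y assume "y \<in> rcol M ` J"
        then obtain i where i: "i \<in> J" "y = rcol M i" by auto
        have "(\<Sum>j\<in>J. (if j = i then 1 else 0) *\<^sub>R rcol M j) = (\<Sum>j\<in>J. if j = i then rcol M j else 0)"
          by (intro sum.cong) auto
        also have "\<dots> = y" using i by simp
        finally show "y \<in> ?S" unfolding subcone_def
          by (intro CollectI exI[of _ "\<lambda>j. if j = i then 1 else 0"]) auto
      qed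
      show "convex_cone ?S"
        unfolding convex_cone_iff
      proof (intro conjI ballI allI impI)
        show "0 \<in> ?S" by (auto simp: subcone_def intro: exI[of _ "\<lambda>_. 0"])
        show "x + y \<in> ?S" if xy: "x \<in> ?S" "y \<in> ?S" for x y
        proof -
          from xy obtain a b where "x = (\<Sum>j\<in>J. a j *\<^sub>R rcol M j)" "y = (\<Sum>j\<in>J. b j *\<^sub>R rcol M j)"
            and nn: "\<forall>j\<in>J. 0 \<le> a j" "\<forall>j\<in>J. 0 \<le> b j" by (auto simp: subcone_def)
          then have "x + y = (\<Sum>j\<in>J. (a j + b j) *\<^sub>R rcol M j)" by (simp add: scaleR_add_left sum.distrib)
          then show ?thesis unfolding subcone_def using nn by (intro CollectI exI[of _ "\<lambda>j. a j + b j"]) auto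
        qed
        show "c *\<^sub>R x \<in> ?S" if "x \<in> ?S" "c \<ge> 0" for c x
          using that by (rule scaleR_subcone)
      qed
    qed
  qed
  then show ?thesis by (simp add: closed_convex_cone_hull)
qed

lemma scaleR_cut_set:
  assumes "x \<in> cut_set M" "c \<ge> 0" shows "c *\<^sub>R x \<in> cut_set M"
  using assms unfolding cut_set_def by (auto intro: scaleR_subcone)

lemma subcone_UNIV: "subcone M UNIV = {rmat M *v u | u. \<forall>j. 0 \<le> u $ j}"
proof -
  have "x \<in> subcone M UNIV" if "x = rmat M *v u" "\<forall>j. 0 \<le> u $ j" for x u
    using that unfolding subcone_def rmat_mult by blast
  moreover have "\<exists>u. x = rmat M *v u \<and> (\<forall>j. 0 \<le> u $ j)" if "x \<in> subcone M UNIV" for x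
  proof -
    from that obtain a where "x = (\<Sum>j\<in>UNIV. a j *\<^sub>R rcol M j)" "\<forall>j. 0 \<le> a j" by (auto simp: subcone_def)
    then show ?thesis by (intro exI[of _ "vec_lambda a"]) (simp add: rmat_mult)
  qed
  ultimately show ?thesis by blast
qed

text \<open>The interior of the cone and the complement of the cuts are invariant under positive
  scaling, so the open ray through a point is a connected set that stays in one component.\<close>

lemma
  fixes M :: "int^'n^'s"
  assumes "\<Omega> \<in> fundamental_cones M"
  shows fundamental_cone_open: "open \<Omega>"
    and fundamental_cone_nonempty: "\<Omega> \<noteq> {}"
    and fundamental_cone_subset: "\<Omega> \<subseteq> interior (subcone M UNIV)"
    and fundamental_cone_scale: "x \<in> \<Omega> \<Longrightarrow> c > 0 \<Longrightarrow> c *\<^sub>R x \<in> \<Omega>"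
proof -
  let ?X = "interior (subcone M UNIV) - cut_set M"
  have \<Omega>: "\<Omega> \<in> components ?X" using assms by (simp add: fundamental_cones_def)
  have "closed (cut_set M)" unfolding cut_set_def by (intro closed_Union) (auto simp: closed_subcone)
  then have "open ?X" by auto
  then show "open \<Omega>" using \<Omega> open_components by blast
  show "\<Omega> \<noteq> {}" using \<Omega> in_components_nonempty by blast
  show "\<Omega> \<subseteq> interior (subcone M UNIV)" using in_components_subset[OF \<Omega>] by auto
  assume x: "x \<in> \<Omega>" and c: "c > 0"
  have sc: "t *\<^sub>R x \<in> ?X" if t: "t > 0" for t
  proof -
    have xX: "x \<in> ?X" using x in_components_subset[OF \<Omega>] by auto
    have "(*\<^sub>R) t ` interior (subcone M UNIV) \<subseteq> subcone M UNIV"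
      using interior_subset scaleR_subcone t by (fastforce)
    then have "(*\<^sub>R) t ` interior (subcone M UNIV) \<subseteq> interior (subcone M UNIV)"
      by (rule interior_maximal) (use t in \<open>auto intro: open_scaling\<close>)
    moreover have "t *\<^sub>R x \<notin> cut_set M"
    proof
      assume "t *\<^sub>R x \<in> cut_set M"
      from scaleR_cut_set[OF this, of "1/t"] t xX show False by auto
    qed
    ultimately show ?thesis using xX by auto
  qed
  let ?S = "(\<lambda>t. t *\<^sub>R x) ` {0<..}"
  have "connected ?S" by (intro connected_continuous_image continuous_intros connected_Ioi)
  moreover have "?S \<subseteq> ?X" using sc by auto
  moreover have "x \<in> ?S" by (rule image_eqI[of _ _ 1]) auto
  ultimately have "?S \<subseteq> \<Omega>"
    using components_maximal[OF \<Omega>, of ?S] x by blast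
  then show "c *\<^sub>R x \<in> \<Omega>" using c by auto
qed

section \<open>The distribution relation\<close>

text \<open>A hyperplane that separates the origin from the hull is positive on every column, so
  each coefficient of a nonnegative combination is controlled by its value. This bounds the integral
  as well as the real fibres of \<open>M\<close> over a point.\<close>

lemma positive_functional:
  fixes M :: "int^'n^'s"
  assumes "0 \<notin> convex hull (range (rcol M))"
  obtains h :: "real^'s" and \<delta> :: real
  where "\<delta> > 0" "\<And>u j. (\<And>j. 0 \<le> u $ j) \<Longrightarrow> \<delta> * u $ j \<le> h \<bullet> (rmat M *v u)"
proof -
  have "closed (convex hull (range (rcol M)))"
    by (intro compact_imp_closed finite_imp_compact_convex_hull) auto
  then obtain h \<delta> where h: "\<delta> > 0" "\<And>x. x \<in> convex hull (range (rcol M)) \<Longrightarrow> h \<bullet> x > \<delta>"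
    using separating_hyperplane_closed_0[OF convex_convex_hull _ assms] by metis
  have "\<delta> * u $ j \<le> h \<bullet> (rmat M *v u)" if "\<And>j. 0 \<le> u $ j" for u j
  proof -
    have hm: "\<delta> \<le> h \<bullet> rcol M j" for j using h(2)[OF hull_inc, of "rcol M j"] by (simp add: less_imp_le)
    have "\<delta> * u $ j \<le> u $ j * (h \<bullet> rcol M j)" using hm[of j] that[of j] by (metis mult.commute mult_left_mono)
    also have "\<dots> \<le> (\<Sum>j\<in>UNIV. u $ j * (h \<bullet> rcol M j))"
      by (rule member_le_sum) (use that h(1) order.trans[OF less_imp_le[OF h(1)] hm] in auto)
    also have "\<dots> = h \<bullet> (rmat M *v u)" by (simp add: rmat_mult inner_sum_right)
    finally show ?thesis .
  qed
  with h(1) show ?thesis by (rule that)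
qed

lemma finite_fibre:
  fixes M :: "int^'n^'s"
  assumes "0 \<notin> convex hull (range (rcol M))"
  shows "finite {\<beta>. lattice_image M \<beta> = \<alpha>}"
proof -
  obtain h \<delta> where h: "\<delta> > 0" "\<And>u j. (\<And>j. 0 \<le> u $ j) \<Longrightarrow> \<delta> * u $ j \<le> h \<bullet> (rmat M *v u)"
    using positive_functional[OF assms] by metis
  have "{\<beta>. lattice_image M \<beta> = \<alpha>} \<subseteq> {\<beta>. \<forall>j. \<beta> $ j \<in> {..nat \<lceil>(h \<bullet> rvec \<alpha>) / \<delta>\<rceil>}}"
  proof (rule subsetI, rule CollectI, rule allI)
    fix \<beta> j assume "\<beta> \<in> {\<beta>. lattice_image M \<beta> = \<alpha>}"
    then have eq: "\<alpha> = lattice_image M \<beta>" by simp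
    have "\<delta> * real (\<beta> $ j) \<le> h \<bullet> rvec (lattice_image M \<beta>)"
      using h(2)[of "\<chi> j. real (\<beta> $ j)" j] by (simp add: rvec_lattice_image)
    then have "real (\<beta> $ j) \<le> (h \<bullet> rvec (lattice_image M \<beta>)) / \<delta>" using h(1) by (simp add: field_simps)
    then show "\<beta> $ j \<in> {..nat \<lceil>(h \<bullet> rvec \<alpha>) / \<delta>\<rceil>}"
      unfolding eq by (metis atMost_iff ceiling_mono ceiling_of_nat nat_int nat_mono)
  qed
  moreover have "finite {\<beta> :: nat^'n. \<forall>j. \<beta> $ j \<in> {..nat \<lceil>(h \<bullet> rvec \<alpha>) / \<delta>\<rceil>}}"
    by (rule finite_vec_box) auto
  ultimately show ?thesis by (rule finite_subset)
qed

section \<open>Splitting lattice points by parity\<close>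

lemma discrete_truncated_power_card: "discrete_truncated_power M \<alpha> = card {\<beta>. lattice_image M \<beta> = \<alpha>}"
  by (simp add: discrete_truncated_power_def lattice_image_def)

text \<open>Used only at vectors with even entries, where it is the exact half.\<close>

definition half :: "int^'s \<Rightarrow> int^'s" where "half x = (\<chi> i. x $ i div 2)"

definition bits :: "(nat^'n) set" where "bits = {\<gamma>. \<forall>j. \<gamma> $ j \<in> {..<2}}"

lemma finite_bits: "finite bits"
  unfolding bits_def by (rule finite_vec_box) auto

lemma discrete_truncated_power_split:
  fixes M :: "int^'n^'s"
  assumes "0 \<notin> convex hull (range (rcol M))"
  shows "discrete_truncated_power M x = (\<Sum>\<gamma>\<in>bits.
    if \<forall>i. even ((x - lattice_image M \<gamma>) $ i) then discrete_truncated_power M (half (x - lattice_image M \<gamma>)) else 0)"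
proof -
  define S where "S \<gamma> = {\<beta>. lattice_image M \<beta> = x \<and> (\<chi> j. \<beta> $ j mod 2) = \<gamma>}" for \<gamma>
  define g where "g \<gamma> \<beta> = (\<chi> j. \<gamma> $ j + 2 * \<beta> $ j)" for \<gamma> \<beta> :: "nat^'n"
  have mg: "lattice_image M (g \<gamma> \<beta>) $ i = lattice_image M \<gamma> $ i + 2 * lattice_image M \<beta> $ i" for \<gamma> \<beta> i
    by (simp add: lattice_image_nth g_def algebra_simps sum.distrib sum_distrib_left)
  have "{\<beta>. lattice_image M \<beta> = x} = (\<Union>\<gamma>\<in>bits. S \<gamma>)" by (auto simp: S_def bits_def)
  then have "discrete_truncated_power M x = card (\<Union>\<gamma>\<in>bits. S \<gamma>)" by (simp add: discrete_truncated_power_card)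
  also have "\<dots> = (\<Sum>\<gamma>\<in>bits. card (S \<gamma>))"
  proof (rule card_UN_disjoint)
    show "\<forall>\<gamma>\<in>bits. finite (S \<gamma>)"
      using finite_fibre[OF assms, of x] by (auto simp: S_def intro: rev_finite_subset)
  qed (auto simp: finite_bits S_def)
  also have "\<dots> = (\<Sum>\<gamma>\<in>bits.
    if \<forall>i. even ((x - lattice_image M \<gamma>) $ i) then discrete_truncated_power M (half (x - lattice_image M \<gamma>)) else 0)"
  proof (rule sum.cong[OF refl])
    fix \<gamma> :: "nat^'n" assume \<gamma>: "\<gamma> \<in> bits"
    \<comment> \<open>The points of parity \<gamma> in the fibre are the
      \<open>\<gamma> + 2 \<beta>'\<close> with \<open>2 M \<beta>' = x - M \<gamma>\<close>; there
      are none if some coordinate on the right is odd.\<close>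
    have SE: "S \<gamma> = g \<gamma> ` {\<beta>. \<forall>i. (x - lattice_image M \<gamma>) $ i = 2 * lattice_image M \<beta> $ i}"
    proof (rule antisym; rule subsetI)
      fix \<beta> assume \<beta>: "\<beta> \<in> S \<gamma>"
      have "\<gamma> = (\<chi> j. \<beta> $ j mod 2)" using \<beta> by (simp add: S_def)
      then have "\<beta> = g \<gamma> (\<chi> j. \<beta> $ j div 2)" by (simp add: g_def vec_eq_iff)
      moreover from this have "(x - lattice_image M \<gamma>) $ i = 2 * lattice_image M (\<chi> j. \<beta> $ j div 2) $ i" for i
        using mg[of \<gamma> "\<chi> j. \<beta> $ j div 2" i] \<beta> by (simp add: S_def)
      ultimately show "\<beta> \<in> g \<gamma> ` {\<beta>. \<forall>i. (x - lattice_image M \<gamma>) $ i = 2 * lattice_image M \<beta> $ i}" by blast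
    next
      fix \<beta> assume "\<beta> \<in> g \<gamma> ` {\<beta>. \<forall>i. (x - lattice_image M \<gamma>) $ i = 2 * lattice_image M \<beta> $ i}"
      then obtain \<beta>' where b: "\<beta> = g \<gamma> \<beta>'" "\<And>i. (x - lattice_image M \<gamma>) $ i = 2 * lattice_image M \<beta>' $ i" by auto
      have "lattice_image M \<beta> $ i = x $ i" for i using b(2)[of i] by (simp add: b(1) mg)
      then show "\<beta> \<in> S \<gamma>" using \<gamma> by (auto simp: S_def vec_eq_iff b(1) g_def bits_def)
    qed
    show "card (S \<gamma>) = (if \<forall>i. even ((x - lattice_image M \<gamma>) $ i)
      then discrete_truncated_power M (half (x - lattice_image M \<gamma>)) else 0)"
    proof (cases "\<forall>i. even ((x - lattice_image M \<gamma>) $ i)")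
      case True
      have "{\<beta>. \<forall>i. (x - lattice_image M \<gamma>) $ i = 2 * lattice_image M \<beta> $ i} = {\<beta>. lattice_image M \<beta> = half (x - lattice_image M \<gamma>)}"
      proof (intro Collect_cong)
        fix \<beta> :: "nat^'n"
        have "(x - lattice_image M \<gamma>) $ i = 2 * lattice_image M \<beta> $ i \<longleftrightarrow> lattice_image M \<beta> $ i = half (x - lattice_image M \<gamma>) $ i" for i
          unfolding half_def using True[rule_format, of i] by auto
        then show "(\<forall>i. (x - lattice_image M \<gamma>) $ i = 2 * lattice_image M \<beta> $ i) \<longleftrightarrow> lattice_image M \<beta> = half (x - lattice_image M \<gamma>)"
          by (simp add: vec_eq_iff)
      qed
      moreover have "inj (g \<gamma>)" by (auto simp: inj_def g_def vec_eq_iff)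
      ultimately show ?thesis using True by (simp add: SE discrete_truncated_power_card card_image inj_on_subset)
    next
      case False
      then have "{\<beta>. \<forall>i. (x - lattice_image M \<gamma>) $ i = 2 * lattice_image M \<beta> $ i} = {}" by (metis (mono_tags, lifting) dvd_triv_left empty_Collect_eq)
      then have "S \<gamma> = {}" unfolding SE by (simp only: image_empty)
      then show ?thesis by (simp only: False if_False card.empty)
    qed
  qed
  finally show ?thesis .
qed

section \<open>Residue classes and the projection onto the trivial character\<close>

definition residues_box :: "nat \<Rightarrow> (int^'s) set" where
  "residues_box N = {r. \<forall>i. r $ i \<in> {0..<int N}}"

lemma finite_residues_box: "finite (residues_box N)"
  unfolding residues_box_def by (rule finite_vec_box) simp

locale chamber =
  fixes M :: "int^'n^'s" and \<Omega> :: "(real^'s) set" and f :: "int^'s \<Rightarrow> complex"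
    and P :: "complex^'s \<Rightarrow> 's cpoly"
  assumes spanning: "span (range (rcol M)) = UNIV"
    and hull: "0 \<notin> convex hull (range (rcol M))"
    and Omega: "\<Omega> \<in> fundamental_cones M"
    and f_agrees: "\<forall>\<alpha>\<in>v_set M \<Omega>. f \<alpha> = of_nat (discrete_truncated_power M \<alpha>)"
    and f_decomp: "\<forall>\<alpha>. f \<alpha> = (\<Sum>\<theta>\<in>A_set M. vpowi \<theta> \<alpha> * peval (P \<theta>) (cvec (rvec \<alpha>)))"
begin

text \<open>A common exponent of the characters in \<open>A_set M\<close>, so that their values
  depend only on residues modulo it.\<close>

definition char_order :: nat where
  "char_order = (SOME N. N > 0 \<and> (\<forall>\<theta> i. \<theta> \<in> A_set M \<longrightarrow> \<theta> $ i ^ N = 1))"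

lemma char_order: "char_order > 0" "\<theta> \<in> A_set M \<Longrightarrow> \<theta> $ i ^ char_order = 1"
proof -
  have "\<exists>N. N > 0 \<and> (\<forall>\<theta> i. \<theta> \<in> A_set M \<longrightarrow> \<theta> $ i ^ N = 1)" by (rule A_set_order[of M], rule exI) blast
  from someI_ex[OF this] show "char_order > 0" "\<theta> \<in> A_set M \<Longrightarrow> \<theta> $ i ^ char_order = 1"
    unfolding char_order_def by blast+
qed

definition one_vec :: "complex^'s" where "one_vec = (\<chi> i. 1)"

lemma one_vec_A: "one_vec \<in> A_set M"
proof -
  have "{j. vpowi one_vec (column j M) = 1} = UNIV" by (auto simp: vpowi_def one_vec_def)
  then show ?thesis using spanning by (simp add: A_set_def one_vec_def)
qed

lemma vpowi_cong:
  assumes "\<theta> \<in> A_set M" "\<forall>i. r $ i mod int char_order = r' $ i mod int char_order"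
  shows "vpowi \<theta> r = vpowi \<theta> r'"
  unfolding vpowi_def
proof (intro prod.cong refl)
  fix i
  have nz: "\<theta> $ i \<noteq> 0" using assms by (auto simp: A_set_def)
  have *: "\<theta> $ i powi k = \<theta> $ i powi (k mod int char_order)" for k
  proof -
    have "\<theta> $ i powi k = \<theta> $ i powi (int char_order * (k div int char_order) + k mod int char_order)" by simp
    also have "\<dots> = (\<theta> $ i powi int char_order) powi (k div int char_order) * \<theta> $ i powi (k mod int char_order)"
      by (simp only: power_int_add[OF disjI1[OF nz]] power_int_mult)
    also have "\<theta> $ i powi int char_order = 1" using char_order(2)[OF assms(1)] by simp
    finally show ?thesis by simp
  qed
  show "\<theta> $ i powi (r $ i) = \<theta> $ i powi (r' $ i)"
    using *[of "r $ i"] *[of "r' $ i"] assms(2) by simp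
qed

text \<open>A residue modulo twice the order determines both the parity of a number and, if it is
  even, the residue of its half modulo the order.\<close>

definition period :: nat where "period = 2 * char_order"

lemma period_pos: "period > 0" using char_order(1) by (simp add: period_def)

text \<open>Orthogonality of characters: the sum factors over the coordinates, and a coordinate
  different from 1 is a nontrivial root of unity whose powers cancel over full periods.\<close>

lemma sum_vpowi:
  assumes \<theta>: "\<theta> \<in> A_set M"
  shows "(\<Sum>r\<in>residues_box period. vpowi \<theta> r) = (if \<theta> = one_vec then of_nat period ^ CARD('s) else 0)"
proof -
  have "(\<Sum>r\<in>residues_box period. vpowi \<theta> r) = (\<Prod>i\<in>UNIV. \<Sum>k\<in>{0..<2 * int char_order}. \<theta> $ i powi k)"
    unfolding vpowi_def residues_box_def period_def of_nat_mult of_nat_numeral by (rule sum_vec_prod) auto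
  also have "\<dots> = (\<Prod>i\<in>UNIV. if \<theta> $ i = 1 then of_nat period else 0)"
    by (simp add: root_sum char_order(2)[OF \<theta>] period_def cong: if_cong)
  also have "\<dots> = (if \<theta> = one_vec then of_nat period ^ CARD('s) else 0)"
    by (auto simp: one_vec_def vec_eq_iff)
  finally show ?thesis .
qed

text \<open>On the residue class of \<open>r\<close> modulo the order of the characters, \<open>f\<close> is this polynomial.\<close>

definition class_poly :: "int^'s \<Rightarrow> complex^'s \<Rightarrow> complex" where
  "class_poly r z = (\<Sum>\<theta>\<in>A_set M. vpowi \<theta> r * peval (P \<theta>) z)"

definition e_poly :: "complex^'s \<Rightarrow> complex" where "e_poly = peval (P one_vec)"

lemma class_poly_cong: "\<forall>i. r $ i mod int char_order = r' $ i mod int char_order \<Longrightarrow> class_poly r = class_poly r'"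
  unfolding class_poly_def by (intro ext sum.cong refl) (metis vpowi_cong)

lemma polyfun_class_poly: "polyfun (class_poly r)"
  unfolding class_poly_def by (intro polyfun_sum polyfun_mult polyfun_const polyfun_peval)

lemma f_class_poly: "f \<alpha> = class_poly \<alpha> (cvec (rvec \<alpha>))"
  using f_decomp by (simp add: class_poly_def)

lemma sum_class_poly: "(\<Sum>r\<in>residues_box period. class_poly r z) = of_nat period ^ CARD('s) * e_poly z"
proof -
  have "(\<Sum>r\<in>residues_box period. class_poly r z)
      = (\<Sum>\<theta>\<in>A_set M. (\<Sum>r\<in>residues_box period. vpowi \<theta> r) * peval (P \<theta>) z)"
    unfolding class_poly_def sum_distrib_right by (rule sum.swap)
  also have "\<dots> = (\<Sum>\<theta>\<in>A_set M. if \<theta> = one_vec then of_nat period ^ CARD('s) * e_poly z else 0)"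
    by (intro sum.cong refl, simp only: sum_vpowi) (simp add: e_poly_def)
  also have "\<dots> = of_nat period ^ CARD('s) * e_poly z"
    using one_vec_A finite_A_set[of M] by simp
  finally show ?thesis .
qed

text \<open>Of the classes modulo \<open>period\<close> only those with the parity of
  \<open>b\<close> count, and their halves run once through all classes modulo
  \<open>char_order\<close>. Hence the same projection as in \<open>sum_class_poly\<close>, with a
  smaller factor.\<close>

lemma sum_class_poly_half:
  "(\<Sum>r\<in>residues_box period. if \<forall>i. even ((r - b) $ i) then class_poly (half (r - b)) z else 0)
    = of_nat char_order ^ CARD('s) * e_poly z"
proof -
  let ?R = "residues_box period :: (int^'s) set"
  have s: "(\<Sum>r\<in>?R. if \<forall>i. even ((r - b) $ i) then vpowi \<theta> (half (r - b)) else 0)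
      = (if \<theta> = one_vec then of_nat char_order ^ CARD('s) else 0)" (is "?l = _")
    if \<theta>: "\<theta> \<in> A_set M" for \<theta>
  proof -
    have "?l = (\<Sum>r\<in>?R. \<Prod>i\<in>UNIV. if even (r $ i - b $ i) then \<theta> $ i powi ((r $ i - b $ i) div 2) else 0)"
      by (intro sum.cong refl) (auto simp: vpowi_def half_def)
    also have "\<dots> = (\<Prod>i\<in>UNIV. \<Sum>k\<in>{0..<2 * int char_order}. if even (k - b $ i) then \<theta> $ i powi ((k - b $ i) div 2) else 0)"
      unfolding residues_box_def period_def of_nat_mult of_nat_numeral
      by (rule sum_vec_prod[where g = "\<lambda>i k. if even (k - b $ i) then \<theta> $ i powi ((k - b $ i) div 2) else 0"]) auto
    also have "\<dots> = (\<Prod>i\<in>UNIV. if \<theta> $ i = 1 then of_nat char_order else 0)"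
      by (intro prod.cong refl root_half_sum char_order \<theta>)
    also have "\<dots> = (if \<theta> = one_vec then of_nat char_order ^ CARD('s) else 0)"
      by (auto simp: one_vec_def vec_eq_iff)
    finally show ?thesis .
  qed
  have "(\<Sum>r\<in>?R. if \<forall>i. even ((r - b) $ i) then class_poly (half (r - b)) z else 0)
      = (\<Sum>r\<in>?R. \<Sum>\<theta>\<in>A_set M. (if \<forall>i. even ((r - b) $ i) then vpowi \<theta> (half (r - b)) else 0) * peval (P \<theta>) z)"
  proof (rule sum.cong[OF refl])
    fix r
    show "(if \<forall>i. even ((r - b) $ i) then class_poly (half (r - b)) z else 0) = (\<Sum>\<theta>\<in>A_set M.
      (if \<forall>i. even ((r - b) $ i) then vpowi \<theta> (half (r - b)) else 0) * peval (P \<theta>) z)"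
      by (cases "\<forall>i. even ((r - b) $ i)")
        (simp_all only: class_poly_def if_True if_False mult_zero_left sum.neutral_const simp_thms)
  qed
  also have "\<dots> = (\<Sum>\<theta>\<in>A_set M. (\<Sum>r\<in>?R. if \<forall>i. even ((r - b) $ i) then vpowi \<theta> (half (r - b)) else 0) * peval (P \<theta>) z)"
    unfolding sum_distrib_right by (rule sum.swap)
  also have "\<dots> = (\<Sum>\<theta>\<in>A_set M. if \<theta> = one_vec then of_nat char_order ^ CARD('s) * e_poly z else 0)"
    by (intro sum.cong refl, simp only: s) (simp add: e_poly_def)
  also have "\<dots> = of_nat char_order ^ CARD('s) * e_poly z"
    using one_vec_A finite_A_set[of M] by simp
  finally show ?thesis .
qed

lemma v_set_minus: "rvec \<alpha> = w - rmat M *v u \<Longrightarrow> w \<in> \<Omega> \<Longrightarrow> (\<And>j. 0 \<le> u $ j \<and> u $ j \<le> 1) \<Longrightarrow> \<alpha> \<in> v_set M \<Omega>"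
  unfolding v_set_def zonotope_def by blast

lemma f_Omega:
  assumes "rvec \<alpha> \<in> \<Omega>" shows "f \<alpha> = of_nat (discrete_truncated_power M \<alpha>)"
proof -
  have "\<alpha> \<in> v_set M \<Omega>" by (rule v_set_minus[of _ "rvec \<alpha>" 0]) (use assms in auto)
  then show ?thesis using f_agrees by blast
qed

lemma rvec_half: "\<forall>i. even (y $ i) \<Longrightarrow> rvec (half y) = (1/2) *\<^sub>R rvec y"
  by (auto simp: vec_eq_iff half_def real_of_int_div)

text \<open>The half of \<open>x - M \<gamma>\<close> is \<open>x / 2 - M (\<gamma> / 2)\<close>,
  with \<open>x / 2\<close> in \<Omega> and the entries of \<open>\<gamma> / 2\<close> equal to 0 or
  1/2. So it lies in \<open>v_set M \<Omega>\<close> even if it leaves \<Omega>; this is where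
  agreement on the larger set enters.\<close>

lemma f_split:
  assumes x: "rvec x \<in> \<Omega>"
  shows "f x = (\<Sum>\<gamma>\<in>bits. if \<forall>i. even ((x - lattice_image M \<gamma>) $ i) then f (half (x - lattice_image M \<gamma>)) else 0)"
proof -
  have *: "f (half (x - lattice_image M \<gamma>)) = of_nat (discrete_truncated_power M (half (x - lattice_image M \<gamma>)))"
    if "\<gamma> \<in> bits" "\<forall>i. even ((x - lattice_image M \<gamma>) $ i)" for \<gamma>
  proof -
    have "half (x - lattice_image M \<gamma>) \<in> v_set M \<Omega>"
    proof (rule v_set_minus)
      show "rvec (half (x - lattice_image M \<gamma>)) = (1/2) *\<^sub>R rvec x - rmat M *v (\<chi> j. \<gamma> $ j / 2)"
        by (subst rvec_half[OF that(2)])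
          (simp add: rvec_diff rvec_lattice_image vec_eq_iff matrix_vector_mult_def sum_divide_distrib diff_divide_distrib)
      show "(1/2) *\<^sub>R rvec x \<in> \<Omega>" by (rule fundamental_cone_scale[OF Omega x]) simp
      show "0 \<le> (\<chi> j. real (\<gamma> $ j) / 2) $ j \<and> (\<chi> j. real (\<gamma> $ j) / 2) $ j \<le> 1" for j
        using that(1) by (auto simp: bits_def dest!: spec[of _ j])
    qed
    then show ?thesis using f_agrees by blast
  qed
  have "f x = of_nat (\<Sum>\<gamma>\<in>bits. if \<forall>i. even ((x - lattice_image M \<gamma>) $ i)
      then discrete_truncated_power M (half (x - lattice_image M \<gamma>)) else 0)"
    using f_Omega[OF x] discrete_truncated_power_split[OF hull, of x] by simp
  also have "\<dots> = (\<Sum>\<gamma>\<in>bits. if \<forall>i. even ((x - lattice_image M \<gamma>) $ i) then f (half (x - lattice_image M \<gamma>)) else 0)"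
    unfolding of_nat_sum by (intro sum.cong refl) (auto simp: *)
  finally show ?thesis .
qed

section \<open>The halving relation for polynomials\<close>

definition halfshift :: "nat^'n \<Rightarrow> complex^'s \<Rightarrow> complex^'s" where
  "halfshift \<gamma> z = (\<chi> i. (z $ i - of_int (lattice_image M \<gamma> $ i)) / 2)"

lemma mod_half:
  fixes a b c :: int
  assumes "a mod (2 * n) = b mod (2 * n)"
  shows "even (a - c) \<longleftrightarrow> even (b - c)"
    and "even (a - c) \<Longrightarrow> ((a - c) div 2) mod n = ((b - c) div 2) mod n"
proof -
  obtain k where k: "a = b + 2 * n * k"
    using assms by (metis mod_eqE mult.commute add.commute diff_eq_eq)
  show ev: "even (a - c) \<longleftrightarrow> even (b - c)" by (simp add: k)
  assume "even (a - c)"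
  then obtain l where "b - c = 2 * l" unfolding ev by (elim evenE)
  then have "b - c = 2 * l" "a - c = 2 * (l + n * k)" by (auto simp: k algebra_simps)
  then show "((a - c) div 2) mod n = ((b - c) div 2) mod n" by simp
qed

text \<open>Both sides are polynomials in \<open>z\<close>. They agree at the lattice points of
  \<Omega> congruent to \<open>r\<close> modulo twice the order, where the parities and the classes
  of the halves are constant, and these points determine a polynomial.\<close>

lemma class_poly_split:
  "class_poly r z = (\<Sum>\<gamma>\<in>bits. if \<forall>i. even ((r - lattice_image M \<gamma>) $ i)
    then class_poly (half (r - lattice_image M \<gamma>)) (halfshift \<gamma> z) else 0)"
proof -
  \<comment> \<open>The parity condition is written as a factor 0 or 1, which keeps \<open>F\<close>
    visibly polynomial.\<close>
  define F where "F z = class_poly r z - (\<Sum>\<gamma>\<in>bits. (if \<forall>i. even ((r - lattice_image M \<gamma>) $ i) then 1 else 0)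
    * class_poly (half (r - lattice_image M \<gamma>)) (halfshift \<gamma> z))" for z
  have hs: "polyfun (\<lambda>z. class_poly r' (halfshift \<gamma> z))" for r' \<gamma>
  proof (rule polyfun_subst[OF polyfun_class_poly])
    show "polyfun (\<lambda>z. halfshift \<gamma> z $ i)" for i
      unfolding halfshift_def vec_lambda_beta divide_inverse
      by (rule polyfun_mult[OF polyfun_diff[OF polyfun_coord polyfun_const] polyfun_const])
  qed
  have "polyfun F"
    unfolding F_def
    by (rule polyfun_diff[OF polyfun_class_poly polyfun_sum[OF polyfun_mult[OF polyfun_const hs]]])
  have "F z = 0"
  proof (rule polyfun_cone_zero[of \<Omega> "2 * char_order" F r])
    show "open \<Omega>" "\<Omega> \<noteq> {}" "\<And>x c. x \<in> \<Omega> \<Longrightarrow> c > 0 \<Longrightarrow> c *\<^sub>R x \<in> \<Omega>"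
      using fundamental_cone_open[OF Omega] fundamental_cone_nonempty[OF Omega] fundamental_cone_scale[OF Omega] by auto
    show "polyfun F" by fact
    show "2 * char_order > 0" using char_order by simp
    fix \<alpha> assume \<alpha>: "rvec \<alpha> \<in> \<Omega>" and r: "\<forall>i. \<alpha> $ i mod int (2 * char_order) = r $ i mod int (2 * char_order)"
    have r': "\<alpha> $ i mod (2 * int char_order) = r $ i mod (2 * int char_order)" for i using r by simp
    have "\<forall>i. \<alpha> $ i mod int char_order = r $ i mod int char_order"
    proof
      fix i
      have "\<alpha> $ i mod (2 * int char_order) mod int char_order = r $ i mod (2 * int char_order) mod int char_order"
        by (simp only: r')
      then show "\<alpha> $ i mod int char_order = r $ i mod int char_order" by (simp add: mod_mod_cancel)
    qed
    then have "class_poly r (cvec (rvec \<alpha>)) = f \<alpha>" by (simp add: f_class_poly class_poly_cong[of \<alpha> r])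
    also have "\<dots> = (\<Sum>\<gamma>\<in>bits. if \<forall>i. even ((\<alpha> - lattice_image M \<gamma>) $ i) then f (half (\<alpha> - lattice_image M \<gamma>)) else 0)"
      by (rule f_split[OF \<alpha>])
    also have "\<dots> = (\<Sum>\<gamma>\<in>bits. (if \<forall>i. even ((r - lattice_image M \<gamma>) $ i) then 1 else 0)
      * class_poly (half (r - lattice_image M \<gamma>)) (halfshift \<gamma> (cvec (rvec \<alpha>))))"
    proof (rule sum.cong[OF refl])
      fix \<gamma> :: "nat^'n"
      have ev: "(\<forall>i. even ((\<alpha> - lattice_image M \<gamma>) $ i)) \<longleftrightarrow> (\<forall>i. even ((r - lattice_image M \<gamma>) $ i))"
        using mod_half(1)[OF r'] by simp
      show "(if \<forall>i. even ((\<alpha> - lattice_image M \<gamma>) $ i) then f (half (\<alpha> - lattice_image M \<gamma>)) else 0)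
        = (if \<forall>i. even ((r - lattice_image M \<gamma>) $ i) then 1 else 0)
        * class_poly (half (r - lattice_image M \<gamma>)) (halfshift \<gamma> (cvec (rvec \<alpha>)))"
      proof (cases "\<forall>i. even ((\<alpha> - lattice_image M \<gamma>) $ i)")
        case True
        have "\<forall>i. half (\<alpha> - lattice_image M \<gamma>) $ i mod int char_order = half (r - lattice_image M \<gamma>) $ i mod int char_order"
          using True mod_half(2)[OF r'] by (simp add: half_def)
        then have "class_poly (half (\<alpha> - lattice_image M \<gamma>)) = class_poly (half (r - lattice_image M \<gamma>))" by (rule class_poly_cong)
        moreover have "cvec (rvec (half (\<alpha> - lattice_image M \<gamma>))) = halfshift \<gamma> (cvec (rvec \<alpha>))"
          unfolding rvec_half[OF True] by (simp add: vec_eq_iff halfshift_def)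
        ultimately have "f (half (\<alpha> - lattice_image M \<gamma>)) = class_poly (half (r - lattice_image M \<gamma>)) (halfshift \<gamma> (cvec (rvec \<alpha>)))"
          by (simp add: f_class_poly)
        then show ?thesis by (simp only: ev[symmetric] if_P[OF True] mult_1)
      next
        case False
        then show ?thesis by (simp only: ev[symmetric] if_not_P mult_zero_left simp_thms)
      qed
    qed
    finally show "F (cvec (rvec \<alpha>)) = 0" by (simp add: F_def)
  qed
  then have "class_poly r z = (\<Sum>\<gamma>\<in>bits. (if \<forall>i. even ((r - lattice_image M \<gamma>) $ i) then 1 else 0)
    * class_poly (half (r - lattice_image M \<gamma>)) (halfshift \<gamma> z))" by (simp add: F_def)
  also have "\<dots> = (\<Sum>\<gamma>\<in>bits. if \<forall>i. even ((r - lattice_image M \<gamma>) $ i)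
    then class_poly (half (r - lattice_image M \<gamma>)) (halfshift \<gamma> z) else 0)"
    by (intro sum.cong refl) auto
  finally show ?thesis .
qed

text \<open>Summed over the classes modulo \<open>period\<close>, the left side counts the trivial
  component \<open>(2 * char_order) ^ s\<close> times, each term on the right
  \<open>char_order ^ s\<close> times.\<close>

lemma e_poly_split: "2 ^ CARD('s) * e_poly z = (\<Sum>\<gamma>\<in>bits. e_poly (halfshift \<gamma> z))"
proof -
  have "of_nat period ^ CARD('s) * e_poly z = (\<Sum>r\<in>residues_box period. class_poly r z)" by (rule sum_class_poly[symmetric])
  also have "\<dots> = (\<Sum>\<gamma>\<in>bits. \<Sum>r\<in>residues_box period. if \<forall>i. even ((r - lattice_image M \<gamma>) $ i)
    then class_poly (half (r - lattice_image M \<gamma>)) (halfshift \<gamma> z) else 0)"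
    by (subst class_poly_split) (rule sum.swap)
  also have "\<dots> = of_nat char_order ^ CARD('s) * (\<Sum>\<gamma>\<in>bits. e_poly (halfshift \<gamma> z))"
    by (simp only: sum_class_poly_half sum_distrib_left)
  finally show ?thesis using char_order(1) by (simp add: period_def power_mult_distrib)
qed

end

section \<open>Derivatives of exponential integrals\<close>

lemma prod_Basis_vec:
  fixes f :: "real^'n"
  shows "(\<Prod>b\<in>Basis. f \<bullet> b) = (\<Prod>j\<in>UNIV. f $ j)"
proof -
  have "bij_betw (\<lambda>j. axis j (1::real)) UNIV (Basis :: (real^'n) set)"
    by (auto simp: bij_betw_def inj_def axis_eq_axis Basis_vec_def)
  from prod.reindex_bij_betw[OF this, of "\<lambda>b. f \<bullet> b", symmetric] show ?thesis
    by (simp add: inner_axis)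
qed

text \<open>The index set \<open>I\<close> is left general: it is the coordinate type itself for
  integrals over the cube, and an orthonormal basis for the fibre volumes.\<close>

lemma lborel_vec_PiM:
  fixes \<phi> :: "'n::finite \<Rightarrow> 'i"
  assumes \<phi>: "bij_betw \<phi> UNIV I"
  shows "(\<lambda>c. \<chi> j. c (\<phi> j)) \<in> borel_measurable (Pi\<^sub>M I (\<lambda>_. lborel :: real measure))"
    and "(lborel :: (real^'n) measure) = distr (Pi\<^sub>M I (\<lambda>_. lborel)) borel (\<lambda>c. \<chi> j. c (\<phi> j))"
proof -
  interpret product_sigma_finite "\<lambda>_::'i. lborel :: real measure"
    by (simp add: product_sigma_finite_def sigma_finite_lborel)
  have fin: "finite I" using bij_betw_finite[OF \<phi>] by simp
  have mem: "\<phi> j \<in> I" for j using \<phi> by (auto simp: bij_betw_def)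
  show meas: "(\<lambda>c. \<chi> j. c (\<phi> j)) \<in> borel_measurable (Pi\<^sub>M I (\<lambda>_. lborel :: real measure))"
  proof (subst borel_measurable_euclidean_space, rule ballI)
    fix b :: "real^'n" assume "b \<in> Basis"
    then obtain j where "b = axis j 1" by (auto simp: Basis_vec_def)
    then show "(\<lambda>c. (\<chi> j. c (\<phi> j)) \<bullet> b) \<in> borel_measurable (Pi\<^sub>M I (\<lambda>_. lborel))"
      using measurable_component_singleton[OF mem[of j], of "\<lambda>_. lborel :: real measure"]
      by (simp add: inner_axis)
  qed
  show "(lborel :: (real^'n) measure) = distr (Pi\<^sub>M I (\<lambda>_. lborel)) borel (\<lambda>c. \<chi> j. c (\<phi> j))"
  proof (rule lborel_eqI)
    fix l u :: "real^'n" assume lu: "\<And>b. b \<in> Basis \<Longrightarrow> l \<bullet> b \<le> u \<bullet> b"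
    then have lu': "l $ j \<le> u $ j" for j using lu[of "axis j 1"] by (auto simp: inner_axis Basis_vec_def)
    let ?\<psi> = "inv_into UNIV \<phi>"
    have inj: "?\<psi> (\<phi> j) = j" for j using \<phi> by (simp add: bij_betw_def inv_into_f_f)
    have "(\<lambda>c. \<chi> j. c (\<phi> j)) -` box l u \<inter> space (Pi\<^sub>M I (\<lambda>_. lborel))
        = PiE I (\<lambda>i. {l $ ?\<psi> i<..<u $ ?\<psi> i})"
    proof -
      have I: "I = \<phi> ` UNIV" using \<phi> by (auto simp: bij_betw_def)
      show ?thesis unfolding I by (auto simp: space_PiM mem_box_cart PiE_iff inj)
    qed
    then have "emeasure (distr (Pi\<^sub>M I (\<lambda>_. lborel)) borel (\<lambda>c. \<chi> j. c (\<phi> j))) (box l u)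
        = emeasure (Pi\<^sub>M I (\<lambda>_. lborel)) (PiE I (\<lambda>i. {l $ ?\<psi> i<..<u $ ?\<psi> i}))"
      using meas by (simp add: emeasure_distr)
    also have "\<dots> = (\<Prod>i\<in>I. emeasure lborel {l $ ?\<psi> i<..<u $ ?\<psi> i})"
      by (rule emeasure_PiM) (auto simp: fin)
    also have "\<dots> = (\<Prod>j\<in>UNIV. emeasure lborel {l $ j<..<u $ j})"
      by (subst prod.reindex_bij_betw[OF \<phi>, symmetric]) (simp add: inj)
    also have "\<dots> = ennreal (\<Prod>j\<in>UNIV. u $ j - l $ j)"
      using lu' by (simp add: prod_ennreal)
    also have "(\<Prod>j\<in>UNIV. u $ j - l $ j) = (\<Prod>b\<in>Basis. (u - l) \<bullet> b)"
      by (simp add: prod_Basis_vec)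
    finally show "emeasure (distr (Pi\<^sub>M I (\<lambda>_. lborel)) borel (\<lambda>c. \<chi> j. c (\<phi> j))) (box l u)
        = ennreal (\<Prod>b\<in>Basis. (u - l) \<bullet> b)" .
  qed simp
qed

definition cubeint :: "(real^'n \<Rightarrow> complex) \<Rightarrow> complex" where
  "cubeint = integral (cbox 0 (\<chi> i. 1))"

text \<open>Fubini, after the indicator of the cube is written as a product of indicators of
  intervals.\<close>

lemma cubeint_prod:
  fixes g :: "'n::finite \<Rightarrow> real \<Rightarrow> complex"
  assumes "\<And>j. continuous_on UNIV (g j)"
  shows "cubeint (\<lambda>t. \<Prod>j\<in>UNIV. g j (t $ j)) = (\<Prod>j\<in>UNIV. integral {0..1} (g j))"
proof -
  interpret product_sigma_finite "\<lambda>_::'n. lborel :: real measure"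
    by (simp add: product_sigma_finite_def sigma_finite_lborel)
  let ?C = "cbox 0 (\<chi> i. 1) :: (real^'n) set"
  let ?G = "\<lambda>t. \<Prod>j\<in>UNIV. g j (t $ j)"
  have cg: "continuous_on ?C ?G"
    by (intro continuous_intros continuous_on_compose2[OF assms]) auto
  have int1: "set_integrable lborel {0..1} (g j)" for j
    unfolding set_integrable_def
    by (rule borel_integrable_compact) (auto intro: continuous_on_subset[OF assms])
  have "cubeint ?G = (LINT t:?C|lborel. ?G t)"
    unfolding cubeint_def
    by (rule set_borel_integral_eq_integral(2)[symmetric])
      (unfold set_integrable_def, rule borel_integrable_compact[OF compact_cbox cg])
  also have "\<dots> = (LINT t|lborel. (\<Prod>j\<in>UNIV. indicator {0..1} (t $ j) *\<^sub>R g j (t $ j)))"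
    unfolding set_lebesgue_integral_def
  proof (rule Bochner_Integration.integral_cong[OF refl])
    fix t :: "real^'n"
    show "indicator ?C t *\<^sub>R ?G t = (\<Prod>j\<in>UNIV. indicator {0..1} (t $ j) *\<^sub>R g j (t $ j))"
    proof (cases "t \<in> ?C")
      case True
      then show ?thesis by (auto simp: mem_box_cart)
    next
      case False
      then obtain j where "t $ j \<notin> {0..1}" by (auto simp: mem_box_cart)
      then have "(\<Prod>j\<in>UNIV. indicator {0..1} (t $ j) *\<^sub>R g j (t $ j)) = 0"
        by (intro prod_zero[OF finite] bexI[of _ j]) simp_all
      with False show ?thesis by simp
    qed
  qed
  also have "\<dots> = (LINT c|Pi\<^sub>M UNIV (\<lambda>_. lborel). (\<Prod>j\<in>UNIV. indicator {0..1} (c j) *\<^sub>R g j (c j)))"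
  proof -
    have gm: "(\<lambda>x. indicator {0..1} x *\<^sub>R g j x) \<in> borel_measurable borel" for j
      using borel_measurable_integrable[OF int1[of j, unfolded set_integrable_def]] by simp
    have nth: "(\<lambda>t::real^'n. t $ j) \<in> borel_measurable borel" for j
      by (intro borel_measurable_continuous_onI continuous_intros)
    have "(\<lambda>t. \<Prod>j\<in>UNIV. indicator {0..1} (t $ j) *\<^sub>R g j (t $ j)) \<in> borel_measurable borel"
      by (intro borel_measurable_prod measurable_compose[OF nth gm])
    from integral_distr[OF lborel_vec_PiM(1)[of id UNIV] this] show ?thesis
      unfolding lborel_vec_PiM(2)[of id UNIV, OF bij_betw_id] by simp
  qed
  also have "\<dots> = (\<Prod>j\<in>UNIV. LINT x|lborel. indicator {0..1} x *\<^sub>R g j x)"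
    by (rule product_integral_prod) (use int1 in \<open>auto simp: set_integrable_def\<close>)
  also have "\<dots> = (\<Prod>j\<in>UNIV. integral {0..1} (g j))"
    using set_borel_integral_eq_integral(2)[OF int1] by (simp add: set_lebesgue_integral_def)
  finally show ?thesis .
qed

text \<open>\<open>c\<close> counts the derivatives taken so far in each direction. The falling
  factorial is written as \<open>fact\<close> times a binomial, ready for the division by
  \<open>u!\<close> in Taylor's formula; the binomial vanishes where the truncated difference of
  exponents would be wrong.\<close>

lemma partial_deriv_pfun:
  fixes a :: "nat^'s \<Rightarrow> complex"
  assumes "finite U"
  shows "partial_deriv i (\<lambda>z. \<Sum>u\<in>U. a u * (\<Prod>j\<in>UNIV. fact (c j) * of_nat (u $ j choose c j) * z $ j ^ (u $ j - c j)))
    = (\<lambda>z. \<Sum>u\<in>U. a u * (\<Prod>j\<in>UNIV. fact ((c(i := Suc (c i))) j) * of_nat (u $ j choose (c(i := Suc (c i))) j)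
        * z $ j ^ (u $ j - (c(i := Suc (c i))) j)))" (is "partial_deriv i ?F = ?G")
proof
  fix z :: "complex^'s"
  let ?c = "c(i := Suc (c i))"
  let ?h = "\<lambda>c u j x. fact (c j) * of_nat (u $ j choose c j) * x ^ (u $ j - c j) :: complex"
  have split: "(\<Prod>j\<in>UNIV. ?h d u j (y $ j)) = ?h d u i (y $ i) * (\<Prod>j\<in>UNIV-{i}. ?h d u j (y $ j))"
    for d u and y :: "complex^'s" by (rule prod.remove) auto
  have one: "((\<lambda>t. ?h c u i (z $ i + t)) has_field_derivative ?h ?c u i (z $ i)) (at 0)" for u
  proof -
    have "real (Suc k) * real (m choose Suc k) = real (m choose k) * real (m - k)" for m k
      by (metis binomial_absorb_comp binomial_absorption mult.commute of_nat_mult times_binomial_minus1_eq diff_Suc_1 zero_less_Suc)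
    then have bin: "of_nat (Suc k) * of_nat (m choose Suc k) = (of_nat (m choose k) * of_nat (m - k) :: complex)" for m k
      by (metis of_nat_eq_iff of_nat_mult)
    have "((\<lambda>t. (z $ i + t) ^ (u $ i - c i)) has_field_derivative of_nat (u $ i - c i) * (z $ i) ^ (u $ i - c i - 1)) (at 0)"
      by (auto intro!: derivative_eq_intros)
    from DERIV_cmult[OF this, of "fact (c i) * of_nat (u $ i choose c i)"]
    have "((\<lambda>t. ?h c u i (z $ i + t)) has_field_derivative
      fact (c i) * of_nat (u $ i choose c i) * (of_nat (u $ i - c i) * (z $ i) ^ (u $ i - c i - 1))) (at 0)" .
    moreover have "fact (c i) * of_nat (u $ i choose c i) * (of_nat (u $ i - c i) * (z $ i) ^ (u $ i - c i - 1))
      = fact (c i) * (of_nat (u $ i choose c i) * of_nat (u $ i - c i)) * (z $ i) ^ (u $ i - Suc (c i))"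
      by (simp add: mult.assoc)
    moreover have "\<dots> = ?h ?c u i (z $ i)"
      unfolding bin[symmetric] by (simp add: algebra_simps)
    ultimately show ?thesis by (simp only:)
  qed
  have "((\<lambda>t. ?F (z + axis i t)) has_field_derivative ?G z) (at 0)"
  proof (rule DERIV_sum)
    fix u
    have p: "(\<Prod>j\<in>UNIV-{i}. ?h c u j ((z + axis i t) $ j)) = (\<Prod>j\<in>UNIV-{i}. ?h ?c u j (z $ j))" for t
      by (rule prod.cong) (auto simp: axis_def)
    have "(\<lambda>t. a u * (\<Prod>j\<in>UNIV. ?h c u j ((z + axis i t) $ j)))
      = (\<lambda>t. a u * (\<Prod>j\<in>UNIV-{i}. ?h ?c u j (z $ j)) * ?h c u i (z $ i + t))"
      by (rule ext, subst split, subst p) (simp add: axis_def)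
    moreover have "a u * (\<Prod>j\<in>UNIV. ?h ?c u j (z $ j)) = a u * (\<Prod>j\<in>UNIV-{i}. ?h ?c u j (z $ j)) * ?h ?c u i (z $ i)"
      by (subst split) simp
    ultimately show "((\<lambda>t. a u * (\<Prod>j\<in>UNIV. ?h c u j ((z + axis i t) $ j))) has_field_derivative
        a u * (\<Prod>j\<in>UNIV. ?h ?c u j (z $ j))) (at 0)"
      by (simp only:) (rule DERIV_cmult[OF one])
  qed
  then show "partial_deriv i ?F z = ?G z"
    unfolding partial_deriv_def by (rule DERIV_imp_deriv)
qed

lemma exists_count_list: "\<exists>is. \<forall>i. count_list is i = (u :: nat^'s) $ i"
proof -
  have "finite S \<Longrightarrow> \<exists>is. \<forall>i. count_list is i = (if i \<in> S then u $ i else 0)" for S :: "'s set"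
  proof (induction S rule: finite_induct)
    case empty
    then show ?case by (intro exI[of _ "[]"]) simp
  next
    case (insert x S)
    then obtain js where js: "\<And>i. count_list js i = (if i \<in> S then u $ i else 0)" by blast
    have "count_list (replicate (u $ x) x @ js) i = (if i \<in> insert x S then u $ i else 0)" for i
    proof -
      have "count_list (replicate n x) i = (if i = x then n else 0)" for n
        by (induction n) auto
      then show ?thesis using js insert by auto
    qed
    then show ?case by blast
  qed
  from this[of UNIV] show ?thesis by simp
qed

text \<open>\<open>mderiv\<close> follows an unspecified list of directions. If the derivatives
  belong to a family indexed by the counts of directions, the order of the list drops out.\<close>

lemma mderiv_eqI:
  assumes "F = G (\<lambda>_. 0)" "\<And>i c. partial_deriv i (G c) = G (c(i := Suc (c i)))"
  shows "mderiv u F = G (vec_nth u)"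
proof -
  have *: "foldr partial_deriv is (G (\<lambda>_. 0)) = G (count_list is)" for "is"
  proof (induction "is")
    case Nil
    have "count_list [] = (\<lambda>_. 0)" by (rule ext) simp
    then show ?case by simp
  next
    case (Cons i "is")
    have "count_list (i # is) = (count_list is)(i := Suc (count_list is i))" by (auto simp: fun_eq_iff)
    then show ?case by (simp only: foldr.simps o_apply Cons assms(2))
  qed
  have "\<forall>i. count_list (SOME is. \<forall>i. count_list is i = u $ i) i = u $ i"
    by (rule someI_ex[OF exists_count_list])
  then have "count_list (SOME is. \<forall>i. count_list is i = u $ i) = vec_nth u" by auto
  then show ?thesis unfolding mderiv_def assms(1) * by simp
qed

lemma mderiv_pfun:
  assumes "finite U"
  shows "mderiv w (pfun U a) z
    = of_nat (mfact w) * (\<Sum>u\<in>U. a u * (\<Prod>j\<in>UNIV. of_nat (u $ j choose w $ j) * z $ j ^ (u $ j - w $ j)))"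
proof -
  have "mderiv w (pfun U a) = (\<lambda>c z. \<Sum>u\<in>U. a u * (\<Prod>j\<in>UNIV. fact (c j) * of_nat (u $ j choose c j) * z $ j ^ (u $ j - c j))) (vec_nth w)"
    by (rule mderiv_eqI[OF _ partial_deriv_pfun[OF assms]]) (simp add: pfun_def monom_at_def fun_eq_iff)
  then show ?thesis
    by (simp add: sum_distrib_left prod.distrib mfact_def of_nat_prod mult_ac)
qed

lemma continuous_on_cvec_nth [continuous_intros]:
  "continuous_on S V \<Longrightarrow> continuous_on S (\<lambda>t. cvec (V t) $ i)"
  unfolding cvec_nth by (intro continuous_intros continuous_on_component)

text \<open>The exponents \<open>c\<close> count the derivatives already taken in each direction; \<open>c = 0\<close> gives the
  transform itself.\<close>

definition expint :: "complex \<Rightarrow> 'g set \<Rightarrow> ('g \<Rightarrow> real^'n \<Rightarrow> real^'s) \<Rightarrow> ('s \<Rightarrow> nat) \<Rightarrow> complex^'s \<Rightarrow> complex" where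
  "expint k \<Gamma> V c \<zeta> = k * (\<Sum>\<gamma>\<in>\<Gamma>. cubeint (\<lambda>t. (\<Prod>j\<in>UNIV. (- \<i> * cvec (V \<gamma> t) $ j) ^ c j)
     * exp (- \<i> * (\<Sum>j\<in>UNIV. \<zeta> $ j * cvec (V \<gamma> t) $ j))))"

text \<open>The exponent is affine in each coordinate of \<zeta>, so differentiation under the
  integral over the compact cube brings down one more linear factor, which is what raising
  \<open>c i\<close> records.\<close>

lemma partial_deriv_expint:
  fixes V :: "'g \<Rightarrow> real^'n \<Rightarrow> real^'s"
  assumes V: "\<And>\<gamma>. \<gamma> \<in> \<Gamma> \<Longrightarrow> continuous_on UNIV (V \<gamma>)"
  shows "partial_deriv i (expint k \<Gamma> V c) = expint k \<Gamma> V (c(i := Suc (c i)))"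
proof
  fix \<zeta> :: "complex^'s"
  let ?c = "c(i := Suc (c i))"
  let ?e = "\<lambda>c \<gamma> x t. (\<Prod>j\<in>UNIV. (- \<i> * cvec (V \<gamma> t) $ j) ^ c j)
     * exp (- \<i> * (\<Sum>j\<in>UNIV. (\<zeta> + axis i x) $ j * cvec (V \<gamma> t) $ j))"
  have "((\<lambda>x. cubeint (?e c \<gamma> x)) has_field_derivative cubeint (?e ?c \<gamma> 0)) (at 0)" if "\<gamma> \<in> \<Gamma>" for \<gamma>
  proof -
    have lin: "(\<Sum>j\<in>UNIV. (\<zeta> + axis i x) $ j * cvec (V \<gamma> t) $ j)
        = (\<Sum>j\<in>UNIV. \<zeta> $ j * cvec (V \<gamma> t) $ j) + x * cvec (V \<gamma> t) $ i" for x t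
    proof -
      have "(\<Sum>j\<in>UNIV. axis i x $ j * cvec (V \<gamma> t) $ j) = (\<Sum>j\<in>UNIV. if j = i then x * cvec (V \<gamma> t) $ j else 0)"
        by (intro sum.cong) (auto simp: axis_def)
      then show ?thesis by (simp add: distrib_right sum.distrib)
    qed
    have up: "(\<Prod>j\<in>UNIV. (- \<i> * cvec (V \<gamma> t) $ j) ^ ?c j)
        = (- \<i> * cvec (V \<gamma> t) $ i) * (\<Prod>j\<in>UNIV. (- \<i> * cvec (V \<gamma> t) $ j) ^ c j)" for t
    proof -
      have "(\<Prod>j\<in>UNIV. (- \<i> * cvec (V \<gamma> t) $ j) ^ ?c j)
        = (\<Prod>j\<in>UNIV. (if j = i then - \<i> * cvec (V \<gamma> t) $ j else 1) * (- \<i> * cvec (V \<gamma> t) $ j) ^ c j)"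
        by (intro prod.cong) auto
      then show ?thesis by (simp add: prod.distrib)
    qed
    have cont: "continuous_on UNIV (\<lambda>t. cvec (V \<gamma> t) $ j)" for j
      by (intro continuous_intros V that)
    note cont' = continuous_on_compose2[OF cont, of _ snd] continuous_on_compose2[OF cont, of _ "\<lambda>x. x"]
    have "((\<lambda>x. integral (cbox 0 (\<chi> i. 1)) (?e c \<gamma> x)) has_field_derivative
        integral (cbox 0 (\<chi> i. 1)) (?e ?c \<gamma> 0)) (at 0 within UNIV)"
    proof (rule leibniz_rule_field_derivative)
      show "((\<lambda>x. ?e c \<gamma> x t) has_field_derivative ?e ?c \<gamma> x t) (at x within UNIV)" for x t
        unfolding lin up by (auto intro!: derivative_eq_intros simp: algebra_simps)
      show "?e c \<gamma> x integrable_on cbox 0 (\<chi> i. 1)" for x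
        unfolding lin by (intro integrable_continuous continuous_intros continuous_on_subset[OF cont]) auto
      show "continuous_on (UNIV \<times> cbox 0 (\<chi> i. 1)) (\<lambda>(x, t). ?e ?c \<gamma> x t)"
        unfolding lin split_beta
        by (intro continuous_intros continuous_on_compose2[OF cont continuous_on_snd]) auto
    qed auto
    then show ?thesis by (simp add: cubeint_def)
  qed
  then have "((\<lambda>x. expint k \<Gamma> V c (\<zeta> + axis i x)) has_field_derivative k * (\<Sum>\<gamma>\<in>\<Gamma>. cubeint (?e ?c \<gamma> 0))) (at 0)"
    unfolding expint_def by (intro DERIV_cmult DERIV_sum)
  moreover have "axis i (0::complex) = 0" by (simp add: axis_def vec_eq_iff)
  then have "k * (\<Sum>\<gamma>\<in>\<Gamma>. cubeint (?e ?c \<gamma> 0)) = expint k \<Gamma> V ?c \<zeta>"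
    by (simp only: expint_def add_0_right)
  ultimately show "partial_deriv i (expint k \<Gamma> V c) \<zeta> = expint k \<Gamma> V ?c \<zeta>"
    unfolding partial_deriv_def by (metis DERIV_imp_deriv)
qed

section \<open>Moments of the box spline\<close>

text \<open>At the origin the exponential is 1, and the factors brought down by the derivatives form
  a moment.\<close>

lemma mderiv_expint_0:
  fixes V :: "'g \<Rightarrow> real^'n \<Rightarrow> real^'s"
  assumes V: "\<And>\<gamma>. \<gamma> \<in> \<Gamma> \<Longrightarrow> continuous_on UNIV (V \<gamma>)"
    and F: "F = expint k \<Gamma> V (\<lambda>_. 0)"
  shows "mderiv u F 0 = (- \<i>) ^ mabs u * (k * (\<Sum>\<gamma>\<in>\<Gamma>. cubeint (\<lambda>t. monom_at (cvec (V \<gamma> t)) u)))"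
proof -
  have "mderiv u F = expint k \<Gamma> V (vec_nth u)"
    by (rule mderiv_eqI[OF F partial_deriv_expint[OF V]])
  moreover have "cubeint (\<lambda>t. (\<Prod>j\<in>UNIV. (- \<i> * cvec (V \<gamma> t) $ j) ^ (u $ j)) * exp (- \<i> * (\<Sum>j\<in>UNIV. (0::complex^'s) $ j * cvec (V \<gamma> t) $ j)))
    = (- \<i>) ^ mabs u * cubeint (\<lambda>t. monom_at (cvec (V \<gamma> t)) u)" for \<gamma>
    unfolding power_mult_distrib prod.distrib monom_at_def mabs_def power_sum cubeint_def by (simp del: cvec_nth)
  ultimately show ?thesis
    by (simp add: expint_def sum_distrib_left mult_ac del: cvec_nth)
qed

definition efac :: "complex \<Rightarrow> complex" where
  "efac w = (if w = 0 then 1 else (1 - exp (- \<i> * w)) / (\<i> * w))"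

lemma efac_integral: "integral {0..1} (\<lambda>t. exp (- \<i> * w * complex_of_real t)) = efac w"
proof (cases "w = 0")
  case True
  then show ?thesis by (simp add: efac_def)
next
  case False
  have "((\<lambda>t. exp (- \<i> * w * complex_of_real t)) has_integral
    (exp (- \<i> * w * complex_of_real 1) / (- \<i> * w) - exp (- \<i> * w * complex_of_real 0) / (- \<i> * w))) {0..1}"
  proof (rule fundamental_theorem_of_calculus)
    fix t :: real assume "t \<in> {0..1}"
    have "((\<lambda>z. exp (- \<i> * w * z) / (- \<i> * w)) has_field_derivative exp (- \<i> * w * complex_of_real t)) (at (complex_of_real t))"
      using False by (auto intro!: derivative_eq_intros)
    from has_vector_derivative_real_field[OF this]
    show "((\<lambda>t. exp (- \<i> * w * complex_of_real t) / (- \<i> * w)) has_vector_derivative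
      exp (- \<i> * w * complex_of_real t)) (at t within {0..1})" by (simp add: o_def)
  qed simp
  then show ?thesis using False
    by (intro integral_unique) (simp add: efac_def field_simps)
qed

text \<open>With \<open>q = exp (- \<i> * w / 2)\<close> this is
  \<open>1 - q^2 = (1 - q) * (1 + q)\<close>: the unit interval is refined into its two
  halves.\<close>

lemma efac_half: "efac w = efac (w / 2) * ((\<Sum>k<2. exp (- \<i> * w / 2 * of_nat k)) / 2)"
proof (cases "w = 0")
  case True
  then show ?thesis by (simp add: efac_def)
next
  case False
  have "exp (- \<i> * w) = exp (- \<i> * w / 2) ^ 2" by (simp add: exp_double[symmetric])
  then show ?thesis using False
    by (simp add: efac_def numeral_2_eq_2 field_simps power2_eq_square)
qed

section \<open>The transform as an integral over the cube, in two ways\<close>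

definition colform :: "int^'n^'s \<Rightarrow> complex^'s \<Rightarrow> 'n \<Rightarrow> complex" where
  "colform M \<zeta> j = (\<Sum>i\<in>UNIV. \<zeta> $ i * of_int (M $ i $ j))"

lemma sum_colform:
  "(\<Sum>i\<in>UNIV. \<zeta> $ i * cvec (rmat M *v t) $ i) = (\<Sum>j\<in>UNIV. colform M \<zeta> j * complex_of_real (t $ j))"
proof -
  have "(\<Sum>i\<in>UNIV. \<zeta> $ i * cvec (rmat M *v t) $ i)
    = (\<Sum>i\<in>UNIV. \<Sum>j\<in>UNIV. \<zeta> $ i * of_int (M $ i $ j) * complex_of_real (t $ j))"
    by (simp add: matrix_vector_mult_def sum_distrib_left mult_ac)
  also have "\<dots> = (\<Sum>j\<in>UNIV. colform M \<zeta> j * complex_of_real (t $ j))"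
    by (subst sum.swap) (simp add: colform_def sum_distrib_right)
  finally show ?thesis .
qed

lemma box_spline_transform_efac: "box_spline_transform M \<zeta> = (\<Prod>j\<in>UNIV. efac (colform M \<zeta> j))"
  by (simp add: box_spline_transform_def efac_def colform_def Let_def)

lemma cubeint_exp:
  fixes w :: "'n::finite \<Rightarrow> complex"
  shows "cubeint (\<lambda>t::real^'n. exp (- \<i> * (\<Sum>j\<in>UNIV. w j * complex_of_real (t $ j)))) = (\<Prod>j\<in>UNIV. efac (w j))"
proof -
  have "(\<lambda>t::real^'n. exp (- \<i> * (\<Sum>j\<in>UNIV. w j * complex_of_real (t $ j))))
    = (\<lambda>t. \<Prod>j\<in>UNIV. exp (- \<i> * w j * complex_of_real (t $ j)))"
    by (simp add: exp_sum[symmetric] sum_distrib_left mult.assoc)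
  then have "cubeint (\<lambda>t::real^'n. exp (- \<i> * (\<Sum>j\<in>UNIV. w j * complex_of_real (t $ j))))
    = (\<Prod>j\<in>UNIV. integral {0..1} (\<lambda>t. exp (- \<i> * w j * complex_of_real t)))"
    by (simp only:) (rule cubeint_prod, intro continuous_intros)
  then show ?thesis by (simp only: efac_integral)
qed

lemma box_spline_transform_expint:
  "box_spline_transform M = expint 1 {()} (\<lambda>_ t. rmat M *v t) (\<lambda>_. 0)"
  by (rule ext) (simp add: expint_def sum_colform cubeint_exp[simplified] box_spline_transform_efac del: cvec_nth)

text \<open>The image under \<open>M\<close> of \<open>(\<gamma> + t) / 2\<close>; for bit vectors
  \<gamma> and \<open>t\<close> in the unit cube these points fill the cube by its
  \<open>2 ^ n\<close> subcubes of side 1/2.\<close>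

definition midpt :: "int^'n^'s \<Rightarrow> nat^'n \<Rightarrow> real^'n \<Rightarrow> real^'s" where
  "midpt M \<gamma> t = (1/2) *\<^sub>R (rvec (lattice_image M \<gamma>) + rmat M *v t)"

lemma midpt_alt: "midpt M \<gamma> t = rmat M *v (\<chi> j. (real (\<gamma> $ j) + t $ j) / 2)"
  by (simp add: midpt_def rvec_lattice_image vec_eq_iff matrix_vector_mult_def sum_divide_distrib
      sum.distrib algebra_simps add_divide_distrib)

text \<open>The two-scale relation of the box spline in Fourier form: each factor splits by
  \<open>efac_half\<close>, and the product over the columns expands into a sum over bit vectors.
  Comparing the derivatives at 0 with those of the first integral representation gives the
  subdivision of the cube for the moments.\<close>

lemma box_spline_transform_midpt:
  fixes M :: "int^'n^'s"
  shows "box_spline_transform M = expint (1 / 2 ^ CARD('n)) bits (midpt M) (\<lambda>_. 0)"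
proof
  fix \<zeta> :: "complex^'s"
  let ?w = "colform M \<zeta>"
  have e: "(\<Prod>j\<in>UNIV. exp (- \<i> * ?w j / 2 * of_nat (\<gamma> $ j))) * (\<Prod>j\<in>UNIV. efac (?w j / 2))
    = cubeint (\<lambda>t. exp (- \<i> * (\<Sum>i\<in>UNIV. \<zeta> $ i * cvec (midpt M \<gamma> t) $ i)))" for \<gamma> :: "nat^'n"
  proof -
    have "(\<lambda>t. exp (- \<i> * (\<Sum>i\<in>UNIV. \<zeta> $ i * cvec (midpt M \<gamma> t) $ i)))
      = (\<lambda>t. (\<Prod>j\<in>UNIV. exp (- \<i> * ?w j / 2 * of_nat (\<gamma> $ j))) * exp (- \<i> * (\<Sum>j\<in>UNIV. (?w j / 2) * complex_of_real (t $ j))))"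
      unfolding midpt_alt sum_colform
      by (rule ext) (simp add: exp_sum[symmetric] exp_add[symmetric] sum_distrib_left sum.distrib
        add_divide_distrib distrib_left sum_negf[symmetric] mult_ac del: cvec_nth)
    then show ?thesis by (simp only: cubeint_def integral_mult_right cubeint_exp[unfolded cubeint_def])
  qed
  have "box_spline_transform M \<zeta> = (\<Prod>j\<in>UNIV. efac (?w j / 2) * ((\<Sum>k<2. exp (- \<i> * ?w j / 2 * of_nat k)) / 2))"
    unfolding box_spline_transform_efac by (rule prod.cong[OF refl efac_half])
  also have "\<dots> = (1 / 2 ^ CARD('n)) * ((\<Prod>j\<in>UNIV. \<Sum>k<2. exp (- \<i> * ?w j / 2 * of_nat k)) * (\<Prod>j\<in>UNIV. efac (?w j / 2)))"
    by (simp add: prod.distrib prod_dividef)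
  also have "(\<Prod>j\<in>UNIV. \<Sum>k<2. exp (- \<i> * ?w j / 2 * of_nat k)) = (\<Sum>\<gamma>\<in>bits. \<Prod>j\<in>UNIV. exp (- \<i> * ?w j / 2 * of_nat (\<gamma> $ j)))"
    unfolding bits_def by (rule sum_vec_prod[symmetric]) simp
  also have "(1 / 2 ^ CARD('n)) * (\<dots> * (\<Prod>j\<in>UNIV. efac (?w j / 2))) = expint (1 / 2 ^ CARD('n)) bits (midpt M) (\<lambda>_. 0) \<zeta>"
    unfolding sum_distrib_right e by (simp add: expint_def del: cvec_nth)
  finally show "box_spline_transform M \<zeta> = expint (1 / 2 ^ CARD('n)) bits (midpt M) (\<lambda>_. 0) \<zeta>" .
qed

definition moment :: "int^'n^'s \<Rightarrow> nat^'s \<Rightarrow> complex" where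
  "moment M u = cubeint (\<lambda>t. monom_at (cvec (rmat M *v t)) u)"

lemma continuous_rmat: "continuous_on S (\<lambda>t. rmat M *v t)"
  by (intro linear_continuous_on) (simp add: linear_conv_bounded_linear[symmetric])

lemma mderiv_box_spline: "mderiv u (box_spline_transform M) 0 = (- \<i>) ^ mabs u * moment M u"
  by (subst mderiv_expint_0[OF continuous_rmat box_spline_transform_expint]) (simp add: moment_def)

lemma continuous_midpt: "continuous_on S (midpt M \<gamma>)"
  unfolding midpt_def[abs_def] by (intro continuous_intros continuous_rmat)

lemma moment_midpt:
  fixes M :: "int^'n^'s"
  shows "2 ^ CARD('n) * moment M u = (\<Sum>\<gamma>\<in>bits. cubeint (\<lambda>t. monom_at (cvec (midpt M \<gamma> t)) u))"
proof -
  have "(- \<i>) ^ mabs u * moment M u = (- \<i>) ^ mabs u * (1 / 2 ^ CARD('n) * (\<Sum>\<gamma>\<in>bits. cubeint (\<lambda>t. monom_at (cvec (midpt M \<gamma> t)) u)))"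
    unfolding mderiv_box_spline[symmetric]
    by (rule mderiv_expint_0[OF continuous_midpt box_spline_transform_midpt])
  then show ?thesis by (simp add: field_simps)
qed

lemma continuous_monom_at: "continuous_on S V \<Longrightarrow> continuous_on S (\<lambda>t. monom_at (cvec (V t)) u)"
  unfolding monom_at_def by (intro continuous_intros)

lemma cubeint_pfun:
  assumes "finite U" "continuous_on UNIV V"
  shows "cubeint (\<lambda>t. pfun U a (cvec (V t))) = (\<Sum>u\<in>U. a u * cubeint (\<lambda>t. monom_at (cvec (V t)) u))"
  unfolding pfun_def cubeint_def
  by (subst integral_sum)
    (auto intro!: assms integrable_continuous continuous_intros continuous_monom_at continuous_on_subset[OF assms(2)])

lemma cubeint_polyfun_midpt:
  fixes M :: "int^'n^'s"
  assumes "polyfun F"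
  shows "2 ^ CARD('n) * cubeint (\<lambda>t. F (cvec (rmat M *v t))) = (\<Sum>\<gamma>\<in>bits. cubeint (\<lambda>t. F (cvec (midpt M \<gamma> t))))"
proof -
  obtain U a where U: "finite U" and F: "F = pfun U a" using assms unfolding polyfun_def by blast
  have "2 ^ CARD('n) * cubeint (\<lambda>t. F (cvec (rmat M *v t))) = (\<Sum>u\<in>U. a u * (2 ^ CARD('n) * moment M u))"
    unfolding F by (simp add: cubeint_pfun[OF U continuous_rmat] moment_def sum_distrib_left mult_ac)
  also have "\<dots> = (\<Sum>\<gamma>\<in>bits. \<Sum>u\<in>U. a u * cubeint (\<lambda>t. monom_at (cvec (midpt M \<gamma> t)) u))"
    unfolding moment_midpt sum_distrib_left by (rule sum.swap)
  also have "\<dots> = (\<Sum>\<gamma>\<in>bits. cubeint (\<lambda>t. F (cvec (midpt M \<gamma> t))))"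
    unfolding F by (simp only: cubeint_pfun[OF U continuous_midpt])
  finally show ?thesis .
qed

section \<open>Convolution with the box spline\<close>

context chamber
begin

text \<open>The convolution of the polynomial with the box spline, continued to complex
  arguments.\<close>

definition box_average :: "complex^'s \<Rightarrow> complex" where
  "box_average z = cubeint (\<lambda>t. e_poly (z - cvec (rmat M *v t)))"

text \<open>The half-shift of \<open>2 z - M t\<close> by \<gamma> is \<open>z\<close> minus the
  point of the subcube belonging to \<gamma>. So \<open>e_poly_split\<close> turns the integral over
  the cube into the sum over its subcubes, which the two-scale relation reassembles.\<close>

lemma box_average_double: "2 ^ CARD('s) * box_average (\<chi> i. 2 * z $ i) = 2 ^ CARD('n) * box_average z"
proof -
  let ?F = "\<lambda>y. e_poly (z - y)"
  have pF: "polyfun ?F"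
    by (rule polyfun_subst)
      (auto simp: e_poly_def polyfun_peval intro: polyfun_diff[OF polyfun_const polyfun_coord])
  then obtain U a where U: "finite U" and "?F = pfun U a" unfolding polyfun_def by blast
  then have F: "e_poly (z - y) = pfun U a y" for y by (metis (no_types))
  have hs: "halfshift \<gamma> ((\<chi> i. 2 * z $ i) - cvec (rmat M *v t)) = z - cvec (midpt M \<gamma> t)" for \<gamma> t
    by (simp add: vec_eq_iff halfshift_def midpt_def field_simps)
  have "2 ^ CARD('s) * box_average (\<chi> i. 2 * z $ i) = cubeint (\<lambda>t. 2 ^ CARD('s) * e_poly ((\<chi> i. 2 * z $ i) - cvec (rmat M *v t)))"
    by (simp add: box_average_def cubeint_def)
  also have "\<dots> = cubeint (\<lambda>t. \<Sum>\<gamma>\<in>bits. ?F (cvec (midpt M \<gamma> t)))"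
    by (simp only: e_poly_split hs)
  also have "\<dots> = (\<Sum>\<gamma>\<in>bits. cubeint (\<lambda>t. ?F (cvec (midpt M \<gamma> t))))"
    unfolding cubeint_def F
    by (rule integral_sum[OF finite_bits])
      (auto simp: pfun_def intro!: integrable_continuous continuous_intros continuous_monom_at continuous_midpt)
  also have "\<dots> = 2 ^ CARD('n) * cubeint (\<lambda>t. ?F (cvec (rmat M *v t)))"
    by (rule cubeint_polyfun_midpt[OF pF, symmetric])
  finally show ?thesis by (simp add: box_average_def)
qed

end

section \<open>The recursion\<close>

text \<open>The common range up to \<open>K\<close> makes the index set independent of
  \<open>v\<close>, so that sums over \<open>v\<close> and \<open>w\<close> can be exchanged; the
  additional binomials are zero.\<close>

lemma monom_at_diff:
  fixes z y :: "complex^'s"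
  assumes "\<And>i. v $ i \<le> K"
  shows "monom_at (z - y) v = (\<Sum>w\<in>{w. \<forall>i. w $ i \<in> {..K}}.
    (-1) ^ mabs w * (\<Prod>i\<in>UNIV. of_nat (v $ i choose w $ i) * z $ i ^ (v $ i - w $ i)) * monom_at y w)"
proof -
  have "monom_at (z - y) v = (\<Prod>i\<in>UNIV. \<Sum>k\<in>{..K}. of_nat (v $ i choose k) * (- y $ i) ^ k * z $ i ^ (v $ i - k))"
    unfolding monom_at_def
  proof (rule prod.cong[OF refl])
    fix i
    have "(z - y) $ i ^ (v $ i) = (- y $ i + z $ i) ^ (v $ i)" by simp
    also have "\<dots> = (\<Sum>k\<le>v $ i. of_nat (v $ i choose k) * (- y $ i) ^ k * z $ i ^ (v $ i - k))"
      by (rule binomial_ring)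
    also have "\<dots> = (\<Sum>k\<in>{..K}. of_nat (v $ i choose k) * (- y $ i) ^ k * z $ i ^ (v $ i - k))"
      by (rule sum.mono_neutral_left) (use assms in auto)
    finally show "(z - y) $ i ^ (v $ i) = \<dots>" .
  qed
  also have "\<dots> = (\<Sum>w\<in>{w. \<forall>i. w $ i \<in> {..K}}. \<Prod>i\<in>UNIV. of_nat (v $ i choose w $ i) * (- y $ i) ^ (w $ i) * z $ i ^ (v $ i - w $ i))"
    by (rule sum_vec_prod[symmetric]) simp
  also have "\<dots> = (\<Sum>w\<in>{w. \<forall>i. w $ i \<in> {..K}}.
    (-1) ^ mabs w * (\<Prod>i\<in>UNIV. of_nat (v $ i choose w $ i) * z $ i ^ (v $ i - w $ i)) * monom_at y w)"
  proof (rule sum.cong[OF refl])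
    fix w :: "nat^'s"
    have "(\<Prod>i\<in>UNIV. of_nat (v $ i choose w $ i) * (- y $ i) ^ (w $ i) * z $ i ^ (v $ i - w $ i))
      = (\<Prod>i\<in>UNIV. (-1) ^ (w $ i) * (of_nat (v $ i choose w $ i) * z $ i ^ (v $ i - w $ i)) * y $ i ^ (w $ i))"
      by (intro prod.cong refl) (simp add: power_minus[of "y $ _"] mult_ac)
    then show "(\<Prod>i\<in>UNIV. of_nat (v $ i choose w $ i) * (- y $ i) ^ (w $ i) * z $ i ^ (v $ i - w $ i))
      = (-1) ^ mabs w * (\<Prod>i\<in>UNIV. of_nat (v $ i choose w $ i) * z $ i ^ (v $ i - w $ i)) * monom_at y w"
      by (simp only: prod.distrib mabs_def power_sum monom_at_def)
  qed
  finally show ?thesis .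
qed

lemma moment_0: "moment M 0 = 1"
  using cubeint_exp[of "\<lambda>_. 0"] by (simp add: moment_def monom_at_def efac_def)

lemma mabs_0_iff: "mabs u = 0 \<longleftrightarrow> u = 0"
  by (auto simp: mabs_def vec_eq_iff)

lemma nth_le_mabs: "u $ i \<le> mabs u"
  unfolding mabs_def by (rule member_le_sum) auto

section \<open>Taylor expansion by homogeneous parts\<close>

context chamber
begin

definition e_support :: "(nat^'s) set" where "e_support = Poly_Mapping.keys (P one_vec)"
definition e_coeff :: "nat^'s \<Rightarrow> complex" where "e_coeff = Poly_Mapping.lookup (P one_vec)"

lemma finite_e_support: "finite e_support" by (simp add: e_support_def)

lemma e_poly_pfun: "e_poly = pfun e_support e_coeff" by (simp add: e_poly_def peval_pfun e_support_def e_coeff_def)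

definition e_part :: "nat \<Rightarrow> complex^'s \<Rightarrow> complex" where
  "e_part e = pfun {v \<in> e_support. mabs v = e} e_coeff"

lemma hom_part_e_part: "hom_part e (P one_vec) = e_part e"
  by (auto simp: hom_part_def e_part_def pfun_def monom_at_def e_support_def e_coeff_def)

text \<open>The contribution of the monomial \<open>v\<close> to the \<open>w\<close>-th derivative
  divided by \<open>w!\<close>.\<close>

definition taylor_term :: "nat^'s \<Rightarrow> nat^'s \<Rightarrow> complex^'s \<Rightarrow> complex" where
  "taylor_term v w z = e_coeff v * (\<Prod>i\<in>UNIV. of_nat (v $ i choose w $ i) * z $ i ^ (v $ i - w $ i))"

definition e_part_taylor :: "nat^'s \<Rightarrow> nat \<Rightarrow> complex^'s \<Rightarrow> complex" where
  "e_part_taylor w e z = (\<Sum>v\<in>{v \<in> e_support. mabs v = e}. taylor_term v w z)"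

lemma mderiv_e_part: "mderiv w (e_part e) z = of_nat (mfact w) * e_part_taylor w e z"
  unfolding e_part_def by (subst mderiv_pfun) (auto simp: e_part_taylor_def taylor_term_def finite_e_support)

lemma mfact_nonzero: "of_nat (mfact w) \<noteq> (0::complex)"
  by (simp add: mfact_def)

text \<open>The assumption concerns the function, the claim an expression in its coefficients; the
  derivative, which sees only the function, connects them.\<close>

lemma e_part_taylor_zero: "e_part e = (\<lambda>_. 0) \<Longrightarrow> e_part_taylor w e z = 0"
proof -
  assume "e_part e = (\<lambda>_. 0)"
  then have "e_part e = pfun {} e_coeff" by (simp add: pfun_def fun_eq_iff)
  then have "mderiv w (e_part e) z = 0" by (simp add: mderiv_pfun)
  then show ?thesis using mfact_nonzero[of w] by (auto simp: mderiv_e_part)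
qed

lemma e_part_taylor_0: "e_part_taylor 0 e z = e_part e z"
  by (simp add: e_part_taylor_def taylor_term_def e_part_def pfun_def monom_at_def)

text \<open>The sum covers the exponents of the polynomial itself, the summand
  \<open>CARD('n)\<close> every multi-index that occurs in the recursion.\<close>

definition exponent_bound :: nat where "exponent_bound = CARD('n) + (\<Sum>u\<in>e_support. mabs u)"

lemma e_support_bound: "v \<in> e_support \<Longrightarrow> v $ i \<le> exponent_bound"
proof -
  assume "v \<in> e_support"
  then have "mabs v \<le> (\<Sum>u\<in>e_support. mabs u)" by (intro member_le_sum) (auto simp: finite_e_support)
  then show ?thesis using nth_le_mabs[of v i] by (simp add: exponent_bound_def)
qed

definition exponent_box :: "(nat^'s) set" where "exponent_box = {w. \<forall>i. w $ i \<in> {..exponent_bound}}"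

lemma finite_exponent_box: "finite exponent_box" unfolding exponent_box_def by (rule finite_vec_box) simp

text \<open>The coefficient in the recursion, up to the factorial: one power of
  \<open>- \<i>\<close> stands there and the derivative of the transform supplies the other, so
  their product is a sign.\<close>

definition signed_moment :: "nat^'s \<Rightarrow> complex" where "signed_moment w = (-1) ^ mabs w * moment M w"

lemma box_average_expand: "box_average z = (\<Sum>w\<in>exponent_box. signed_moment w * (\<Sum>v\<in>e_support. taylor_term v w z))"
proof -
  have "e_poly (z - y) = pfun exponent_box (\<lambda>w. (-1) ^ mabs w * (\<Sum>v\<in>e_support. taylor_term v w z)) y" for y
  proof -
    have "e_poly (z - y) = (\<Sum>v\<in>e_support. e_coeff v * (\<Sum>w\<in>exponent_box. (-1) ^ mabs w *
      (\<Prod>i\<in>UNIV. of_nat (v $ i choose w $ i) * z $ i ^ (v $ i - w $ i)) * monom_at y w))"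
      unfolding e_poly_pfun pfun_def exponent_box_def by (intro sum.cong refl, subst monom_at_diff[OF e_support_bound]) auto
    also have "\<dots> = (\<Sum>v\<in>e_support. \<Sum>w\<in>exponent_box. (-1) ^ mabs w * taylor_term v w z * monom_at y w)"
      by (simp add: sum_distrib_left taylor_term_def mult_ac)
    also have "\<dots> = pfun exponent_box (\<lambda>w. (-1) ^ mabs w * (\<Sum>v\<in>e_support. taylor_term v w z)) y"
      unfolding pfun_def by (subst sum.swap) (simp add: sum_distrib_left sum_distrib_right)
    finally show ?thesis .
  qed
  then show ?thesis
    by (simp add: box_average_def cubeint_pfun[OF finite_exponent_box continuous_rmat] moment_def[symmetric] signed_moment_def mult_ac)
qed

text \<open>The subtraction is truncated; where \<open>taylor_term\<close> is nonzero,
  \<open>w\<close> is below \<open>v\<close> and this is the difference of the total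
  degrees.\<close>

definition degree_drop :: "nat^'s \<Rightarrow> nat^'s \<Rightarrow> nat" where "degree_drop v w = (\<Sum>i\<in>UNIV. v $ i - w $ i)"

lemma taylor_term_scale: "taylor_term v w (\<chi> i. c * z $ i) = c ^ degree_drop v w * taylor_term v w z"
  by (simp add: taylor_term_def degree_drop_def power_mult_distrib prod.distrib power_sum mult_ac)

lemma taylor_term_nonzero: "taylor_term v w z \<noteq> 0 \<Longrightarrow> mabs v = degree_drop v w + mabs w"
proof -
  assume "taylor_term v w z \<noteq> 0"
  then have "w $ i \<le> v $ i" for i by (auto simp: taylor_term_def binomial_eq_0_iff not_less)
  then show ?thesis unfolding mabs_def degree_drop_def by (simp add: sum.distrib[symmetric])
qed

lemma card_le: "CARD('s) \<le> CARD('n)"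
proof -
  have "CARD('s) = dim (span (range (rcol M)))" using spanning by simp
  also have "\<dots> \<le> card (range (rcol M))" by (simp add: dim_le_card')
  also have "\<dots> \<le> CARD('n)" by (rule card_image_le) simp
  finally show ?thesis .
qed

lemma box_average_pow: "box_average (\<chi> i. 2 ^ k * z $ i) = (2 ^ k) ^ (CARD('n) - CARD('s)) * box_average z"
proof (induction k)
  case (Suc k)
  have "box_average (\<chi> i. 2 * y $ i) = 2 ^ (CARD('n) - CARD('s)) * box_average y" for y
    using box_average_double[of y] card_le by (simp add: power_diff field_simps)
  from this[of "\<chi> i. 2 ^ k * z $ i"] Suc show ?case
    by (simp add: mult.assoc power_mult_distrib)
qed simp

text \<open>On the ray through \<open>z\<close> the average is a polynomial in the scaling factor.
  It agrees with a monomial of degree \<open>n - s\<close> at all powers of 2, which are infinitely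
  many points, so its coefficient in any other degree \<open>d\<close> vanishes. The sum is that
  coefficient: a part of degree \<open>d + |w|\<close> loses \<open>|w|\<close> by
  differentiation.\<close>

lemma homogeneous_zero:
  assumes "d \<noteq> CARD('n) - CARD('s)"
  shows "(\<Sum>w\<in>exponent_box. signed_moment w * e_part_taylor w (d + mabs w) z) = 0"
proof -
  let ?k = "CARD('n) - CARD('s)"
  define p where "p = (\<Sum>w\<in>exponent_box. \<Sum>v\<in>e_support. monom (signed_moment w * taylor_term v w z) (degree_drop v w))"
  have pe: "poly p c = box_average (\<chi> i. c * z $ i)" for c
    unfolding box_average_expand taylor_term_scale p_def by (simp add: poly_sum poly_monom sum_distrib_left mult_ac)
  have "infinite (range (\<lambda>k. (2::complex) ^ k))"
  proof (rule range_inj_infinite, rule injI)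
    fix a b :: nat assume "(2::complex) ^ a = 2 ^ b"
    then have "(2::nat) ^ a = 2 ^ b" by (metis of_nat_eq_iff of_nat_numeral of_nat_power)
    then show "a = b" by simp
  qed
  moreover have "range (\<lambda>k. (2::complex) ^ k) \<subseteq> {x. poly (p - monom (box_average z) ?k) x = 0}"
    by (auto simp: pe box_average_pow poly_monom)
  ultimately have "infinite {x. poly (p - monom (box_average z) ?k) x = 0}" using finite_subset by blast
  then have "p - monom (box_average z) ?k = 0" using poly_roots_finite by blast
  then have "coeff p d = 0" using assms by simp
  then have "(\<Sum>w\<in>exponent_box. \<Sum>v\<in>e_support. if degree_drop v w = d then signed_moment w * taylor_term v w z else 0) = 0"
    by (simp add: p_def coeff_sum)
  moreover have "(\<Sum>v\<in>e_support. if degree_drop v w = d then signed_moment w * taylor_term v w z else 0) = signed_moment w * e_part_taylor w (d + mabs w) z" for w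
  proof -
    have "(\<Sum>v\<in>e_support. if degree_drop v w = d then signed_moment w * taylor_term v w z else 0)
      = (\<Sum>v\<in>e_support. if mabs v = d + mabs w then signed_moment w * taylor_term v w z else 0)"
      by (rule sum.cong[OF refl]) (use taylor_term_nonzero in fastforce)
    also have "\<dots> = signed_moment w * e_part_taylor w (d + mabs w) z"
      unfolding e_part_taylor_def sum_distrib_left by (rule sum.inter_filter[symmetric]) (rule finite_e_support)
    finally show ?thesis .
  qed
  ultimately show ?thesis by simp
qed

text \<open>Let \<open>m\<close> be the highest degree that occurs. In the identity of degree
  \<open>m\<close> every term with \<open>w \<noteq> 0\<close> involves a part of degree above
  \<open>m\<close>, so only \<open>w = 0\<close> remains, and as the moment of order 0 is 1, the
  part of degree \<open>m\<close> itself is zero if \<open>m > n - s\<close>.\<close>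

lemma e_part_degree:
  assumes "e > CARD('n) - CARD('s)" shows "e_part e = (\<lambda>_. 0)"
proof (rule ccontr)
  assume ne: "e_part e \<noteq> (\<lambda>_. 0)"
  define E where "E = {e. e_part e \<noteq> (\<lambda>_. 0)}"
  have "E \<subseteq> mabs ` e_support"
  proof
    fix e assume "e \<in> E"
    then obtain z where "pfun {v \<in> e_support. mabs v = e} e_coeff z \<noteq> 0" by (auto simp: E_def e_part_def)
    then have "{v \<in> e_support. mabs v = e} \<noteq> {}" unfolding pfun_def by (metis sum.empty)
    then show "e \<in> mabs ` e_support" by auto
  qed
  then have fin: "finite E" using finite_e_support finite_surj by blast
  define m where "m = Max E"
  have "e \<in> E" using ne by (simp add: E_def)
  then have m: "m \<in> E" "m \<ge> e" unfolding m_def using Max_in[OF fin] Max_ge[OF fin] by auto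
  have top: "e_part e' = (\<lambda>_. 0)" if "e' > m" for e'
  proof (rule ccontr)
    assume "e_part e' \<noteq> (\<lambda>_. 0)"
    then have "e' \<in> E" by (simp add: E_def)
    then have "e' \<le> m" unfolding m_def by (rule Max_ge[OF fin])
    with that show False by simp
  qed
  have "e_part m z = 0" for z
  proof -
    have "0 = (\<Sum>w\<in>exponent_box. signed_moment w * e_part_taylor w (m + mabs w) z)"
      by (rule homogeneous_zero[symmetric]) (use m assms in auto)
    also have "\<dots> = (\<Sum>w\<in>{0}. signed_moment w * e_part_taylor w (m + mabs w) z)"
    proof (rule sum.mono_neutral_right[OF finite_exponent_box])
      show "{0} \<subseteq> exponent_box" by (simp add: exponent_box_def)
      show "\<forall>w\<in>exponent_box - {0}. signed_moment w * e_part_taylor w (m + mabs w) z = 0"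
      proof
        fix w assume "w \<in> exponent_box - {0}"
        then have "mabs w \<noteq> 0" by (simp add: mabs_0_iff)
        then have "e_part_taylor w (m + mabs w) z = 0" by (intro e_part_taylor_zero top) simp
        then show "signed_moment w * e_part_taylor w (m + mabs w) z = 0" by simp
      qed
    qed
    also have "\<dots> = e_part m z" by (simp add: signed_moment_def moment_0 e_part_taylor_0 mabs_def)
    finally show ?thesis by simp
  qed
  then show False using m by (auto simp: E_def)
qed

text \<open>This is the identity of degree \<open>n - s - \<mu>\<close> with its terms sorted by
  \<open>j = \<mu> - |u|\<close>; the assumption \<open>1 \<le> \<mu>\<close> keeps that degree away
  from the exceptional \<open>n - s\<close>.\<close>

lemma recursion:
  assumes p: "\<forall>\<mu>\<le>CARD('n) - CARD('s). p \<mu> = hom_part (CARD('n) - CARD('s) - \<mu>) (P (\<chi> i. 1))"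
    and \<mu>: "1 \<le> \<mu>" "\<mu> \<le> CARD('n) - CARD('s)"
  shows "p \<mu> z = - (\<Sum>j=0..\<mu>-1. \<Sum>u\<in>{u :: nat^'s. mabs u = \<mu> - j}.
             mderiv u (p j) z * (- \<i>) ^ mabs u
               * mderiv u (box_spline_transform M) 0 / of_nat (mfact u))"
proof -
  let ?k = "CARD('n) - CARD('s)"
  let ?t = "\<lambda>j u. mderiv u (p j) z * (- \<i>) ^ mabs u * mderiv u (box_spline_transform M) 0 / of_nat (mfact u)"
  define d where "d = ?k - \<mu>"
  have pj: "p j = e_part (?k - j)" if "j \<le> ?k" for j
    using p that hom_part_e_part by (simp add: one_vec_def)
  have t: "?t j u = signed_moment u * e_part_taylor u (d + mabs u) z" if "j \<le> \<mu>" "mabs u = \<mu> - j" for j u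
  proof -
    have "?k - j = d + mabs u" using that \<mu> by (simp add: d_def)
    then have "mderiv u (p j) z = of_nat (mfact u) * e_part_taylor u (d + mabs u) z"
      using that \<mu> by (simp add: pj mderiv_e_part)
    moreover have "(- \<i>) ^ mabs u * (- \<i>) ^ mabs u = (-1) ^ mabs u"
      by (simp add: power_mult_distrib[symmetric])
    ultimately show ?thesis using mfact_nonzero[of u]
      by (simp add: mderiv_box_spline signed_moment_def)
  qed
  define S where "S = {u :: nat^'s. mabs u \<le> \<mu>}"
  have SW: "S \<subseteq> exponent_box"
  proof
    fix u assume "u \<in> S"
    then have "u $ i \<le> exponent_bound" for i using nth_le_mabs[of u i] \<mu> by (simp add: S_def exponent_bound_def)
    then show "u \<in> exponent_box" by (simp add: exponent_box_def)
  qed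
  then have finS: "finite S" using finite_exponent_box finite_subset by blast
  have "0 = (\<Sum>w\<in>exponent_box. signed_moment w * e_part_taylor w (d + mabs w) z)"
    by (rule homogeneous_zero[symmetric]) (use \<mu> in \<open>simp add: d_def\<close>)
  also have "\<dots> = (\<Sum>w\<in>S. signed_moment w * e_part_taylor w (d + mabs w) z)"
  proof (rule sum.mono_neutral_right[OF finite_exponent_box SW], rule ballI)
    \<comment> \<open>Here \<open>|w| > \<mu>\<close>, so the part concerned has degree above
      \<open>n - s\<close>.\<close>
    fix w assume "w \<in> exponent_box - S"
    then have "e_part_taylor w (d + mabs w) z = 0" by (intro e_part_taylor_zero e_part_degree) (use \<mu> in \<open>auto simp: S_def d_def\<close>)
    then show "signed_moment w * e_part_taylor w (d + mabs w) z = 0" by simp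
  qed
  also have "\<dots> = (\<Sum>j\<in>{0..\<mu>}. \<Sum>w\<in>{w \<in> S. \<mu> - mabs w = j}. signed_moment w * e_part_taylor w (d + mabs w) z)"
    by (rule sum.group[symmetric]) (auto simp: finS)
  also have "\<dots> = (\<Sum>j\<in>{0..\<mu>}. \<Sum>u\<in>{u. mabs u = \<mu> - j}. ?t j u)"
  proof (intro sum.cong refl)
    fix j u assume "j \<in> {0..\<mu>}" "u \<in> {u :: nat^'s. mabs u = \<mu> - j}"
    then show "signed_moment u * e_part_taylor u (d + mabs u) z = ?t j u" by (intro t[symmetric]) auto
  qed (auto simp: S_def)
  also have "{0..\<mu>} = insert \<mu> {0..\<mu>-1}" using \<mu> by auto
  also have "(\<Sum>j\<in>insert \<mu> {0..\<mu>-1}. \<Sum>u\<in>{u. mabs u = \<mu> - j}. ?t j u)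
    = (\<Sum>u\<in>{u. mabs u = \<mu> - \<mu>}. ?t \<mu> u) + (\<Sum>j=0..\<mu>-1. \<Sum>u\<in>{u. mabs u = \<mu> - j}. ?t j u)"
    by (rule sum.insert) (use \<mu> in auto)
  also have "(\<Sum>u\<in>{u. mabs u = \<mu> - \<mu>}. ?t \<mu> u) = p \<mu> z"
  proof -
    \<comment> \<open>The term \<open>j = \<mu>\<close> is the undifferentiated part, to be isolated
      on one side.\<close>
    have "{u::nat^'s. mabs u = \<mu> - \<mu>} = {0}" by (auto simp: mabs_0_iff)
    moreover have "?t \<mu> 0 = p \<mu> z"
      using \<mu> by (subst t) (simp_all add: mabs_def signed_moment_def moment_0 e_part_taylor_0 pj d_def)
    ultimately show ?thesis by (simp only: sum.insert sum.empty finite.emptyI empty_iff not_False_eq_True add_0_right)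
  qed
  finally show ?thesis by (simp add: eq_neg_iff_add_eq_0)
qed

end

section \<open>Linear images of Lebesgue measure\<close>

text \<open>The change of variables theorems of the library need a well-ordered index type. A copy of a
  finite index type, ordered by an enumeration, makes them available for every finite index type.\<close>

typedef 'a ordered_copy = "UNIV :: 'a set" morphisms of_copy to_copy ..

lemma bij_to_copy: "bij to_copy"
  by (rule bij_betw_byWitness[where f' = of_copy]) (auto simp: of_copy_inverse to_copy_inverse)

lemma bij_of_copy: "bij of_copy"
  by (rule bij_betw_byWitness[where f' = to_copy]) (auto simp: of_copy_inverse to_copy_inverse)

instance ordered_copy :: (finite) finite
proof
  have "finite (range (to_copy :: 'a \<Rightarrow> 'a ordered_copy))" by simp
  then show "finite (UNIV :: 'a ordered_copy set)" by (simp only: bij_is_surj[OF bij_to_copy])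
qed

definition enum_index :: "'a::finite \<Rightarrow> nat" where
  "enum_index = (SOME f. inj f)"

lemma inj_enum_index: "inj enum_index"
proof -
  have "\<exists>f :: 'a::finite \<Rightarrow> nat. inj f" using finite_imp_inj_to_nat_seg[of "UNIV :: 'a set"] by auto
  then show ?thesis unfolding enum_index_def by (rule someI_ex)
qed

instantiation ordered_copy :: (finite) wellorder
begin

definition "x \<le> y \<longleftrightarrow> enum_index (of_copy x) \<le> enum_index (of_copy y)"
definition "x < y \<longleftrightarrow> enum_index (of_copy x) < enum_index (of_copy y)"

instance
proof
  fix x y z :: "'a ordered_copy"
  show "x < y \<longleftrightarrow> x \<le> y \<and> \<not> y \<le> x" "x \<le> x" "x \<le> y \<Longrightarrow> y \<le> z \<Longrightarrow> x \<le> z" "x \<le> y \<or> y \<le> x"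
    by (auto simp: less_eq_ordered_copy_def less_ordered_copy_def)
  show "x \<le> y \<Longrightarrow> y \<le> x \<Longrightarrow> x = y"
    by (simp add: less_eq_ordered_copy_def inj_eq[OF inj_enum_index] of_copy_inject order_eq_iff[symmetric])
next
  fix P :: "'a ordered_copy \<Rightarrow> bool" and a
  assume step: "\<And>x. (\<And>y. y < x \<Longrightarrow> P y) \<Longrightarrow> P x"
  show "P a"
    by (induction "enum_index (of_copy a)" arbitrary: a rule: less_induct)
      (metis step less_ordered_copy_def)
qed

end

text \<open>Conjugation by \<open>g\<close> is a bijection between the permutations of the two index
  types that preserves signs.\<close>

lemma det_reindex:
  fixes A :: "real^'k^'k" and g :: "'l::finite \<Rightarrow> 'k"
  assumes g: "bij g"
  shows "det (\<chi> i j. A $ g i $ g j) = det A"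
proof -
  let ?m = "map_permutation UNIV g"
  have mp: "?m p (g i) = g (p i)" for p i
    using g by (intro map_permutation_apply) (auto simp: bij_is_inj)
  have bb: "bij_betw ?m {p. p permutes UNIV} {p. p permutes UNIV}"
  proof (rule bij_betwI[where g = "map_permutation UNIV (inv g)"])
    show "?m \<in> {p. p permutes UNIV} \<rightarrow> {p. p permutes UNIV}"
      using map_permutation_permutes[OF g] by auto
    show "map_permutation UNIV (inv g) \<in> {p. p permutes UNIV} \<rightarrow> {p. p permutes UNIV}"
      using map_permutation_permutes[OF bij_imp_bij_inv[OF g]] by auto
    show "map_permutation UNIV (inv g) (?m p) = p" if "p \<in> {p. p permutes UNIV}" for p
      by (rule map_permutation_compose_inv[OF g]) (use that g in \<open>auto simp: bij_is_inj\<close>)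
    show "?m (map_permutation UNIV (inv g) p) = p" if "p \<in> {p. p permutes UNIV}" for p
      by (rule map_permutation_compose_inv[OF bij_imp_bij_inv[OF g]])
        (use that g in \<open>auto simp: bij_is_surj surj_f_inv_f\<close>)
  qed
  have "det A = (\<Sum>p\<in>{p. p permutes UNIV}. of_int (sign (?m p)) * (\<Prod>i\<in>UNIV. A $ i $ ?m p i))"
    unfolding det_def by (rule sum.reindex_bij_betw[OF bb, symmetric])
  also have "\<dots> = (\<Sum>p\<in>{p. p permutes UNIV}. of_int (sign p) * (\<Prod>i\<in>UNIV. A $ g i $ g (p i)))"
  proof (rule sum.cong[OF refl])
    fix p :: "'l \<Rightarrow> 'l" assume "p \<in> {p. p permutes UNIV}"
    then have "sign (?m p) = sign p" using g by (intro sign_map_permutation) (auto simp: bij_is_inj)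
    moreover have "(\<Prod>i\<in>UNIV. A $ i $ ?m p i) = (\<Prod>i\<in>UNIV. A $ g i $ g (p i))"
      by (subst prod.reindex_bij_betw[OF g, symmetric]) (simp add: mp)
    ultimately show "of_int (sign (?m p)) * (\<Prod>i\<in>UNIV. A $ i $ ?m p i) = of_int (sign p) * (\<Prod>i\<in>UNIV. A $ g i $ g (p i))"
      by simp
  qed
  also have "\<dots> = det (\<chi> i j. A $ g i $ g j)" by (simp add: det_def)
  finally show ?thesis ..
qed

lemma lborel_reindex:
  fixes g :: "'k::finite \<Rightarrow> 'l::finite"
  assumes g: "bij g"
  shows "(lborel :: (real^'k) measure) = distr lborel borel (\<lambda>x :: real^'l. \<chi> i. x $ g i)"
proof -
  have m: "(\<lambda>x :: real^'l. \<chi> i. x $ g i) \<in> borel_measurable borel"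
    by (intro borel_measurable_continuous_onI continuous_intros)
  have "distr lborel borel (\<lambda>x :: real^'l. \<chi> i. x $ g i)
    = distr (distr (Pi\<^sub>M UNIV (\<lambda>_. lborel)) borel (\<lambda>c. \<chi> j. c (id j))) borel (\<lambda>x :: real^'l. \<chi> i. x $ g i)"
    by (simp only: lborel_vec_PiM(2)[OF bij_betw_id, symmetric])
  also have "\<dots> = distr (Pi\<^sub>M UNIV (\<lambda>_. lborel)) borel (\<lambda>c. \<chi> i. c (g i))"
    by (subst distr_distr[OF m lborel_vec_PiM(1)[OF bij_betw_id]]) (simp add: o_def)
  also have "\<dots> = lborel" by (rule lborel_vec_PiM(2)[OF g, symmetric])
  finally show ?thesis ..
qed

text \<open>Boundedness makes both sets finite in measure, so the real-valued formula for linear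
  images carries over to extended values; the preimage form is the one that survives a change of
  index type.\<close>

lemma emeasure_linear_vimage_wellorder:
  fixes \<Lambda> :: "real^'k::{finite,wellorder} \<Rightarrow> real^'k::_"
  assumes lin: "linear \<Lambda>" and bij: "bij \<Lambda>" and E: "E \<in> sets borel" "bounded E"
  shows "emeasure lborel E = ennreal \<bar>det (matrix \<Lambda>)\<bar> * emeasure lborel (\<Lambda> -` E)"
proof -
  have cont: "continuous_on UNIV \<Lambda>" using lin by (rule linear_continuous_on[OF linear_conv_bounded_linear[THEN iffD1]])
  have S: "\<Lambda> -` E \<in> sets borel"
    using measurable_sets[OF borel_measurable_continuous_onI[OF cont] E(1)] by simp
  have im: "\<Lambda> ` (\<Lambda> -` E) = E" using bij by (simp add: bij_is_surj surj_image_vimage_eq)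
  have eq: "\<Lambda> -` E = inv \<Lambda> ` E" using bij by (simp add: bij_vimage_eq_inv_image)
  have linv: "linear (inv \<Lambda>)" using bij lin by (simp add: bij_is_inj bij_is_surj inj_linear_imp_inv_linear)
  have mE: "E \<in> lmeasurable" using E by (intro bounded_set_imp_lmeasurable) auto
  have mS: "\<Lambda> -` E \<in> lmeasurable" unfolding eq by (rule measurable_linear_image[OF linv mE])
  have "measure lebesgue E = \<bar>det (matrix \<Lambda>)\<bar> * measure lebesgue (\<Lambda> -` E)"
    using measure_linear_image[OF lin mS] by (simp only: im)
  then have "ennreal (measure lebesgue E) = ennreal \<bar>det (matrix \<Lambda>)\<bar> * ennreal (measure lebesgue (\<Lambda> -` E))"
    by (simp add: ennreal_mult)
  moreover have "ennreal (measure lebesgue X) = emeasure lborel X"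
    if X: "X \<in> lmeasurable" "X \<in> sets borel" for X :: "(real^'k::_) set"
  proof -
    have "X \<in> sets lborel" using X(2) by simp
    then have "emeasure lebesgue X = emeasure lborel X"
      by (subst emeasure_completion[OF sets_completionI_sets]) auto
    then show ?thesis by (simp only: emeasure_eq_measure2[OF X(1), symmetric])
  qed
  ultimately show ?thesis using mE mS S E(1) by simp
qed

text \<open>Conjugating by the relabelling of coordinates moves the claim to the ordered index type.
  Relabelling preserves Lebesgue measure, and it permutes rows and columns of the matrix alike,
  which preserves the determinant.\<close>

lemma emeasure_linear_vimage:
  fixes \<Lambda> :: "real^'k \<Rightarrow> real^'k"
  assumes lin: "linear \<Lambda>" and bij: "bij \<Lambda>" and E: "E \<in> sets borel" "bounded E"
  shows "emeasure lborel E = ennreal \<bar>det (matrix \<Lambda>)\<bar> * emeasure lborel (\<Lambda> -` E)"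
proof -
  define \<tau> :: "real^'k \<Rightarrow> real^'k ordered_copy" where "\<tau> x = (\<chi> i. x $ of_copy i)" for x
  define \<sigma> :: "real^'k ordered_copy \<Rightarrow> real^'k" where "\<sigma> y = (\<chi> j. y $ to_copy j)" for y
  have ts: "\<tau> (\<sigma> y) = y" and st: "\<sigma> (\<tau> x) = x" for x y
    by (simp_all add: \<tau>_def \<sigma>_def vec_eq_iff of_copy_inverse to_copy_inverse)
  have linear: "linear \<tau>" "linear \<sigma>" by (auto intro!: linearI simp: \<tau>_def \<sigma>_def vec_eq_iff)
  have bijs: "bij \<tau>" "bij \<sigma>"
    by (rule bij_betw_byWitness[where f' = \<sigma>], auto simp: ts st)
      (rule bij_betw_byWitness[where f' = \<tau>], auto simp: ts st)
  have \<sigma>m: "\<sigma> \<in> borel_measurable borel" unfolding \<sigma>_def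
    by (intro borel_measurable_continuous_onI continuous_intros)
  have lb: "emeasure lborel S = emeasure lborel (\<sigma> -` S)" if "S \<in> sets borel" for S
  proof -
    have "emeasure lborel S = emeasure (distr lborel borel \<sigma>) S"
      unfolding \<sigma>_def by (simp only: lborel_reindex[OF bij_to_copy, symmetric])
    also have "\<dots> = emeasure lborel (\<sigma> -` S)" using \<sigma>m that by (simp add: emeasure_distr)
    finally show ?thesis .
  qed
  define \<Lambda>' where "\<Lambda>' = \<tau> \<circ> \<Lambda> \<circ> \<sigma>"
  have lin': "linear \<Lambda>'" unfolding \<Lambda>'_def by (intro linear_compose lin linear)
  have bij': "bij \<Lambda>'" unfolding \<Lambda>'_def by (intro bij_comp bij bijs)
  have \<sigma>\<tau>: "\<sigma> -` S = \<tau> ` S" for S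
  proof (rule antisym; rule subsetI)
    fix y assume "y \<in> \<sigma> -` S"
    then show "y \<in> \<tau> ` S" by (intro image_eqI[of y \<tau> "\<sigma> y"]) (auto simp: ts)
  qed (auto simp: st)
  have "bounded (\<sigma> -` E)" unfolding \<sigma>\<tau> by (rule bounded_linear_image[OF E(2)]) (simp add: linear_conv_bounded_linear[symmetric] linear)
  moreover have "\<sigma> -` E \<in> sets borel" using measurable_sets[OF \<sigma>m E(1)] by simp
  ultimately have "emeasure lborel (\<sigma> -` E) = ennreal \<bar>det (matrix \<Lambda>')\<bar> * emeasure lborel (\<Lambda>' -` \<sigma> -` E)"
    by (intro emeasure_linear_vimage_wellorder[OF lin' bij'])
  moreover have "\<Lambda>' -` \<sigma> -` E = \<sigma> -` \<Lambda> -` E" by (auto simp: \<Lambda>'_def st)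
  moreover have "\<Lambda> -` E \<in> sets borel"
    using measurable_sets[OF borel_measurable_continuous_onI[OF linear_continuous_on[OF linear_conv_bounded_linear[THEN iffD1, OF lin]]] E(1)] by simp
  moreover have "det (matrix \<Lambda>') = det (matrix \<Lambda>)"
  proof -
    have "\<sigma> (axis j 1) = axis (of_copy j) 1" for j
      by (auto simp: \<sigma>_def axis_def vec_eq_iff of_copy_inverse to_copy_inverse)
    then have "matrix \<Lambda>' $ i $ j = matrix \<Lambda> $ of_copy i $ of_copy j" for i j
      by (simp add: matrix_def \<Lambda>'_def \<tau>_def)
    then have "matrix \<Lambda>' = (\<chi> i j. matrix \<Lambda> $ of_copy i $ of_copy j)"
      by (simp add: vec_eq_iff)
    then show ?thesis by (simp add: det_reindex[OF bij_of_copy])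
  qed
  ultimately show ?thesis using lb[OF E(1)] lb[of "\<Lambda> -` E"] by simp
qed

section \<open>Fibre volumes\<close>

text \<open>Combining a full orthonormal basis with given coefficients is an orthogonal map after
  standard coordinates, so its determinant is 1 in absolute value.\<close>

lemma lborel_orthonormal:
  fixes Ob :: "(real^'n) set"
  assumes orth: "pairwise orthogonal Ob" and norm1: "\<And>b. b \<in> Ob \<Longrightarrow> norm b = 1" and card: "card Ob = CARD('n)"
  shows "(\<lambda>c. \<Sum>b\<in>Ob. c b *\<^sub>R b) \<in> borel_measurable (Pi\<^sub>M Ob (\<lambda>_. lborel))"
    and "lborel = distr (Pi\<^sub>M Ob (\<lambda>_. lborel)) borel (\<lambda>c. \<Sum>b\<in>Ob. c b *\<^sub>R b)"
proof -
  have fin: "finite Ob" using card by (metis card.infinite finite UNIV_not_empty card_eq_0_iff)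
  obtain \<phi> :: "'n \<Rightarrow> real^'n" where \<phi>: "bij_betw \<phi> UNIV Ob"
    using finite_same_card_bij[of "UNIV :: 'n set" Ob] fin card by auto
  have mem: "\<phi> j \<in> Ob" for j using \<phi> by (auto simp: bij_betw_def)
  have inj: "\<phi> i = \<phi> j \<longleftrightarrow> i = j" for i j using \<phi> by (auto simp: bij_betw_def inj_on_def)
  define \<omega> where "\<omega> x = (\<Sum>j\<in>UNIV. x $ j *\<^sub>R \<phi> j)" for x :: "real^'n"
  have lin: "linear \<omega>"
    by (rule linearI) (simp_all add: \<omega>_def scaleR_add_left sum.distrib scaleR_sum_right)
  have ip: "\<phi> i \<bullet> \<phi> j = (if i = j then 1 else 0)" for i j
    using orth norm1[OF mem] mem inj by (auto simp: pairwise_def orthogonal_def dot_square_norm)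
  have "\<omega> v \<bullet> \<omega> w = v \<bullet> w" for v w
  proof -
    have "\<omega> v \<bullet> \<omega> w = (\<Sum>i\<in>UNIV. \<Sum>j\<in>UNIV. w $ i * (v $ j * (if j = i then 1 else 0)))"
      by (simp add: \<omega>_def inner_sum_left inner_sum_right ip sum_distrib_left)
    also have "\<dots> = v \<bullet> w" by (simp add: if_distrib inner_vec_def mult.commute cong: if_cong)
    finally show ?thesis .
  qed
  then have ot: "orthogonal_transformation \<omega>" using lin by (simp add: orthogonal_transformation_def)
  have bij: "bij \<omega>" by (rule orthogonal_transformation_bij[OF ot])
  have det: "\<bar>det (matrix \<omega>)\<bar> = 1"
    using det_orthogonal_matrix[of "matrix \<omega>"] ot by (auto simp: orthogonal_transformation_matrix)
  have cont: "\<omega> \<in> borel_measurable borel"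
    by (intro borel_measurable_continuous_onI linear_continuous_on linear_conv_bounded_linear[THEN iffD1] lin)
  have rot: "lborel = distr lborel borel \<omega>"
  proof (rule lborel_eqI)
    fix l u :: "real^'n" assume lu: "\<And>b. b \<in> Basis \<Longrightarrow> l \<bullet> b \<le> u \<bullet> b"
    have "emeasure (distr lborel borel \<omega>) (box l u) = emeasure lborel (\<omega> -` box l u)"
      using cont by (simp add: emeasure_distr)
    also have "\<dots> = emeasure lborel (box l u)"
      using emeasure_linear_vimage[OF lin bij, of "box l u"] det by simp
    finally show "emeasure (distr lborel borel \<omega>) (box l u) = ennreal (\<Prod>b\<in>Basis. (u - l) \<bullet> b)"
      using lu by (simp add: emeasure_lborel_box)
  qed simp
  have \<omega>\<phi>: "\<omega> (\<chi> j. c (\<phi> j)) = (\<Sum>b\<in>Ob. c b *\<^sub>R b)" for c :: "real^'n \<Rightarrow> real"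
    using sum.reindex_bij_betw[OF \<phi>, of "\<lambda>b. c b *\<^sub>R b"] by (simp add: \<omega>_def)
  show "(\<lambda>c. \<Sum>b\<in>Ob. c b *\<^sub>R b) \<in> borel_measurable (Pi\<^sub>M Ob (\<lambda>_. lborel))"
    using measurable_compose[OF lborel_vec_PiM(1)[OF \<phi>] cont] by (simp add: \<omega>\<phi>)
  have "distr lborel borel \<omega> = distr (distr (Pi\<^sub>M Ob (\<lambda>_. lborel)) borel (\<lambda>c. \<chi> j. c (\<phi> j))) borel \<omega>"
    by (simp only: lborel_vec_PiM(2)[OF \<phi>, symmetric])
  also have "\<dots> = distr (Pi\<^sub>M Ob (\<lambda>_. lborel)) borel (\<lambda>c. \<Sum>b\<in>Ob. c b *\<^sub>R b)"
    by (subst distr_distr[OF cont lborel_vec_PiM(1)[OF \<phi>]]) (simp add: o_def \<omega>\<phi>)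
  finally show "lborel = distr (Pi\<^sub>M Ob (\<lambda>_. lborel)) borel (\<lambda>c. \<Sum>b\<in>Ob. c b *\<^sub>R b)"
    using rot by simp
qed

lemma PiM_lborel_translate:
  fixes B :: "'i set" and c0 :: "'i \<Rightarrow> real"
  assumes "finite B"
  shows "distr (Pi\<^sub>M B (\<lambda>_. lborel)) (Pi\<^sub>M B (\<lambda>_. lborel)) (\<lambda>c. \<lambda>b\<in>B. c b + c0 b) = Pi\<^sub>M B (\<lambda>_. lborel)"
proof -
  interpret product_sigma_finite "\<lambda>_::'i. lborel :: real measure"
    by (simp add: product_sigma_finite_def sigma_finite_lborel)
  have meas: "(\<lambda>c. \<lambda>b\<in>B. c b + c0 b) \<in> measurable (Pi\<^sub>M B (\<lambda>_. lborel)) (Pi\<^sub>M B (\<lambda>_. lborel :: real measure))"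
    by measurable
  show ?thesis
  proof (rule PiM_eqI[OF assms])
    fix A :: "'i \<Rightarrow> real set" assume A: "\<And>i. i \<in> B \<Longrightarrow> A i \<in> sets lborel"
    have sh: "(\<lambda>x. x + c) -` A i \<in> sets lborel" if "i \<in> B" for i c
    proof -
      have "(\<lambda>x::real. x + c) \<in> borel_measurable borel" by simp
      from measurable_sets[OF this, of "A i"] A[OF that] show ?thesis by simp
    qed
    have "emeasure (distr (Pi\<^sub>M B (\<lambda>_. lborel)) (Pi\<^sub>M B (\<lambda>_. lborel)) (\<lambda>c. \<lambda>b\<in>B. c b + c0 b)) (Pi\<^sub>E B A)
      = emeasure (Pi\<^sub>M B (\<lambda>_. lborel)) (Pi\<^sub>E B (\<lambda>i. (\<lambda>x. x + c0 i) -` A i))"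
    proof (subst emeasure_distr[OF meas])
      show "Pi\<^sub>E B A \<in> sets (Pi\<^sub>M B (\<lambda>_. lborel))" using A by (intro sets_PiM_I_finite assms) auto
      show "emeasure (Pi\<^sub>M B (\<lambda>_. lborel)) ((\<lambda>c. \<lambda>b\<in>B. c b + c0 b) -` Pi\<^sub>E B A \<inter> space (Pi\<^sub>M B (\<lambda>_. lborel)))
        = emeasure (Pi\<^sub>M B (\<lambda>_. lborel)) (Pi\<^sub>E B (\<lambda>i. (\<lambda>x. x + c0 i) -` A i))"
        by (rule arg_cong[where f="emeasure _"]) (auto simp: space_PiM PiE_iff)
    qed
    also have "\<dots> = (\<Prod>i\<in>B. emeasure lborel ((\<lambda>x. x + c0 i) -` A i))"
      by (rule emeasure_PiM[OF assms]) (use sh in auto)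
    also have "\<dots> = (\<Prod>i\<in>B. emeasure lborel (A i))"
    proof (rule prod.cong[OF refl])
      fix i assume i: "i \<in> B"
      have "emeasure lborel (A i) = emeasure (distr lborel borel ((+) (c0 i))) (A i)"
        by (simp only: lborel_distr_plus)
      also have "\<dots> = emeasure lborel ((\<lambda>x. x + c0 i) -` A i)"
        using A[OF i] by (subst emeasure_distr) (auto simp: add.commute[of "c0 i"] vimage_def)
      finally show "emeasure lborel ((\<lambda>x. x + c0 i) -` A i) = emeasure lborel (A i)" ..
    qed
    finally show "emeasure (distr (Pi\<^sub>M B (\<lambda>_. lborel)) (Pi\<^sub>M B (\<lambda>_. lborel)) (\<lambda>c. \<lambda>b\<in>B. c b + c0 b)) (Pi\<^sub>E B A)
      = (\<Prod>i\<in>B. emeasure lborel (A i))" .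
  qed simp
qed

section \<open>Volumes of the fibres of the nonnegative orthant\<close>

definition nonneg :: "(real^'n) set" where "nonneg = {u. \<forall>j. 0 \<le> u $ j}"

lemma closed_nonneg: "closed nonneg"
  unfolding nonneg_def by (intro closed_Collect_all closed_Collect_le continuous_intros)

lemma borel_nonneg [measurable]: "nonneg \<in> sets borel"
  by (rule borel_closed[OF closed_nonneg])

locale spanning_hull =
  fixes M :: "int^'n^'s"
  assumes spanning': "span (range (rcol M)) = UNIV"
    and hull': "0 \<notin> convex hull (range (rcol M))"
begin

definition ker :: "(real^'n) set" where "ker = {u. rmat M *v u = 0}"

lemma subspace_ker: "subspace ker"
  unfolding ker_def subspace_def by (auto simp: matrix_vector_right_distrib matrix_vector_mult_scaleR)

lemma surj_rmat: "\<exists>u. rmat M *v u = x"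
proof -
  have "x \<in> span (rcol M ` UNIV)" using spanning' by simp
  then obtain a where "x = (\<Sum>j\<in>UNIV. a j *\<^sub>R rcol M j)"
    by (rule span_image_coeffs[rotated]) auto
  then have "rmat M *v (\<chi> j. a j) = x" by (simp add: rmat_mult)
  then show ?thesis ..
qed

text \<open>The same choice expression as in \<open>affine_volume\<close>, whose direction space
  turns out to be \<open>ker\<close>; hence both use the very same basis.\<close>

definition onb :: "(real^'n) set" where
  "onb = (SOME B. pairwise orthogonal B \<and> (\<forall>b\<in>B. norm b = 1) \<and> span B = ker)"

lemma onb: "pairwise orthogonal onb" "b \<in> onb \<Longrightarrow> norm b = 1" "span onb = ker"
proof -
  obtain B where "pairwise orthogonal B" "\<And>x. x \<in> B \<Longrightarrow> norm x = 1" "span B = ker"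
    using orthonormal_basis_subspace[OF subspace_ker] by metis
  then have "\<exists>B. pairwise orthogonal B \<and> (\<forall>b\<in>B. norm b = 1) \<and> span B = ker" by blast
  from someI_ex[OF this] show "pairwise orthogonal onb" "b \<in> onb \<Longrightarrow> norm b = 1" "span onb = ker"
    unfolding onb_def by blast+
qed

lemma independent_onb: "independent onb"
  using onb by (intro pairwise_orthogonal_independent) force+

lemma finite_onb: "finite onb"
  using independent_onb independent_imp_finite by blast

lemma card_onb: "card onb = dim ker"
  using independent_onb onb(3) by (metis dim_eq_card_independent dim_span)

abbreviation \<nu> :: "(real^'n \<Rightarrow> real) measure" where "\<nu> \<equiv> Pi\<^sub>M onb (\<lambda>_. lborel)"

definition comb :: "(real^'n \<Rightarrow> real) \<Rightarrow> real^'n" where "comb c = (\<Sum>b\<in>onb. c b *\<^sub>R b)"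

lemma comb_ker: "rmat M *v comb c = 0"
proof -
  have "comb c \<in> span onb" unfolding comb_def by (intro span_sum span_scale span_base)
  then show ?thesis by (simp add: onb(3) ker_def)
qed

text \<open>The volume of the fibre of the orthant through \<open>a\<close>, in orthonormal
  coordinates of the kernel. The base point is explicit, but matters only through its image under
  \<open>M\<close>.\<close>

definition fibre_mass :: "real^'n \<Rightarrow> ennreal" where
  "fibre_mass a = emeasure \<nu> {c \<in> onb \<rightarrow>\<^sub>E UNIV. a + comb c \<in> nonneg}"

lemma measurable_comb [measurable]: "comb \<in> borel_measurable \<nu>"
  unfolding comb_def by measurable

lemma fibre_mass_sets: "{c \<in> onb \<rightarrow>\<^sub>E UNIV. a + comb c \<in> nonneg} \<in> sets \<nu>"
proof -
  have "(\<lambda>c. a + comb c) \<in> borel_measurable \<nu>" by measurable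
  from measurable_sets[OF this borel_nonneg] show ?thesis
    by (simp add: space_PiM vimage_def Int_def conj_commute)
qed

text \<open>Two base points of one fibre differ by a kernel vector, so changing them translates the
  coordinates, and the product measure is invariant under translations.\<close>

lemma fibre_mass_translate:
  assumes "rmat M *v a = rmat M *v a'" shows "fibre_mass a = fibre_mass a'"
proof -
  have "a - a' \<in> span onb" using assms by (simp add: onb(3) ker_def matrix_vector_mult_diff_distrib)
  then have c0: "a - a' = comb (\<lambda>b. (a - a') \<bullet> b)"
    unfolding comb_def by (intro orthonormal_basis_expand[symmetric] onb finite_onb) auto
  define c0 where "c0 b = (a - a') \<bullet> b" for b
  have shift: "a' + comb (\<lambda>b\<in>onb. c b + c0 b) = a + comb c" for c
  proof -
    have "comb (\<lambda>b\<in>onb. c b + c0 b) = comb c + comb c0"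
      by (simp add: comb_def scaleR_add_left sum.distrib)
    then show ?thesis using c0 by (simp add: c0_def[abs_def] algebra_simps)
  qed
  have meas: "(\<lambda>c. \<lambda>b\<in>onb. c b + c0 b) \<in> measurable \<nu> \<nu>" by measurable
  have "fibre_mass a' = emeasure (distr \<nu> \<nu> (\<lambda>c. \<lambda>b\<in>onb. c b + c0 b)) {c \<in> onb \<rightarrow>\<^sub>E UNIV. a' + comb c \<in> nonneg}"
    by (simp only: PiM_lborel_translate[OF finite_onb] fibre_mass_def)
  also have "\<dots> = emeasure \<nu> ((\<lambda>c. \<lambda>b\<in>onb. c b + c0 b) -` {c \<in> onb \<rightarrow>\<^sub>E UNIV. a' + comb c \<in> nonneg} \<inter> space \<nu>)"
    by (rule emeasure_distr[OF meas fibre_mass_sets])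
  also have "(\<lambda>c. \<lambda>b\<in>onb. c b + c0 b) -` {c \<in> onb \<rightarrow>\<^sub>E UNIV. a' + comb c \<in> nonneg} \<inter> space \<nu>
    = {c \<in> onb \<rightarrow>\<^sub>E UNIV. a + comb c \<in> nonneg}"
    by (auto simp: space_PiM shift)
  finally show ?thesis by (simp add: fibre_mass_def)
qed

text \<open>Adding \<open>v\<close> maps the nonnegative points of one fibre into those of the
  other. This is the source of the monotonicity of \<open>T\<close> along the cone.\<close>

lemma fibre_mass_mono:
  assumes "v \<in> nonneg" shows "fibre_mass a \<le> fibre_mass (a + v)"
  unfolding fibre_mass_def
proof (rule emeasure_mono[OF _ fibre_mass_sets])
  show "{c \<in> onb \<rightarrow>\<^sub>E UNIV. a + comb c \<in> nonneg} \<subseteq> {c \<in> onb \<rightarrow>\<^sub>E UNIV. a + v + comb c \<in> nonneg}"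
    using assms unfolding nonneg_def by (auto simp: add_nonneg_nonneg) (metis add.commute add.left_commute add_nonneg_nonneg)
qed

lemma fibre_mass_finite: "fibre_mass a < \<infinity>"
proof -
  interpret product_sigma_finite "\<lambda>_::real^'n. lborel :: real measure"
    by (simp add: product_sigma_finite_def sigma_finite_lborel)
  obtain h \<delta> where h: "\<delta> > 0" "\<And>u j. (\<And>j. 0 \<le> u $ j) \<Longrightarrow> \<delta> * u $ j \<le> h \<bullet> (rmat M *v u)"
    using positive_functional[OF hull'] by metis
  \<comment> \<open>On the fibre the positive functional is constant and bounds every entry of a
    nonnegative point; \<open>norm a\<close> accounts for the base point.\<close>
  define R where "R = (\<Sum>j\<in>(UNIV::'n set). (h \<bullet> (rmat M *v a)) / \<delta>) + norm a"
  have "{c \<in> onb \<rightarrow>\<^sub>E UNIV. a + comb c \<in> nonneg} \<subseteq> PiE onb (\<lambda>_. {-R..R})"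
  proof
    fix c assume "c \<in> {c \<in> onb \<rightarrow>\<^sub>E UNIV. a + comb c \<in> nonneg}"
    then have c: "c \<in> onb \<rightarrow>\<^sub>E UNIV" and nn: "\<And>j. 0 \<le> (a + comb c) $ j" by (auto simp: nonneg_def)
    have bnd: "(a + comb c) $ j \<le> (h \<bullet> (rmat M *v a)) / \<delta>" for j
      using h(2)[OF nn, of j] h(1) by (simp add: matrix_vector_right_distrib comb_ker field_simps)
    have "norm (a + comb c) \<le> (\<Sum>j\<in>UNIV. \<bar>(a + comb c) $ j\<bar>)" by (rule norm_le_l1_cart)
    also have "\<dots> \<le> (\<Sum>j\<in>(UNIV::'n set). (h \<bullet> (rmat M *v a)) / \<delta>)"
      by (rule sum_mono) (use bnd nn in simp)
    finally have "norm (comb c) \<le> R"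
      using norm_triangle_ineq4[of "a + comb c" a] by (simp add: R_def)
    have "\<bar>c b\<bar> \<le> R" if b: "b \<in> onb" for b
    proof -
      have "comb c \<bullet> b = (\<Sum>b'\<in>onb. c b' * (b' \<bullet> b))" by (simp add: comb_def inner_sum_left)
      also have "\<dots> = (\<Sum>b'\<in>onb. if b' = b then c b else 0)"
        using onb(1,2) b by (intro sum.cong) (auto simp: pairwise_def orthogonal_def dot_square_norm)
      also have "\<dots> = c b" using b finite_onb by simp
      finally have "\<bar>c b\<bar> \<le> norm (comb c) * norm b" by (metis Cauchy_Schwarz_ineq2)
      then show ?thesis using onb(2)[OF b] \<open>norm (comb c) \<le> R\<close> by simp
    qed
    then show "c \<in> PiE onb (\<lambda>_. {-R..R})" using c by (force simp: PiE_iff abs_le_iff)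
  qed
  then have "fibre_mass a \<le> emeasure \<nu> (PiE onb (\<lambda>_. {-R..R}))"
    unfolding fibre_mass_def by (rule emeasure_mono) (intro sets_PiM_I_finite finite_onb, simp)
  also have "\<dots> = (\<Prod>b\<in>onb. emeasure lborel {-R..R})"
    by (rule emeasure_PiM) (auto simp: finite_onb)
  also have "\<dots> < \<infinity>" by (simp add: emeasure_lborel_Icc_eq ennreal_power less_top[symmetric] power_eq_top_ennreal)
  finally show ?thesis .
qed

definition gram_det :: real where "gram_det = det (rmat M ** transpose (rmat M))"

lemma truncated_power_fibre_mass:
  assumes "rmat M *v a = x" shows "truncated_power M x = enn2real (fibre_mass a) / sqrt gram_det"
proof -
  define a' where "a' = (SOME a. a \<in> {u. rmat M *v u = x})"
  have a': "rmat M *v a' = x" using someI_ex[of "\<lambda>a. a \<in> {u. rmat M *v u = x}"] assms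
    unfolding a'_def by blast
  have img: "(\<lambda>v. v - a') ` {u. rmat M *v u = x} = ker"
  proof (rule antisym; rule subsetI)
    fix v assume "v \<in> (\<lambda>v. v - a') ` {u. rmat M *v u = x}"
    then show "v \<in> ker" using a' by (auto simp: ker_def matrix_vector_mult_diff_distrib)
  next
    fix v assume "v \<in> ker"
    then show "v \<in> (\<lambda>v. v - a') ` {u. rmat M *v u = x}"
      using a' by (intro image_eqI[of _ _ "v + a'"]) (auto simp: ker_def matrix_vector_right_distrib)
  qed
  have "affine_volume {u. rmat M *v u = x} {u. (\<forall>j. 0 \<le> u $ j) \<and> rmat M *v u = x}
    = measure \<nu> {c \<in> onb \<rightarrow>\<^sub>E UNIV. a' + (\<Sum>b\<in>onb. c b *\<^sub>R b) \<in> {u. (\<forall>j. 0 \<le> u $ j) \<and> rmat M *v u = x}}"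
    unfolding affine_volume_def Let_def a'_def[symmetric] img onb_def[symmetric] ..
  also have "{c \<in> onb \<rightarrow>\<^sub>E UNIV. a' + (\<Sum>b\<in>onb. c b *\<^sub>R b) \<in> {u. (\<forall>j. 0 \<le> u $ j) \<and> rmat M *v u = x}}
    = {c \<in> onb \<rightarrow>\<^sub>E UNIV. a' + comb c \<in> nonneg}"
    using a' comb_ker by (auto simp: comb_def[symmetric] nonneg_def matrix_vector_right_distrib)
  also have "measure \<nu> {c \<in> onb \<rightarrow>\<^sub>E UNIV. a' + comb c \<in> nonneg} = enn2real (fibre_mass a')"
    by (simp add: fibre_mass_def measure_def)
  also have "fibre_mass a' = fibre_mass a" using a' assms by (intro fibre_mass_translate) simp
  finally show ?thesis by (simp add: truncated_power_def gram_det_def)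
qed

lemma truncated_power_mono:
  assumes "v \<in> nonneg" "gram_det \<ge> 0" shows "truncated_power M x \<le> truncated_power M (x + rmat M *v v)"
proof -
  obtain a where a: "rmat M *v a = x" using surj_rmat by blast
  then have "rmat M *v (a + v) = x + rmat M *v v" by (simp add: matrix_vector_right_distrib)
  from truncated_power_fibre_mass[OF a] truncated_power_fibre_mass[OF this] show ?thesis
    using enn2real_mono[OF fibre_mass_mono[OF assms(1)] fibre_mass_finite[unfolded infinity_ennreal_def]] assms(2) by (simp add: divide_right_mono)
qed

section \<open>Disintegration along the row space\<close>

lemma linear_rmat: "linear (\<lambda>u. rmat M *v u)"
  by (rule matrix_vector_mul_linear)

text \<open>\<open>W\<close> is an orthonormal basis of the orthogonal complement of the kernel, the
  row space, which \<open>M\<close> maps bijectively onto the target. Together with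
  \<open>onb\<close> it separates the choice of a fibre from the position within it.\<close>

lemma row_space_basis:
  obtains W where "pairwise orthogonal W" "\<And>w. w \<in> W \<Longrightarrow> norm w = 1" "finite W" "card W = CARD('s)"
    "\<And>w b. w \<in> W \<Longrightarrow> b \<in> onb \<Longrightarrow> orthogonal b w" "onb \<inter> W = {}" "card (W \<union> onb) = CARD('n)"
    "\<And>y. (\<And>x. x \<in> ker \<Longrightarrow> orthogonal x y) \<Longrightarrow> y \<in> span W"
proof -
  define perp where "perp = {y. \<forall>x\<in>ker. orthogonal x y}"
  have "subspace perp" unfolding perp_def subspace_def by (auto simp: orthogonal_clauses)
  then obtain W where W: "W \<subseteq> perp" "pairwise orthogonal W" "\<And>w. w \<in> W \<Longrightarrow> norm w = 1"
    "independent W" "card W = dim perp" "span W = perp"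
    using orthonormal_basis_subspace by metis
  have fin: "finite W" using W(4) independent_imp_finite by blast
  have "onb \<subseteq> ker" using onb(3) span_superset by blast
  then have orth: "orthogonal b w" if "w \<in> W" "b \<in> onb" for w b using that W(1) by (auto simp: perp_def)
  have disj: "onb \<inter> W = {}"
  proof -
    have False if "b \<in> onb" "b \<in> W" for b
      using orth[OF that(2) that(1)] onb(2)[OF that(1)] by (simp add: orthogonal_def)
    then show ?thesis by blast
  qed
  have "dim {y \<in> UNIV. \<forall>x\<in>ker. orthogonal x y} + dim ker = dim (UNIV :: (real^'n) set)"
    by (rule dim_subspace_orthogonal_to_vectors) (auto simp: subspace_ker)
  then have cn: "dim perp + dim ker = CARD('n)" by (simp add: perp_def)
  have inj: "inj_on (\<lambda>u. rmat M *v u) (span W)"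
  proof (rule inj_onI)
    fix x y assume xy: "x \<in> span W" "y \<in> span W" "rmat M *v x = rmat M *v y"
    then have "x - y \<in> perp" "x - y \<in> ker"
      using span_diff[OF xy(1,2)] W(6) by (auto simp: ker_def matrix_vector_mult_diff_distrib)
    then have "orthogonal (x - y) (x - y)" unfolding perp_def by blast
    then show "x = y" by (simp add: orthogonal_def)
  qed
  have "(\<lambda>u. rmat M *v u) ` span W = UNIV"
  proof -
    have "x \<in> (\<lambda>u. rmat M *v u) ` span W" for x
    proof -
      obtain u where u: "rmat M *v u = x" using surj_rmat by blast
      obtain y z where yz: "y \<in> span ker" "\<And>w. w \<in> span ker \<Longrightarrow> orthogonal z w" "u = y + z"
        using orthogonal_subspace_decomp_exists[of ker u] by metis
      have "y \<in> ker" using yz(1) subspace_ker by (simp add: span_eq_iff[THEN iffD2])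
      then have "rmat M *v z = x" using u yz(3) by (simp add: ker_def matrix_vector_right_distrib)
      moreover have "z \<in> perp" unfolding perp_def using yz(2) span_superset[of ker]
        by (auto simp: orthogonal_commute)
      ultimately show ?thesis using W(6) by (auto intro: image_eqI[of x _ z])
    qed
    then show ?thesis by blast
  qed
  then have "CARD('s) = dim ((\<lambda>u. rmat M *v u) ` span W)" by simp
  also have "\<dots> = dim (span W)" by (rule dim_image_eq[OF linear_rmat]) (simp only: span_span inj)
  also have "\<dots> = card W" using W(5) W(6) by simp
  finally have cs: "card W = CARD('s)" ..
  have "card (W \<union> onb) = CARD('n)"
    using cn W(5) card_onb disj by (subst card_Un_disjoint) (auto simp: fin finite_onb)
  moreover have "y \<in> span W" if "\<And>x. x \<in> ker \<Longrightarrow> orthogonal x y" for y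
    using that by (simp add: W(6) perp_def)
  ultimately show ?thesis using that[OF W(2,3) fin cs orth disj] by blast
qed

definition vol_set :: "(real^'s) set \<Rightarrow> (real^'n) set" where
  "vol_set E = {u \<in> nonneg. rmat M *v u \<in> E}"

lemma measurable_rmat: "(\<lambda>u. rmat M *v u) \<in> borel_measurable borel"
  by (intro borel_measurable_continuous_onI continuous_rmat)

lemma vol_set_borel: "E \<in> sets borel \<Longrightarrow> vol_set E \<in> sets borel"
proof -
  assume "E \<in> sets borel"
  from measurable_sets[OF measurable_rmat this] have "(\<lambda>u. rmat M *v u) -` E \<in> sets borel" by simp
  moreover have "vol_set E = nonneg \<inter> (\<lambda>u. rmat M *v u) -` E" by (auto simp: vol_set_def)
  ultimately show ?thesis by simp
qed

text \<open>Fubini in the coordinates of \<open>W\<close> and \<open>onb\<close>: \<open>d\<close>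
  selects a fibre, \<open>L d\<close> is the point below it, and the kernel coordinates are
  integrated out. Restricted to the row space, \<open>M\<close> becomes a square matrix with the
  same Gram matrix, so its Jacobian is the root of \<open>gram_det\<close>, the normalisation of
  \<open>T\<close>. \<open>Q\<close> and \<open>L\<close> stay abstract, since only comparisons with
  constants follow.\<close>

lemma volume_disintegration:
  assumes E: "E \<in> sets borel" "bounded E"
  obtains Q :: "(real^'n \<Rightarrow> real) measure" and L where
    "emeasure lborel (vol_set E) = (\<integral>\<^sup>+d. indicator E (L d) * ennreal (sqrt gram_det * truncated_power M (L d)) \<partial>Q)"
    "{d \<in> space Q. L d \<in> E} \<in> sets Q"
    "emeasure lborel E = ennreal (sqrt gram_det) * emeasure Q {d \<in> space Q. L d \<in> E}"
    "gram_det > 0"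
proof -
  interpret product_sigma_finite "\<lambda>_::real^'n. lborel :: real measure"
    by (simp add: product_sigma_finite_def sigma_finite_lborel)
  obtain W where W: "pairwise orthogonal W" "\<And>w. w \<in> W \<Longrightarrow> norm w = 1" "finite W" "card W = CARD('s)"
    and orth: "\<And>w b. w \<in> W \<Longrightarrow> b \<in> onb \<Longrightarrow> orthogonal b w" and disj: "onb \<inter> W = {}"
    and cO: "card (W \<union> onb) = CARD('n)" and spanW: "\<And>y. (\<And>x. x \<in> ker \<Longrightarrow> orthogonal x y) \<Longrightarrow> y \<in> span W"
    using row_space_basis by metis
  define Q where "Q = Pi\<^sub>M W (\<lambda>_. lborel :: real measure)"
  define D where "D d = (\<Sum>w\<in>W. d w *\<^sub>R w)" for d :: "real^'n \<Rightarrow> real"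
  define L where "L d = rmat M *v D d" for d
  obtain \<psi> :: "'s \<Rightarrow> real^'n" where \<psi>: "bij_betw \<psi> UNIV W"
    using finite_same_card_bij[of "UNIV :: 's set" W] W(3,4) by auto
  define \<Lambda> where "\<Lambda> y = (\<Sum>i\<in>UNIV. y $ i *\<^sub>R (rmat M *v \<psi> i))" for y :: "real^'s"
  have lin: "linear \<Lambda>"
    by (rule linearI) (simp_all add: \<Lambda>_def scaleR_add_left sum.distrib scaleR_sum_right)
  have LL: "\<Lambda> (\<chi> i. d (\<psi> i)) = L d" for d
  proof -
    have "D d = (\<Sum>i\<in>UNIV. d (\<psi> i) *\<^sub>R \<psi> i)"
      unfolding D_def by (rule sum.reindex_bij_betw[OF \<psi>, symmetric])
    then show ?thesis by (simp add: L_def \<Lambda>_def linear_sum[OF linear_rmat] matrix_vector_mult_scaleR)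
  qed
  \<comment> \<open>The rows of \<open>M\<close> are orthogonal to the kernel, so their expansions
    in \<open>W\<close> are complete and the inner products of rows can be computed there.\<close>
  have row: "(\<Sum>w\<in>W. (rmat M $ k \<bullet> w) *\<^sub>R w) = rmat M $ k" for k
  proof (rule orthonormal_basis_expand[OF W(1,2) _ W(3)])
    show "rmat M $ k \<in> span W"
    proof (rule spanW)
      fix x assume "x \<in> ker"
      then have "(rmat M *v x) $ k = 0" by (simp add: ker_def)
      then show "orthogonal x (rmat M $ k)"
        by (simp only: matrix_vector_mul_component orthogonal_def inner_commute[of x])
    qed
  qed
  have gram: "matrix \<Lambda> ** transpose (matrix \<Lambda>) = rmat M ** transpose (rmat M)"
  proof -
    have mL: "matrix \<Lambda> $ k $ i = rmat M $ k \<bullet> \<psi> i" for k i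
    proof -
      have "\<Lambda> (axis i 1) = (\<Sum>j\<in>UNIV. if j = i then rmat M *v \<psi> j else 0)"
        unfolding \<Lambda>_def by (intro sum.cong) (auto simp: axis_def)
      then show ?thesis by (simp add: matrix_def matrix_vector_mul_component)
    qed
    have "(matrix \<Lambda> ** transpose (matrix \<Lambda>)) $ k $ l = (rmat M ** transpose (rmat M)) $ k $ l" for k l
    proof -
      have "(matrix \<Lambda> ** transpose (matrix \<Lambda>)) $ k $ l = (\<Sum>i\<in>UNIV. (rmat M $ k \<bullet> \<psi> i) * (rmat M $ l \<bullet> \<psi> i))"
        by (simp add: matrix_matrix_mult_def transpose_def mL)
      also have "\<dots> = (\<Sum>w\<in>W. (rmat M $ k \<bullet> w) * (rmat M $ l \<bullet> w))"
        by (rule sum.reindex_bij_betw[OF \<psi>])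
      also have "\<dots> = (\<Sum>w\<in>W. (rmat M $ k \<bullet> w) *\<^sub>R w) \<bullet> rmat M $ l"
        by (simp add: inner_sum_left inner_sum_right inner_commute[of _ "rmat M $ l"])
      also have "\<dots> = rmat M $ k \<bullet> rmat M $ l" by (simp only: row)
      also have "\<dots> = (rmat M ** transpose (rmat M)) $ k $ l"
        by (simp add: matrix_matrix_mult_def transpose_def inner_vec_def)
      finally show ?thesis .
    qed
    then show ?thesis by (simp add: vec_eq_iff)
  qed
  have dG: "gram_det = (det (matrix \<Lambda>))\<^sup>2"
    unfolding gram_det_def gram[symmetric] by (simp add: det_mul power2_eq_square)
  have orth2: "orthogonal w b" if "w \<in> W" "b \<in> onb" for w b
    by (subst orthogonal_commute) (rule orth[OF that])
  have po: "pairwise orthogonal (W \<union> onb)"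
    using W(1) onb(1) unfolding pairwise_def by (auto intro: orth orth2)
  have spanO: "u \<in> span (W \<union> onb)" for u
  proof -
    have "0 \<notin> W \<union> onb" using W(2) onb(2) by force
    then have "independent (W \<union> onb)" by (rule pairwise_orthogonal_independent[OF po])
    then have "dim (W \<union> onb) = CARD('n)" using cO by (simp add: dim_eq_card_independent)
    then show ?thesis by (metis DIM_cart DIM_real UNIV_I dim_eq_full mult.right_neutral)
  qed
  have n1: "b \<in> W \<union> onb \<Longrightarrow> norm b = 1" for b using W(2) onb(2) by auto
  \<comment> \<open>Of a preimage under \<open>M\<close> only the row space component counts; the
    kernel component is mapped to 0.\<close>
  have "surj \<Lambda>"
  proof -
    have "\<exists>y. \<Lambda> y = x" for x
    proof -
      obtain u where u: "rmat M *v u = x" using surj_rmat by blast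
      have "u = (\<Sum>b\<in>W \<union> onb. (u \<bullet> b) *\<^sub>R b)"
        by (rule orthonormal_basis_expand[OF po n1 spanO, symmetric]) (auto simp: W(3) finite_onb)
      also have "\<dots> = D (\<lambda>b. u \<bullet> b) + comb (\<lambda>b. u \<bullet> b)"
        unfolding D_def comb_def by (rule sum.union_disjoint) (use W(3) finite_onb disj in auto)
      finally have "x = L (\<lambda>b. u \<bullet> b)" unfolding L_def u[symmetric]
        by (metis add.right_neutral comb_ker matrix_vector_right_distrib)
      then show ?thesis using LL by metis
    qed
    then show ?thesis by (auto simp: surj_def) metis
  qed
  then have inj: "inj \<Lambda>" by (rule linear_surjective_imp_injective[OF lin]) simp
  have bij: "bij \<Lambda>" using inj \<open>surj \<Lambda>\<close> by (simp add: bij_def)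
  have "det (matrix \<Lambda>) \<noteq> 0" using det_nz_iff_inj[OF lin] inj by blast
  then have pos: "gram_det > 0" by (simp add: dG)
  have sq: "sqrt gram_det = \<bar>det (matrix \<Lambda>)\<bar>" by (simp add: dG)
  have \<Lambda>m: "\<Lambda> \<in> borel_measurable borel"
    by (intro borel_measurable_continuous_onI linear_continuous_on linear_conv_bounded_linear[THEN iffD1] lin)
  have Em: "\<Lambda> -` E \<in> sets borel" using measurable_sets[OF \<Lambda>m E(1)] by simp
  have set_eq: "(\<lambda>c. \<chi> i. c (\<psi> i)) -` (\<Lambda> -` E) \<inter> space Q = {d \<in> space Q. L d \<in> E}"
    by (auto simp: LL)
  have Qset: "{d \<in> space Q. L d \<in> E} \<in> sets Q"
    using measurable_sets[OF lborel_vec_PiM(1)[OF \<psi>] Em] unfolding Q_def[symmetric] set_eq .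
  have "emeasure lborel (\<Lambda> -` E) = emeasure (distr Q borel (\<lambda>c. \<chi> i. c (\<psi> i))) (\<Lambda> -` E)"
    unfolding Q_def by (simp only: lborel_vec_PiM(2)[OF \<psi>, symmetric])
  also have "\<dots> = emeasure Q {d \<in> space Q. L d \<in> E}"
    unfolding set_eq[symmetric] by (rule emeasure_distr) (use lborel_vec_PiM(1)[OF \<psi>] Em in \<open>auto simp: Q_def\<close>)
  finally have eE: "emeasure lborel E = ennreal (sqrt gram_det) * emeasure Q {d \<in> space Q. L d \<in> E}"
    using emeasure_linear_vimage[OF lin bij E] by (simp add: sq)
  have fibT: "fibre_mass (D d) = ennreal (sqrt gram_det * truncated_power M (L d))" for d
  proof -
    have "sqrt gram_det * truncated_power M (L d) = enn2real (fibre_mass (D d))"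
      using truncated_power_fibre_mass[of "D d" "L d"] pos by (simp add: L_def)
    then show ?thesis using fibre_mass_finite[of "D d"] by (simp add: ennreal_enn2real_if)
  qed
  let ?S = "vol_set E"
  let ?s = "\<lambda>c. \<Sum>b\<in>W \<union> onb. c b *\<^sub>R b"
  note sm = lborel_orthonormal[OF po n1 cO]
  have ind: "(indicator ?S :: real^'n \<Rightarrow> ennreal) \<in> borel_measurable borel"
    by (rule borel_measurable_indicator) (use vol_set_borel[OF E(1)] in simp)
  have "emeasure lborel ?S = (\<integral>\<^sup>+u. indicator ?S u \<partial>lborel)"
    using vol_set_borel[OF E(1)] by simp
  also have "\<dots> = (\<integral>\<^sup>+u. indicator ?S u \<partial>distr (Pi\<^sub>M (W \<union> onb) (\<lambda>_. lborel)) borel ?s)"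
    by (simp only: sm(2)[symmetric])
  also have "\<dots> = (\<integral>\<^sup>+c. indicator ?S (?s c) \<partial>Pi\<^sub>M (W \<union> onb) (\<lambda>_. lborel))"
    using nn_integral_distr[OF sm(1), of "indicator ?S"] ind by (simp only: measurable_distr_eq1 simp_thms)
  also have "\<dots> = (\<integral>\<^sup>+d. \<integral>\<^sup>+c. indicator ?S (?s (merge W onb (d, c))) \<partial>\<nu> \<partial>Q)"
    unfolding Q_def
    by (rule product_nn_integral_fold) (use disj W(3) finite_onb measurable_compose[OF sm(1) ind] in auto)
  also have "\<dots> = (\<integral>\<^sup>+d. indicator E (L d) * ennreal (sqrt gram_det * truncated_power M (L d)) \<partial>Q)"
  proof (rule nn_integral_cong)
    fix d
    have ms: "?s (merge W onb (d, c)) = D d + comb c" for c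
    proof -
      have "?s (merge W onb (d, c)) = (\<Sum>b\<in>W. merge W onb (d, c) b *\<^sub>R b) + (\<Sum>b\<in>onb. merge W onb (d, c) b *\<^sub>R b)"
        by (rule sum.union_disjoint) (use W(3) finite_onb disj in auto)
      also have "\<dots> = D d + comb c"
        unfolding D_def comb_def
        by (intro arg_cong2[where f="(+)"] sum.cong refl) (use disj in \<open>auto simp: merge_def\<close>)
      finally show ?thesis .
    qed
    have "(\<integral>\<^sup>+c. indicator ?S (?s (merge W onb (d, c))) \<partial>\<nu>)
      = (\<integral>\<^sup>+c. indicator E (L d) * indicator {c \<in> onb \<rightarrow>\<^sub>E UNIV. D d + comb c \<in> nonneg} c \<partial>\<nu>)"
      by (rule nn_integral_cong) (auto simp: ms vol_set_def indicator_def space_PiM matrix_vector_right_distrib comb_ker L_def)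
    also have "\<dots> = indicator E (L d) * fibre_mass (D d)"
      unfolding fibre_mass_def by (rule nn_integral_cmult_indicator[OF fibre_mass_sets])
    finally show "(\<integral>\<^sup>+c. indicator ?S (?s (merge W onb (d, c))) \<partial>\<nu>)
      = indicator E (L d) * ennreal (sqrt gram_det * truncated_power M (L d))" by (simp only: fibT)
  qed
  finally show ?thesis using Qset eE pos by (rule that)
qed

lemma gram_det_pos: "gram_det > 0"
  using volume_disintegration[of "{}"] by auto

text \<open>A constant bound on \<open>T\<close> over \<open>E\<close> factors out of the
  disintegration; what is left is the mass of the fibres over \<open>E\<close>, which is the volume
  of \<open>E\<close> up to the Jacobian.\<close>

lemma vol_upper:
  assumes E: "E \<in> sets borel" "bounded E" and \<tau>: "\<And>y. y \<in> E \<Longrightarrow> truncated_power M y \<le> \<tau>" "\<tau> \<ge> 0"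
  shows "emeasure lborel (vol_set E) \<le> ennreal \<tau> * emeasure lborel E"
proof -
  obtain Q :: "(real^'n \<Rightarrow> real) measure" and L where
    eq: "emeasure lborel (vol_set E) = (\<integral>\<^sup>+d. indicator E (L d) * ennreal (sqrt gram_det * truncated_power M (L d)) \<partial>Q)"
    and s: "{d \<in> space Q. L d \<in> E} \<in> sets Q"
    and e: "emeasure lborel E = ennreal (sqrt gram_det) * emeasure Q {d \<in> space Q. L d \<in> E}"
    and "gram_det > 0"
    by (rule volume_disintegration[OF E])
  have "emeasure lborel (vol_set E) \<le> (\<integral>\<^sup>+d. ennreal (sqrt gram_det * \<tau>) * indicator {d \<in> space Q. L d \<in> E} d \<partial>Q)"
    unfolding eq using \<tau>(1) gram_det_pos
    by (intro nn_integral_mono) (auto simp: indicator_def intro!: ennreal_leI mult_left_mono)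
  also have "\<dots> = ennreal (sqrt gram_det * \<tau>) * emeasure Q {d \<in> space Q. L d \<in> E}"
    by (rule nn_integral_cmult_indicator[OF s])
  also have "\<dots> = ennreal \<tau> * emeasure lborel E"
    unfolding e using \<tau>(2) gram_det_pos by (simp add: ennreal_mult mult_ac)
  finally show ?thesis .
qed

lemma vol_lower:
  assumes E: "E \<in> sets borel" "bounded E" and \<tau>: "\<And>y. y \<in> E \<Longrightarrow> \<tau> \<le> truncated_power M y" "\<tau> \<ge> 0"
  shows "ennreal \<tau> * emeasure lborel E \<le> emeasure lborel (vol_set E)"
proof -
  obtain Q :: "(real^'n \<Rightarrow> real) measure" and L where
    eq: "emeasure lborel (vol_set E) = (\<integral>\<^sup>+d. indicator E (L d) * ennreal (sqrt gram_det * truncated_power M (L d)) \<partial>Q)"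
    and s: "{d \<in> space Q. L d \<in> E} \<in> sets Q"
    and e: "emeasure lborel E = ennreal (sqrt gram_det) * emeasure Q {d \<in> space Q. L d \<in> E}"
    and "gram_det > 0"
    by (rule volume_disintegration[OF E])
  have "ennreal \<tau> * emeasure lborel E = ennreal (sqrt gram_det * \<tau>) * emeasure Q {d \<in> space Q. L d \<in> E}"
    unfolding e using \<tau>(2) gram_det_pos by (simp add: ennreal_mult mult_ac)
  also have "\<dots> = (\<integral>\<^sup>+d. ennreal (sqrt gram_det * \<tau>) * indicator {d \<in> space Q. L d \<in> E} d \<partial>Q)"
    by (rule nn_integral_cmult_indicator[OF s, symmetric])
  also have "\<dots> \<le> emeasure lborel (vol_set E)"
    unfolding eq using \<tau>(1) gram_det_pos
    by (intro nn_integral_mono) (auto simp: indicator_def intro!: ennreal_leI mult_left_mono)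
  finally show ?thesis .
qed

lemma truncated_power_nonneg: "0 \<le> truncated_power M x"
proof -
  obtain a where "rmat M *v a = x" using surj_rmat by blast
  from truncated_power_fibre_mass[OF this] show ?thesis using gram_det_pos by simp
qed

end

section \<open>Counting lattice points in cubes\<close>

sublocale chamber \<subseteq> spanning_hull M
  by unfold_locales (rule spanning hull)+

lemma card_residues:
  fixes a r :: int
  assumes N: "N > 0" and r: "0 \<le> r" "r < int N"
  shows "card {k \<in> {a..<a + int N * int m}. k mod int N = r} = m"
proof -
  \<comment> \<open>The first member of the residue class at or above \<open>a\<close>.\<close>
  define b where "b = a + (r - a) mod int N"
  have b: "a \<le> b" "b < a + int N" "b mod int N = r"
    using N r by (auto simp: b_def mod_add_right_eq)
  have "{k \<in> {a..<a + int N * int m}. k mod int N = r} = (\<lambda>j. b + int N * int j) ` {..<m}"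
  proof (rule antisym; rule subsetI)
    fix k assume k: "k \<in> {k \<in> {a..<a + int N * int m}. k mod int N = r}"
    then have "k mod int N = b mod int N" using b by simp
    then obtain j where j: "k = b + int N * j" by (metis mod_eqE mult.commute add.commute diff_eq_eq)
    have kb: "a \<le> k" "k < a + int N * int m" using k by auto
    have "int N * j < int N * int m" using kb b j by linarith
    then have "j < int m" using N by (simp only: mult_less_cancel_left_pos of_nat_0_less_iff)
    moreover have "int N * (-1) < int N * j" using kb b j by linarith
    then have "-1 < j" using N by (simp only: mult_less_cancel_left_pos of_nat_0_less_iff)
    ultimately show "k \<in> (\<lambda>j. b + int N * int j) ` {..<m}"
      by (intro image_eqI[of _ _ "nat j"]) (auto simp: j)
  next
    fix k assume "k \<in> (\<lambda>j. b + int N * int j) ` {..<m}"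
    then obtain j where j: "k = b + int N * int j" "j < m" by auto
    have "int N * int j + int N \<le> int N * int m"
      using mult_left_mono[of "int j + 1" "int m" "int N"] j(2) by (simp add: algebra_simps)
    moreover have "0 \<le> int N * int j" by simp
    ultimately have "a \<le> k" "k < a + int N * int m" using b j by linarith+
    then show "k \<in> {k \<in> {a..<a + int N * int m}. k mod int N = r}" using b j by simp
  qed
  moreover have "inj_on (\<lambda>j. b + int N * int j) {..<m}" using N by (auto simp: inj_on_def)
  ultimately show ?thesis by (simp add: card_image)
qed

text \<open>The side length is a multiple of \<open>N\<close>, so every residue class modulo
  \<open>N\<close> occurs equally often.\<close>

definition ibox :: "nat \<Rightarrow> int^'s \<Rightarrow> nat \<Rightarrow> (int^'s) set" where
  "ibox N a m = {\<alpha>. \<forall>i. \<alpha> $ i \<in> {a $ i..<a $ i + int N * int m}}"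

definition residue :: "nat \<Rightarrow> int^'s \<Rightarrow> int^'s" where
  "residue N \<alpha> = (\<chi> i. \<alpha> $ i mod int N)"

lemma finite_ibox: "finite (ibox N a m)"
  unfolding ibox_def by (rule finite_vec_box) simp

lemma sum_ibox:
  fixes h :: "int^'s \<Rightarrow> real" and a :: "int^'s"
  assumes N: "N > 0"
  shows "(\<Sum>\<alpha>\<in>ibox N a m. h (residue N \<alpha>)) = real m ^ CARD('s) * (\<Sum>r\<in>residues_box N. h r)"
proof -
  have c: "card {\<alpha> \<in> ibox N a m. residue N \<alpha> = r} = m ^ CARD('s)" if r: "r \<in> residues_box N" for r
  proof -
    have "{\<alpha> \<in> ibox N a m. residue N \<alpha> = r} = {\<alpha>. \<forall>i. \<alpha> $ i \<in> {k \<in> {a $ i..<a $ i + int N * int m}. k mod int N = r $ i}}"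
      by (auto simp: ibox_def residue_def vec_eq_iff)
    then have "card {\<alpha> \<in> ibox N a m. residue N \<alpha> = r}
      = (\<Sum>\<alpha>\<in>{\<alpha>. \<forall>i. \<alpha> $ i \<in> {k \<in> {a $ i..<a $ i + int N * int m}. k mod int N = r $ i}}. \<Prod>i\<in>(UNIV::'s set). 1)"
      by simp
    also have "\<dots> = (\<Prod>i\<in>(UNIV::'s set). \<Sum>k\<in>{k \<in> {a $ i..<a $ i + int N * int m}. k mod int N = r $ i}. 1)"
      by (rule sum_vec_prod) (rule finite_subset[OF _ finite_atLeastLessThan_int], blast)
    also have "\<dots> = (\<Prod>i\<in>(UNIV::'s set). m)"
      by (intro prod.cong refl) (use card_residues[OF N] r in \<open>simp add: residues_box_def\<close>)
    finally show ?thesis by simp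
  qed
  have "(\<Sum>\<alpha>\<in>ibox N a m. h (residue N \<alpha>)) = (\<Sum>r\<in>residues_box N. \<Sum>\<alpha>\<in>{\<alpha> \<in> ibox N a m. residue N \<alpha> = r}. h (residue N \<alpha>))"
    by (rule sum.group[symmetric, OF finite_ibox finite_residues_box])
      (use N in \<open>auto simp: residues_box_def residue_def\<close>)
  also have "\<dots> = (\<Sum>r\<in>residues_box N. \<Sum>\<alpha>\<in>{\<alpha> \<in> ibox N a m. residue N \<alpha> = r}. h r)"
    by (intro sum.cong) auto
  also have "\<dots> = (\<Sum>r\<in>residues_box N. real m ^ CARD('s) * h r)"
    by (intro sum.cong refl) (simp add: c)
  finally show ?thesis by (simp add: sum_distrib_left)
qed

lemma sum_discrete_truncated_power_ibox:
  fixes M :: "int^'n^'s"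
  assumes "0 \<notin> convex hull (range (rcol M))"
  shows "finite {\<beta>. lattice_image M \<beta> \<in> ibox N a m}"
    and "(\<Sum>\<alpha>\<in>ibox N a m. discrete_truncated_power M \<alpha>) = card {\<beta>. lattice_image M \<beta> \<in> ibox N a m}"
proof -
  have eq: "{\<beta>. lattice_image M \<beta> \<in> ibox N a m} = (\<Union>\<alpha>\<in>ibox N a m. {\<beta>. lattice_image M \<beta> = \<alpha>})" by auto
  show "finite {\<beta>. lattice_image M \<beta> \<in> ibox N a m}"
    unfolding eq by (intro finite_UN_I finite_ibox finite_fibre[OF assms])
  show "(\<Sum>\<alpha>\<in>ibox N a m. discrete_truncated_power M \<alpha>) = card {\<beta>. lattice_image M \<beta> \<in> ibox N a m}"
    unfolding eq discrete_truncated_power_card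
    by (rule card_UN_disjoint[symmetric]) (auto simp: finite_ibox finite_fibre[OF assms])
qed

text \<open>The cells of side \<open>1 / c\<close> with lower corner \<open>\<beta> / c\<close> tile
  the orthant, one for each \<beta>. The closed ones cover, for upper bounds; the open ones are
  disjoint, for lower bounds.\<close>

definition cell_lo :: "real \<Rightarrow> nat^'n \<Rightarrow> real^'n" where "cell_lo c \<beta> = (\<chi> j. real (\<beta> $ j) / c)"
definition cell_hi :: "real \<Rightarrow> nat^'n \<Rightarrow> real^'n" where "cell_hi c \<beta> = (\<chi> j. (real (\<beta> $ j) + 1) / c)"

lemma emeasure_cube:
  fixes l u :: "real^'n"
  assumes "\<And>j. u $ j - l $ j = d" "d \<ge> 0"
  shows "emeasure lborel (box l u) = ennreal (d ^ CARD('n))" "emeasure lborel (cbox l u) = ennreal (d ^ CARD('n))"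
proof -
  have le: "l \<bullet> b \<le> u \<bullet> b" if b: "b \<in> Basis" for b
  proof -
    from b obtain j where "b = axis j 1" unfolding Basis_vec_def by auto
    then show ?thesis using assms(1)[of j] assms(2) by (simp add: inner_axis)
  qed
  have "(\<Prod>b\<in>Basis. (u - l) \<bullet> b) = d ^ CARD('n)"
    unfolding prod_Basis_vec by (simp add: assms(1))
  then show "emeasure lborel (box l u) = ennreal (d ^ CARD('n))" "emeasure lborel (cbox l u) = ennreal (d ^ CARD('n))"
    using emeasure_lborel_box[OF le] emeasure_lborel_cbox[OF le] by auto
qed

lemma cell_upper:
  fixes A :: "(real^'n) set"
  assumes c: "c > 0" and S: "finite S" and sub: "A \<subseteq> (\<Union>\<beta>\<in>S. cbox (cell_lo c \<beta>) (cell_hi c \<beta>))"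
  shows "emeasure lborel A \<le> ennreal (card S / c ^ CARD('n))"
proof -
  have cell: "emeasure lborel (cbox (cell_lo c \<beta>) (cell_hi c \<beta>)) = ennreal ((1/c) ^ CARD('n))" for \<beta> :: "nat^'n"
    by (rule emeasure_cube) (use c in \<open>auto simp: cell_lo_def cell_hi_def field_simps\<close>)
  have "emeasure lborel A \<le> emeasure lborel (\<Union>\<beta>\<in>S. cbox (cell_lo c \<beta>) (cell_hi c \<beta>))"
    by (rule emeasure_mono[OF sub]) (auto intro: S)
  also have "\<dots> \<le> (\<Sum>\<beta>\<in>S. emeasure lborel (cbox (cell_lo c \<beta>) (cell_hi c \<beta>)))"
    by (rule emeasure_subadditive_finite[OF S]) auto
  also have "\<dots> = ennreal (card S / c ^ CARD('n))"
    unfolding cell using c by (simp add: ennreal_of_nat_eq_real_of_nat ennreal_mult[symmetric] power_one_over divide_inverse power_inverse)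
  finally show ?thesis .
qed

lemma cell_lower:
  fixes A :: "(real^'n) set"
  assumes c: "c > 0" and S: "finite S" and A: "A \<in> sets borel"
    and sub: "\<And>\<beta>. \<beta> \<in> S \<Longrightarrow> box (cell_lo c \<beta>) (cell_hi c \<beta>) \<subseteq> A"
  shows "ennreal (card S / c ^ CARD('n)) \<le> emeasure lborel A"
proof -
  have cell: "emeasure lborel (box (cell_lo c \<beta>) (cell_hi c \<beta>)) = ennreal ((1/c) ^ CARD('n))" for \<beta> :: "nat^'n"
    by (rule emeasure_cube) (use c in \<open>auto simp: cell_lo_def cell_hi_def field_simps\<close>)
  have disj: "disjoint_family_on (\<lambda>\<beta>. box (cell_lo c \<beta>) (cell_hi c \<beta>)) S"
    unfolding disjoint_family_on_def
  proof (intro ballI impI)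
    fix \<beta> \<beta>' :: "nat^'n" assume "\<beta> \<noteq> \<beta>'"
    then obtain j where j: "\<beta> $ j \<noteq> \<beta>' $ j" by (auto simp: vec_eq_iff)
    have False if u: "u \<in> box (cell_lo c \<beta>) (cell_hi c \<beta>)" "u \<in> box (cell_lo c \<beta>') (cell_hi c \<beta>')" for u
    proof -
      have "real (\<beta> $ j) < c * u $ j" "c * u $ j < real (\<beta> $ j) + 1"
        "real (\<beta>' $ j) < c * u $ j" "c * u $ j < real (\<beta>' $ j) + 1"
        using u c by (auto simp: mem_box_cart cell_lo_def cell_hi_def field_simps)
      then show False using j by linarith
    qed
    then show "box (cell_lo c \<beta>) (cell_hi c \<beta>) \<inter> box (cell_lo c \<beta>') (cell_hi c \<beta>') = {}" by blast
  qed
  have "ennreal (card S / c ^ CARD('n)) = (\<Sum>\<beta>\<in>S. emeasure lborel (box (cell_lo c \<beta>) (cell_hi c \<beta>)))"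
    unfolding cell using c by (simp add: ennreal_of_nat_eq_real_of_nat ennreal_mult[symmetric] power_one_over divide_inverse power_inverse)
  also have "\<dots> = emeasure lborel (\<Union>\<beta>\<in>S. box (cell_lo c \<beta>) (cell_hi c \<beta>))"
    by (rule sum_emeasure[OF _ disj S]) auto
  also have "\<dots> \<le> emeasure lborel A"
    by (rule emeasure_mono) (use sub A in auto)
  finally show ?thesis .
qed

text \<open>The sum of the absolute values of the entries bounds \<open>M w\<close> for
  \<open>w\<close> in the unit cube; the additional 1 leaves room for the strict inequalities of
  half-open and open boxes.\<close>

definition entry_bound :: "int^'n^'s \<Rightarrow> nat" where
  "entry_bound M = nat (\<Sum>i\<in>UNIV. \<Sum>j\<in>UNIV. \<bar>M $ i $ j\<bar>) + 1"

lemma entry_bound: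
  assumes "\<And>j. 0 \<le> w $ j \<and> w $ j \<le> 1"
  shows "\<bar>(rmat M *v w) $ i\<bar> \<le> real (entry_bound M) - 1"
proof -
  have "\<bar>(rmat M *v w) $ i\<bar> \<le> (\<Sum>j\<in>UNIV. \<bar>real_of_int (M $ i $ j) * w $ j\<bar>)"
    by (simp add: matrix_vector_mult_def)
  also have "\<dots> \<le> (\<Sum>j\<in>UNIV. \<bar>real_of_int (M $ i $ j)\<bar>)"
    by (intro sum_mono) (use assms in \<open>auto simp: abs_mult intro!: mult_right_le_one_le\<close>)
  also have "\<dots> \<le> (\<Sum>i\<in>UNIV. \<Sum>j\<in>UNIV. \<bar>real_of_int (M $ i $ j)\<bar>)"
    by (rule member_le_sum[where f = "\<lambda>i. \<Sum>j\<in>UNIV. \<bar>real_of_int (M $ i $ j)\<bar>"]) (auto intro: sum_nonneg)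
  also have "\<dots> = real_of_int (\<Sum>i\<in>UNIV. \<Sum>j\<in>UNIV. \<bar>M $ i $ j\<bar>)" by simp
  also have "\<dots> = real (entry_bound M) - 1"
    by (simp add: entry_bound_def sum_nonneg del: of_int_sum)
  finally show ?thesis .
qed

lemma mvec_near:
  assumes "\<And>j. 0 \<le> c * u $ j - real (\<beta> $ j) \<and> c * u $ j - real (\<beta> $ j) \<le> 1"
  shows "\<bar>c * (rmat M *v u) $ i - real_of_int (lattice_image M \<beta> $ i)\<bar> \<le> real (entry_bound M) - 1"
proof -
  have "c * (rmat M *v u) $ i - real_of_int (lattice_image M \<beta> $ i) = (rmat M *v (c *\<^sub>R u - (\<chi> j. real (\<beta> $ j)))) $ i"
    by (simp add: matrix_vector_mult_diff_distrib matrix_vector_mult_scaleR rvec_lattice_image[symmetric])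
  then show ?thesis using entry_bound[of "c *\<^sub>R u - (\<chi> j. real (\<beta> $ j))" M i] assms by simp
qed

definition cube_lo :: "nat \<Rightarrow> int^'s \<Rightarrow> real^'s" where "cube_lo D a = (\<chi> i. real_of_int (a $ i) / D)"
definition cube_hi :: "nat \<Rightarrow> int^'s \<Rightarrow> real^'s" where "cube_hi D a = (\<chi> i. (real_of_int (a $ i) + 1) / D)"

context spanning_hull
begin

text \<open>Rounding \<open>c u\<close> down to \<beta> moves its image by less than
  \<open>entry_bound M\<close>, so the cells of the lattice points over a slightly enlarged box
  cover the region. With \<open>c = N D m\<close> the cube of side \<open>1 / D\<close> scales to an
  integer box of side \<open>N m\<close>, and the margin is also a multiple of \<open>N\<close>, so
  that complete residue systems are counted.\<close>

lemma count_upper: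
  assumes N: "N > 0" and D: "D > 0" and m: "m > 0"
  shows "emeasure lborel (vol_set (cbox (cube_lo D a) (cube_hi D a)))
    \<le> ennreal ((\<Sum>\<alpha>\<in>ibox N (\<chi> i. int N * (int m * a $ i - int (entry_bound M))) (m + 2 * entry_bound M). real (discrete_truncated_power M \<alpha>))
      / (real N * real D * real m) ^ CARD('n))"
proof -
  let ?c = "real N * real D * real m"
  let ?B = "ibox N (\<chi> i. int N * (int m * a $ i - int (entry_bound M))) (m + 2 * entry_bound M)"
  have c: "?c > 0" using N D m by simp
  have "vol_set (cbox (cube_lo D a) (cube_hi D a)) \<subseteq> (\<Union>\<beta>\<in>{\<beta>. lattice_image M \<beta> \<in> ?B}. cbox (cell_lo ?c \<beta>) (cell_hi ?c \<beta>))"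
  proof
    fix u assume u: "u \<in> vol_set (cbox (cube_lo D a) (cube_hi D a))"
    then have nn: "\<And>j. 0 \<le> u $ j" by (simp add: vol_set_def nonneg_def)
    define \<beta> where "\<beta> = (\<chi> j. nat \<lfloor>?c * u $ j\<rfloor>)"
    have bj: "real (\<beta> $ j) \<le> ?c * u $ j" "?c * u $ j < real (\<beta> $ j) + 1" for j
    proof -
      have "0 \<le> ?c * u $ j" using nn c by (intro mult_nonneg_nonneg) auto
      then show "real (\<beta> $ j) \<le> ?c * u $ j" "?c * u $ j < real (\<beta> $ j) + 1" by (auto simp: \<beta>_def)
    qed
    have cellm: "u \<in> cbox (cell_lo ?c \<beta>) (cell_hi ?c \<beta>)"
      unfolding mem_box_cart
    proof
      fix j
      show "cell_lo ?c \<beta> $ j \<le> u $ j \<and> u $ j \<le> cell_hi ?c \<beta> $ j"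
        using bj[of j] c by (simp add: cell_lo_def cell_hi_def pos_divide_le_eq pos_le_divide_eq mult.commute[of "u $ j"])
    qed
    have "lattice_image M \<beta> \<in> ?B"
      unfolding ibox_def
    proof (rule CollectI, rule allI)
      fix i
      have wb: "\<bar>?c * (rmat M *v u) $ i - real_of_int (lattice_image M \<beta> $ i)\<bar> \<le> real (entry_bound M) - 1"
        by (rule mvec_near) (use bj in \<open>simp add: less_imp_le algebra_simps\<close>)
      have "real_of_int (a $ i) / D \<le> (rmat M *v u) $ i" "(rmat M *v u) $ i \<le> (real_of_int (a $ i) + 1) / D"
        using u by (auto simp: vol_set_def mem_box_cart cube_lo_def cube_hi_def)
      then have "real_of_int (a $ i) \<le> real D * (rmat M *v u) $ i" "real D * (rmat M *v u) $ i \<le> real_of_int (a $ i) + 1"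
        using D by (auto simp: field_simps)
      then have "(real N * real m) * real_of_int (a $ i) \<le> (real N * real m) * (real D * (rmat M *v u) $ i)"
        "(real N * real m) * (real D * (rmat M *v u) $ i) \<le> (real N * real m) * (real_of_int (a $ i) + 1)"
        by (auto intro: mult_left_mono)
      then have cu: "real N * real m * real_of_int (a $ i) \<le> ?c * (rmat M *v u) $ i"
        "?c * (rmat M *v u) $ i \<le> real N * real m * real_of_int (a $ i) + real N * real m"
        by (simp_all add: algebra_simps)
      have MN: "real (entry_bound M) \<le> real N * real (entry_bound M)"
        using mult_right_mono[of 1 "real N" "real (entry_bound M)"] N by simp
      have "real_of_int (int N * (int m * a $ i - int (entry_bound M))) \<le> real_of_int (lattice_image M \<beta> $ i)"
        using wb cu(1) MN by (simp add: algebra_simps)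
      moreover have "real_of_int (lattice_image M \<beta> $ i) < real_of_int (int N * (int m * a $ i - int (entry_bound M)) + int N * int (m + 2 * entry_bound M))"
        using wb cu(2) MN by (simp add: algebra_simps)
      ultimately show "lattice_image M \<beta> $ i \<in> {(\<chi> i. int N * (int m * a $ i - int (entry_bound M))) $ i..<
          (\<chi> i. int N * (int m * a $ i - int (entry_bound M))) $ i + int N * int (m + 2 * entry_bound M)}"
        unfolding of_int_le_iff of_int_less_iff by simp
    qed
    then show "u \<in> (\<Union>\<beta>\<in>{\<beta>. lattice_image M \<beta> \<in> ?B}. cbox (cell_lo ?c \<beta>) (cell_hi ?c \<beta>))" using cellm by blast
  qed
  from cell_upper[OF c sum_discrete_truncated_power_ibox(1)[OF hull'] this] show ?thesis
    by (simp only: sum_discrete_truncated_power_ibox(2)[OF hull', symmetric] of_nat_sum)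
qed

text \<open>With the box shrunk by the same margin, the whole open cell of each counted point lies
  in the region. The bound on \<open>m\<close> keeps the shrunken side positive.\<close>

lemma count_lower:
  assumes N: "N > 0" and D: "D > 0" and m: "m > 2 * entry_bound M"
  shows "ennreal ((\<Sum>\<alpha>\<in>ibox N (\<chi> i. int N * (int m * a $ i + int (entry_bound M))) (m - 2 * entry_bound M). real (discrete_truncated_power M \<alpha>))
      / (real N * real D * real m) ^ CARD('n)) \<le> emeasure lborel (vol_set (box (cube_lo D a) (cube_hi D a)))"
proof -
  let ?c = "real N * real D * real m"
  let ?B = "ibox N (\<chi> i. int N * (int m * a $ i + int (entry_bound M))) (m - 2 * entry_bound M)"
  have c: "?c > 0" using N D m by simp
  have sub: "box (cell_lo ?c \<beta>) (cell_hi ?c \<beta>) \<subseteq> vol_set (box (cube_lo D a) (cube_hi D a))"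
    if \<beta>: "\<beta> \<in> {\<beta>. lattice_image M \<beta> \<in> ?B}" for \<beta>
  proof
    fix u assume "u \<in> box (cell_lo ?c \<beta>) (cell_hi ?c \<beta>)"
    then have bj: "real (\<beta> $ j) < ?c * u $ j" "?c * u $ j < real (\<beta> $ j) + 1" for j
      using c by (auto simp: mem_box_cart cell_lo_def cell_hi_def pos_divide_less_eq pos_less_divide_eq mult.commute[of "u $ _"])
    have nn: "0 \<le> u $ j" for j
    proof -
      have "0 < ?c * u $ j" using bj(1)[of j] by (rule le_less_trans[rotated]) simp
      from zero_less_mult_pos[OF this c] show ?thesis by simp
    qed
    have "rmat M *v u \<in> box (cube_lo D a) (cube_hi D a)"
      unfolding mem_box_cart
    proof
      fix i
      have wb: "\<bar>?c * (rmat M *v u) $ i - real_of_int (lattice_image M \<beta> $ i)\<bar> \<le> real (entry_bound M) - 1"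
        by (rule mvec_near) (use bj in \<open>simp add: less_imp_le algebra_simps\<close>)
      have "int N * (int m * a $ i + int (entry_bound M)) \<le> lattice_image M \<beta> $ i"
        "lattice_image M \<beta> $ i < int N * (int m * a $ i + int (entry_bound M)) + int N * int (m - 2 * entry_bound M)"
        using \<beta> by (auto simp: ibox_def)
      then have "real_of_int (int N * (int m * a $ i + int (entry_bound M))) \<le> real_of_int (lattice_image M \<beta> $ i)"
        "real_of_int (lattice_image M \<beta> $ i) < real_of_int (int N * (int m * a $ i + int (entry_bound M)) + int N * int (m - 2 * entry_bound M))"
        by (simp_all only: of_int_le_iff of_int_less_iff)
      then have b: "real N * real m * real_of_int (a $ i) + real N * real (entry_bound M) \<le> real_of_int (lattice_image M \<beta> $ i)"
        "real_of_int (lattice_image M \<beta> $ i) < real N * real m * real_of_int (a $ i) + real N * real m - real N * real (entry_bound M)"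
        using m by (simp_all add: algebra_simps of_nat_diff)
      have MN: "real (entry_bound M) \<le> real N * real (entry_bound M)"
        using mult_right_mono[of 1 "real N" "real (entry_bound M)"] N by simp
      have "real N * real m * real_of_int (a $ i) < ?c * (rmat M *v u) $ i"
        "?c * (rmat M *v u) $ i < real N * real m * real_of_int (a $ i) + real N * real m"
        using wb b MN by linarith+
      then have "(real N * real m) * real_of_int (a $ i) < (real N * real m) * (real D * (rmat M *v u) $ i)"
        "(real N * real m) * (real D * (rmat M *v u) $ i) < (real N * real m) * (real_of_int (a $ i) + 1)"
        by (simp_all add: algebra_simps)
      moreover have "real N * real m > 0" using N m by simp
      ultimately have "real_of_int (a $ i) < real D * (rmat M *v u) $ i" "real D * (rmat M *v u) $ i < real_of_int (a $ i) + 1"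
        by (simp_all only: mult_less_cancel_left_pos)
      then show "cube_lo D a $ i < (rmat M *v u) $ i \<and> (rmat M *v u) $ i < cube_hi D a $ i"
        using D by (simp add: cube_lo_def cube_hi_def field_simps)
    qed
    then show "u \<in> vol_set (box (cube_lo D a) (cube_hi D a))" using nn by (simp add: vol_set_def nonneg_def)
  qed
  have "vol_set (box (cube_lo D a) (cube_hi D a)) \<in> sets borel" by (rule vol_set_borel) simp
  from cell_lower[OF c sum_discrete_truncated_power_ibox(1)[OF hull'] this sub] show ?thesis
    by (simp only: sum_discrete_truncated_power_ibox(2)[OF hull', symmetric] of_nat_sum)
qed

end

section \<open>The leading homogeneous part\<close>

lemma floor_scaled_limit:
  fixes x :: real and N r :: real
  assumes N: "N > 0"
  shows "(\<lambda>m. (r + N * real_of_int \<lfloor>real m * x / N\<rfloor>) / real m) \<longlonglongrightarrow> x"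
proof -
  have "(\<lambda>m. (r + N * real_of_int \<lfloor>real m * x / N\<rfloor>) / real m - x) \<longlonglongrightarrow> 0"
  proof (rule Lim_null_comparison)
    show "(\<lambda>m. (\<bar>r\<bar> + N) / real m) \<longlonglongrightarrow> 0" by (rule lim_const_over_n)
    show "\<forall>\<^sub>F m in sequentially. norm ((r + N * real_of_int \<lfloor>real m * x / N\<rfloor>) / real m - x) \<le> (\<bar>r\<bar> + N) / real m"
      using eventually_gt_at_top[of 0]
    proof eventually_elim
      case (elim m)
      define y where "y = real m * x / N"
      have "(r + N * real_of_int \<lfloor>y\<rfloor>) / real m - x = (r + N * (real_of_int \<lfloor>y\<rfloor> - y)) / real m"
        using elim N by (simp add: y_def field_simps)
      moreover have "\<bar>r + N * (real_of_int \<lfloor>y\<rfloor> - y)\<bar> \<le> \<bar>r\<bar> + N"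
      proof -
        have "\<bar>N * (real_of_int \<lfloor>y\<rfloor> - y)\<bar> \<le> N * 1"
          unfolding abs_mult using N by (intro mult_mono) (auto, linarith)
        then show ?thesis by linarith
      qed
      ultimately show ?case using elim by (simp add: y_def[symmetric] divide_right_mono)
    qed
  qed
  then show ?thesis by (rule LIM_zero_cancel)
qed

lemma card_residues_box: "card (residues_box N :: (int^'s) set) = N ^ CARD('s)"
proof -
  have "card (residues_box N :: (int^'s) set) = (\<Sum>r\<in>{r::int^'s. \<forall>i. r $ i \<in> {0..<int N}}. \<Prod>i\<in>(UNIV::'s set). 1)"
    by (simp add: residues_box_def)
  also have "\<dots> = (\<Prod>i\<in>(UNIV::'s set). \<Sum>k\<in>{0..<int N}. 1)" by (rule sum_vec_prod) simp
  finally show ?thesis by simp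
qed

section \<open>Homogeneous parts class by class\<close>

context chamber
begin

abbreviation T :: "real^'s \<Rightarrow> real" where "T \<equiv> truncated_power M"

definition class_support :: "(nat^'s) set" where "class_support = (\<Union>\<theta>\<in>A_set M. Poly_Mapping.keys (P \<theta>))"

lemma finite_class_support: "finite class_support" unfolding class_support_def by (intro finite_UN_I finite_A_set) simp

definition class_coeff :: "int^'s \<Rightarrow> nat^'s \<Rightarrow> complex" where
  "class_coeff r u = (\<Sum>\<theta>\<in>A_set M. vpowi \<theta> r * Poly_Mapping.lookup (P \<theta>) u)"

lemma class_poly_pfun: "class_poly r = pfun class_support (class_coeff r)"
proof
  fix z
  have "peval (P \<theta>) z = pfun class_support (Poly_Mapping.lookup (P \<theta>)) z" if "\<theta> \<in> A_set M" for \<theta>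
    unfolding peval_pfun by (rule pfun_superset[symmetric, OF finite_class_support]) (use that in \<open>auto simp: class_support_def in_keys_iff\<close>)
  then have "class_poly r z = (\<Sum>\<theta>\<in>A_set M. \<Sum>u\<in>class_support. vpowi \<theta> r * Poly_Mapping.lookup (P \<theta>) u * monom_at z u)"
    by (simp add: class_poly_def pfun_def sum_distrib_left mult.assoc)
  also have "\<dots> = pfun class_support (class_coeff r) z"
    by (subst sum.swap) (simp add: pfun_def class_coeff_def sum_distrib_right)
  finally show "class_poly r z = pfun class_support (class_coeff r) z" .
qed

definition class_part :: "int^'s \<Rightarrow> nat \<Rightarrow> complex^'s \<Rightarrow> complex" where
  "class_part r d = pfun {u \<in> class_support. mabs u = d} (class_coeff r)"

text \<open>A crude bound on the degrees, from which an induction downwards can start.\<close>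

definition class_degree :: nat where "class_degree = (\<Sum>u\<in>class_support. mabs u)"

lemma mabs_le_Dm: "u \<in> class_support \<Longrightarrow> mabs u \<le> class_degree"
  unfolding class_degree_def by (rule member_le_sum) (auto simp: finite_class_support)

lemma class_part_above: "d > class_degree \<Longrightarrow> class_part r d = (\<lambda>_. 0)"
proof -
  assume "d > class_degree"
  then have "{u \<in> class_support. mabs u = d} = {}" using mabs_le_Dm by fastforce
  then show ?thesis unfolding class_part_def pfun_def by (simp only: sum.empty)
qed

lemma class_poly_sum: "K \<ge> class_degree \<Longrightarrow> class_poly r z = (\<Sum>e\<in>{..K}. class_part r e z)"
  unfolding class_poly_pfun class_part_def pfun_def
  by (rule sum.group[symmetric]) (use mabs_le_Dm finite_class_support in fastforce)+

lemma class_part_scale: "class_part r d (cvec (c *\<^sub>R y)) = of_real c ^ d * class_part r d (cvec y)"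
proof -
  have "cvec (c *\<^sub>R y) = (\<chi> i. of_real c * cvec y $ i)" by (simp add: vec_eq_iff)
  then show ?thesis unfolding class_part_def pfun_def by (simp add: monom_at_scale sum_distrib_left mult_ac del: cvec_nth)
qed

text \<open>The projection of \<open>sum_class_poly\<close> holds coefficient by coefficient, hence
  in every degree separately.\<close>

lemma sum_class_part: "(\<Sum>r\<in>residues_box period. class_part r d z) = of_nat period ^ CARD('s) * e_part d z"
proof -
  have c: "(\<Sum>r\<in>residues_box period. class_coeff r u) = of_nat period ^ CARD('s) * e_coeff u" for u
  proof -
    have "(\<Sum>r\<in>residues_box period. class_coeff r u) = (\<Sum>\<theta>\<in>A_set M. (\<Sum>r\<in>residues_box period. vpowi \<theta> r) * Poly_Mapping.lookup (P \<theta>) u)"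
      unfolding class_coeff_def sum_distrib_right by (rule sum.swap)
    also have "\<dots> = (\<Sum>\<theta>\<in>A_set M. if \<theta> = one_vec then of_nat period ^ CARD('s) * e_coeff u else 0)"
      by (intro sum.cong refl, simp only: sum_vpowi) (simp add: e_coeff_def)
    also have "\<dots> = of_nat period ^ CARD('s) * e_coeff u"
      using one_vec_A finite_A_set[of M] by simp
    finally show ?thesis .
  qed
  have "(\<Sum>r\<in>residues_box period. class_part r d z) = (\<Sum>u\<in>{u \<in> class_support. mabs u = d}. (\<Sum>r\<in>residues_box period. class_coeff r u) * monom_at z u)"
    unfolding class_part_def pfun_def sum_distrib_right by (rule sum.swap)
  also have "\<dots> = of_nat period ^ CARD('s) * pfun {u \<in> class_support. mabs u = d} e_coeff z"
    unfolding c pfun_def by (simp add: sum_distrib_left mult.assoc)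
  also have "pfun {u \<in> class_support. mabs u = d} e_coeff z = e_part d z"
    unfolding e_part_def
  proof (rule pfun_superset)
    have "e_support \<subseteq> class_support" using one_vec_A by (auto simp: class_support_def e_support_def)
    then show "{u \<in> e_support. mabs u = d} \<subseteq> {u \<in> class_support. mabs u = d}" by auto
  qed (auto simp: finite_class_support e_support_def e_coeff_def in_keys_iff)
  finally show ?thesis .
qed

lemma continuous_class_part: "continuous_on S (\<lambda>y. class_part r d (cvec y))"
  unfolding class_part_def pfun_def by (intro continuous_intros continuous_monom_at)

text \<open>The limit is joint in the scale \<open>fst p\<close> and the direction
  \<open>snd p\<close>: the lattice points of a whole cube are to be compared with \<open>x\<close>,
  not only those on its ray. Lower degrees decay and higher ones vanish by assumption.\<close>

lemma class_poly_asymp: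
  assumes high: "\<And>e. e > d \<Longrightarrow> class_part r e = (\<lambda>_. 0)"
  shows "((\<lambda>p. class_poly r (cvec (fst p *\<^sub>R snd p)) / of_real (fst p) ^ d) \<longlongrightarrow> class_part r d (cvec x)) (at_top \<times>\<^sub>F nhds x)"
proof -
  let ?F = "at_top \<times>\<^sub>F nhds x :: (real \<times> (real^'s)) filter"
  let ?g = "\<lambda>e p. (of_real (fst p) ^ e / of_real (fst p) ^ d) * class_part r e (cvec (snd p)) :: complex"
  have fst: "filterlim fst at_top ?F" by (rule filterlim_fst)
  have snd: "(snd \<longlongrightarrow> x) ?F" by (rule filterlim_snd)
  have pos: "\<forall>\<^sub>F p in ?F. fst p > 0" using fst by (rule filterlim_at_top_dense[THEN iffD1, rule_format])
  have cont: "((\<lambda>p. class_part r e (cvec (snd p))) \<longlongrightarrow> class_part r e (cvec x)) ?F" for e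
  proof -
    have "isCont (\<lambda>y. class_part r e (cvec y)) x"
      using continuous_class_part[of UNIV] by (simp add: continuous_on_eq_continuous_at)
    then show ?thesis using snd by (rule isCont_tendsto_compose)
  qed
  have g: "(?g e \<longlongrightarrow> (if e = d then class_part r d (cvec x) else 0)) ?F" for e
  proof (cases e d rule: linorder_cases)
    case less
    have "((\<lambda>p. of_real (inverse (fst p)) ^ (d - e) * class_part r e (cvec (snd p))) \<longlongrightarrow> of_real 0 ^ (d - e) * class_part r e (cvec x)) ?F"
      by (intro tendsto_intros cont tendsto_of_real tendsto_inverse_0_at_top fst)
    then have "((\<lambda>p. of_real (inverse (fst p)) ^ (d - e) * class_part r e (cvec (snd p))) \<longlongrightarrow> 0) ?F"
      using less by (simp add: power_0_left)
    moreover have "\<forall>\<^sub>F p in ?F. of_real (inverse (fst p)) ^ (d - e) * class_part r e (cvec (snd p)) = ?g e p"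
      using pos
    proof eventually_elim
      case (elim p)
      have "of_real (fst p) ^ d = (of_real (fst p) ^ e * of_real (fst p) ^ (d - e) :: complex)"
        using less by (simp add: power_add[symmetric])
      then show ?case using elim by (simp add: power_inverse field_simps)
    qed
    ultimately have "(?g e \<longlongrightarrow> 0) ?F" by (rule Lim_transform_eventually)
    then show ?thesis using less by simp
  next
    case equal
    have "\<forall>\<^sub>F p in ?F. class_part r e (cvec (snd p)) = ?g e p"
      using pos by eventually_elim (simp add: equal)
    with cont have "(?g e \<longlongrightarrow> class_part r e (cvec x)) ?F" by (rule Lim_transform_eventually)
    then show ?thesis by (simp only: equal if_True refl)
  next
    case greater
    then show ?thesis by (simp add: high)
  qed
  have "((\<lambda>p. \<Sum>e\<in>{..class_degree + d}. ?g e p) \<longlongrightarrow> (\<Sum>e\<in>{..class_degree + d}. if e = d then class_part r d (cvec x) else 0)) ?F"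
    by (intro tendsto_sum g)
  moreover have "(\<Sum>e\<in>{..class_degree + d}. if e = d then class_part r d (cvec x) else 0) = class_part r d (cvec x)" by simp
  moreover have "(\<lambda>p. \<Sum>e\<in>{..class_degree + d}. ?g e p) = (\<lambda>p. class_poly r (cvec (fst p *\<^sub>R snd p)) / of_real (fst p) ^ d)"
  proof
    fix p :: "real \<times> (real^'s)"
    have "class_poly r (cvec (fst p *\<^sub>R snd p)) = (\<Sum>e\<in>{..class_degree + d}. of_real (fst p) ^ e * class_part r e (cvec (snd p)))"
      by (subst class_poly_sum[of "class_degree + d"]) (simp_all add: class_part_scale)
    then show "(\<Sum>e\<in>{..class_degree + d}. ?g e p) = class_poly r (cvec (fst p *\<^sub>R snd p)) / of_real (fst p) ^ d"
      by (simp add: sum_divide_distrib)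
  qed
  ultimately show ?thesis by simp
qed

lemma class_poly_discrete_truncated_power:
  assumes "rvec \<alpha> \<in> \<Omega>" "\<forall>i. r $ i mod int period = \<alpha> $ i mod int period"
  shows "class_poly r (cvec (rvec \<alpha>)) = of_nat (discrete_truncated_power M \<alpha>)"
proof -
  have "\<forall>i. r $ i mod int char_order = \<alpha> $ i mod int char_order"
  proof
    fix i
    have "r $ i mod int period mod int char_order = \<alpha> $ i mod int period mod int char_order" using assms(2) by simp
    then show "r $ i mod int char_order = \<alpha> $ i mod int char_order" by (simp add: period_def mod_mod_cancel)
  qed
  then have "class_poly r = class_poly \<alpha>" by (rule class_poly_cong)
  then show ?thesis using f_class_poly[of \<alpha>] f_Omega[OF assms(1)] by simp
qed

text \<open>A leading part is the limit of the counts divided by \<open>m ^ d\<close>, taken along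
  lattice points of \<Omega> in the class of \<open>r\<close>.\<close>

lemma class_part_nonneg:
  assumes high: "\<And>e. e > d \<Longrightarrow> class_part r e = (\<lambda>_. 0)" and x: "x \<in> \<Omega>"
  shows "class_part r d (cvec x) \<in> \<real>\<^sub>\<ge>\<^sub>0"
proof -
  \<comment> \<open>Rounds \<open>m x\<close> to a point of the residue class of \<open>r\<close>;
    the error stays bounded, so \<open>y m\<close> tends to \<open>x\<close>.\<close>
  define \<alpha> where "\<alpha> m = (\<chi> i. r $ i + int period * \<lfloor>real m * x $ i / real period\<rfloor>)" for m
  define y where "y m = (1 / real m) *\<^sub>R rvec (\<alpha> m)" for m
  have yx: "y \<longlonglongrightarrow> x"
  proof (rule vec_tendstoI)
    fix i
    have "(\<lambda>m. (real_of_int (r $ i) + real period * real_of_int \<lfloor>real m * x $ i / real period\<rfloor>) / real m) \<longlonglongrightarrow> x $ i"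
      by (rule floor_scaled_limit) (use period_pos in simp)
    then show "(\<lambda>m. y m $ i) \<longlonglongrightarrow> x $ i" by (simp add: y_def \<alpha>_def)
  qed
  have "filterlim (\<lambda>m. (real m, y m)) (at_top \<times>\<^sub>F nhds x) sequentially"
    by (rule filterlim_Pair[OF filterlim_real_sequentially yx])
  from filterlim_compose[OF class_poly_asymp[OF high] this]
  have lim: "(\<lambda>m. class_poly r (cvec (real m *\<^sub>R y m)) / of_real (real m) ^ d) \<longlonglongrightarrow> class_part r d (cvec x)" by simp
  have "\<forall>\<^sub>F m in sequentially. y m \<in> \<Omega>"
    using yx fundamental_cone_open[OF Omega] x by (rule topological_tendstoD)
  then have "\<forall>\<^sub>F m in sequentially. class_poly r (cvec (real m *\<^sub>R y m)) / of_real (real m) ^ d \<in> \<real>\<^sub>\<ge>\<^sub>0"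
    using eventually_gt_at_top[of 0]
  proof eventually_elim
    case (elim m)
    have e: "real m *\<^sub>R y m = rvec (\<alpha> m)" using elim by (simp add: y_def)
    have "rvec (\<alpha> m) \<in> \<Omega>" using fundamental_cone_scale[OF Omega elim(1), of "real m"] elim(2) by (simp add: e)
    then have "class_poly r (cvec (rvec (\<alpha> m))) = of_nat (discrete_truncated_power M (\<alpha> m))"
      by (rule class_poly_discrete_truncated_power) (simp add: \<alpha>_def)
    then have "class_poly r (cvec (real m *\<^sub>R y m)) / of_real (real m) ^ d = of_real (real (discrete_truncated_power M (\<alpha> m)) / real m ^ d)"
      by (simp add: e)
    then show ?case by (metis nonneg_Reals_of_real_iff of_nat_0_le_iff zero_le_divide_iff zero_le_power)
  qed
  from Lim_in_closed_set[OF closed_nonneg_Reals_complex this _ lim] show ?thesis by simp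
qed

text \<open>If all higher parts vanish, the parts of degree \<open>e\<close> are leading and so
  nonnegative on \<Omega>. Their sum over the classes is a multiple of the part of degree
  \<open>e\<close> of the trivial component, which is zero; so each of them vanishes on \<Omega> and
  hence identically. The induction descends in \<open>e\<close>.\<close>

lemma class_part_degree:
  assumes "e > CARD('n) - CARD('s)" "r \<in> residues_box period"
  shows "class_part r e = (\<lambda>_. 0)"
  using assms
proof (induction "class_degree - e" arbitrary: e r rule: less_induct)
  case less
  show ?case
  proof (cases "e > class_degree")
    case True
    then show ?thesis by (rule class_part_above)
  next
    case False
    have high: "class_part r' e' = (\<lambda>_. 0)" if "e' > e" "r' \<in> residues_box period" for e' r'
    proof (cases "e' > class_degree")
      case True
      then show ?thesis by (rule class_part_above)
    next
      case False
      then show ?thesis using less that by (intro less(1)) auto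
    qed
    have zero: "class_part r' e (cvec x) = 0" if x: "x \<in> \<Omega>" and r': "r' \<in> residues_box period" for x r'
    proof -
      have nn: "class_part r'' e (cvec x) \<in> \<real>\<^sub>\<ge>\<^sub>0" if "r'' \<in> residues_box period" for r''
        by (rule class_part_nonneg[OF high x]) (use that in auto)
      have "(\<Sum>r\<in>residues_box period. class_part r e (cvec x)) = 0"
        using e_part_degree[OF less(2)] by (simp add: sum_class_part)
      then have "(\<Sum>r\<in>residues_box period. Re (class_part r e (cvec x))) = 0"
        by (metis Re_sum zero_complex.simps(1))
      then have "Re (class_part r' e (cvec x)) = 0"
        using nn r' by (subst (asm) sum_nonneg_eq_0_iff) (auto simp: finite_residues_box complex_nonneg_Reals_iff)
      then show ?thesis using nn[OF r'] by (simp add: complex_nonneg_Reals_iff complex_eq_iff)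
    qed
    have "class_part r e z = 0" for z
    proof (rule polyfun_cone_zero[of \<Omega> 1 "class_part r e" 0])
      show "open \<Omega>" "\<Omega> \<noteq> {}" "\<And>x c. x \<in> \<Omega> \<Longrightarrow> c > 0 \<Longrightarrow> c *\<^sub>R x \<in> \<Omega>"
        using fundamental_cone_open[OF Omega] fundamental_cone_nonempty[OF Omega] fundamental_cone_scale[OF Omega] by auto
      show "polyfun (class_part r e)" unfolding class_part_def by (rule polyfun_pfun) (simp add: finite_class_support)
      show "class_part r e (cvec (rvec \<alpha>)) = 0" if "rvec \<alpha> \<in> \<Omega>" for \<alpha> using zero[OF that less(3)] .
    qed simp
    then show ?thesis by auto
  qed
qed

definition top_deg :: nat where "top_deg = CARD('n) - CARD('s)"

definition class_lead :: "real^'s \<Rightarrow> int^'s \<Rightarrow> real" where "class_lead x r = Re (class_part r top_deg (cvec x))"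
definition lead :: "real^'s \<Rightarrow> real" where "lead x = Re (e_part top_deg (cvec x))"

lemma class_part_top_nonneg: "x \<in> \<Omega> \<Longrightarrow> r \<in> residues_box period \<Longrightarrow> class_part r top_deg (cvec x) \<in> \<real>\<^sub>\<ge>\<^sub>0"
  by (rule class_part_nonneg) (use class_part_degree in \<open>auto simp: top_deg_def\<close>)

lemma class_part_lead: "x \<in> \<Omega> \<Longrightarrow> r \<in> residues_box period \<Longrightarrow> class_part r top_deg (cvec x) = of_real (class_lead x r)"
  using class_part_top_nonneg[of x r] by (simp add: complex_nonneg_Reals_iff complex_eq_iff class_lead_def)

lemma sum_class_lead: "(\<Sum>r\<in>residues_box period. class_lead x r) = real period ^ CARD('s) * lead x"
proof -
  have "(\<Sum>r\<in>residues_box period. class_lead x r) = Re (of_nat period ^ CARD('s) * e_part top_deg (cvec x))"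
    unfolding class_lead_def sum_class_part[symmetric] by simp
  also have "of_nat period ^ CARD('s) * e_part top_deg (cvec x) = of_real (real period ^ CARD('s)) * e_part top_deg (cvec x)" by simp
  finally show ?thesis unfolding lead_def by (simp only: Re_complex_of_real times_complex.simps Im_complex_of_real)
qed

lemma e_part_lead:
  assumes "x \<in> \<Omega>" shows "e_part top_deg (cvec x) = of_real (lead x)" "lead x \<ge> 0"
proof -
  have "of_nat period ^ CARD('s) * e_part top_deg (cvec x) = of_real (\<Sum>r\<in>residues_box period. class_lead x r)"
    unfolding sum_class_part[symmetric] of_real_sum by (rule sum.cong[OF refl class_part_lead[OF assms]])
  also have "\<dots> = of_nat period ^ CARD('s) * of_real (lead x)" unfolding sum_class_lead by simp
  finally show "e_part top_deg (cvec x) = of_real (lead x)" using period_pos by simp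
  have "0 \<le> (\<Sum>r\<in>residues_box period. class_lead x r)"
    by (rule sum_nonneg) (use class_part_top_nonneg[OF assms] in \<open>auto simp: class_lead_def complex_nonneg_Reals_iff\<close>)
  moreover have "real period ^ CARD('s) > 0" using period_pos by simp
  ultimately show "lead x \<ge> 0" unfolding sum_class_lead zero_le_mult_iff by linarith
qed

text \<open>The joint limit holds uniformly over the finitely many classes; the neighbourhood of
  \<open>x\<close> is shrunk into \<Omega>, where the polynomial values are counts.\<close>

lemma local_estimate:
  assumes x: "x \<in> \<Omega>" and \<epsilon>: "\<epsilon> > 0"
  shows "\<exists>c0 > 0. \<exists>\<eta> > 0. \<forall>\<alpha> c. c \<ge> c0 \<longrightarrow> dist x ((1/c) *\<^sub>R rvec \<alpha>) < \<eta> \<longrightarrow>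
      \<bar>real (discrete_truncated_power M \<alpha>) / c ^ top_deg - class_lead x (residue period \<alpha>)\<bar> < \<epsilon>"
proof -
  have "\<forall>\<^sub>F p in at_top \<times>\<^sub>F nhds x. \<forall>r\<in>residues_box period.
      dist (class_poly r (cvec (fst p *\<^sub>R snd p)) / of_real (fst p) ^ top_deg) (class_part r top_deg (cvec x)) < \<epsilon>"
  proof (rule eventually_ball_finite[OF finite_residues_box], rule ballI)
    fix r :: "int^'s" assume r: "r \<in> residues_box period"
    show "\<forall>\<^sub>F p in at_top \<times>\<^sub>F nhds x.
      dist (class_poly r (cvec (fst p *\<^sub>R snd p)) / of_real (fst p) ^ top_deg) (class_part r top_deg (cvec x)) < \<epsilon>"
      by (rule tendstoD[OF class_poly_asymp \<epsilon>]) (use class_part_degree r in \<open>auto simp: top_deg_def\<close>)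
  qed
  then obtain Pf Pg where PP: "eventually Pf at_top" "eventually Pg (nhds x)"
    and est: "\<And>c y r. Pf c \<Longrightarrow> Pg y \<Longrightarrow> r \<in> residues_box period \<Longrightarrow>
      dist (class_poly r (cvec (c *\<^sub>R y)) / of_real c ^ top_deg) (class_part r top_deg (cvec x)) < \<epsilon>"
    unfolding eventually_prod_filter by auto
  obtain c0 where c0: "\<And>c. c \<ge> c0 \<Longrightarrow> Pf c" using PP(1) by (auto simp: eventually_at_top_linorder)
  have "eventually (\<lambda>y. Pg y \<and> y \<in> \<Omega>) (nhds x)"
    using PP(2) eventually_nhds_in_open[OF fundamental_cone_open[OF Omega] x] by (rule eventually_conj)
  then obtain \<eta> where \<eta>: "\<eta> > 0" "\<And>y. dist y x < \<eta> \<Longrightarrow> Pg y \<and> y \<in> \<Omega>"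
    by (auto simp: eventually_nhds_metric)
  show ?thesis
  proof (intro exI conjI allI impI)
    show "max c0 1 > 0" "\<eta> > 0" using \<eta> by auto
    fix \<alpha> c assume c: "c \<ge> max c0 1" and d: "dist x ((1/c) *\<^sub>R rvec \<alpha>) < \<eta>"
    let ?y = "(1/c) *\<^sub>R rvec \<alpha>" and ?r = "residue period \<alpha>"
    have y: "Pg ?y" "?y \<in> \<Omega>" using \<eta>(2)[of ?y] d by (auto simp: dist_commute)
    have cy: "c *\<^sub>R ?y = rvec \<alpha>" using c by simp
    have \<alpha>: "rvec \<alpha> \<in> \<Omega>" using fundamental_cone_scale[OF Omega y(2), of c] c by (simp only: cy)
    have r: "?r \<in> residues_box period" using period_pos by (simp add: residue_def residues_box_def)
    have "class_poly ?r (cvec (rvec \<alpha>)) = of_nat (discrete_truncated_power M \<alpha>)"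
      by (rule class_poly_discrete_truncated_power[OF \<alpha>]) (simp add: residue_def)
    then have "class_poly ?r (cvec (c *\<^sub>R ?y)) / of_real c ^ top_deg = of_real (real (discrete_truncated_power M \<alpha>) / c ^ top_deg)"
      unfolding cy by simp
    moreover have "dist (class_poly ?r (cvec (c *\<^sub>R ?y)) / of_real c ^ top_deg) (class_part ?r top_deg (cvec x)) < \<epsilon>"
      by (rule est[OF c0 y(1) r]) (use c in simp)
    ultimately have "dist (of_real (real (discrete_truncated_power M \<alpha>) / c ^ top_deg) :: complex) (of_real (class_lead x ?r)) < \<epsilon>"
      by (simp only: class_part_lead[OF x r])
    then show "\<bar>real (discrete_truncated_power M \<alpha>) / c ^ top_deg - class_lead x ?r\<bar> < \<epsilon>"
      by (simp only: dist_of_real dist_real_def)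
  qed
qed

section \<open>Volume against lattice count\<close>

lemma card_split: "CARD('n) = top_deg + CARD('s)"
  using card_le by (simp add: top_deg_def)

text \<open>Over complete residue systems the values of the classes average to
  \<open>lead x\<close>. The error \<epsilon> is carried along and has a negative sign in the lower
  estimate.\<close>

lemma sum_residue:
  "(\<Sum>\<alpha>\<in>ibox period b m. class_lead x (residue period \<alpha>) + \<epsilon>) = (real m * real period) ^ CARD('s) * (lead x + \<epsilon>)"
  by (subst sum_ibox[OF period_pos])
    (simp add: sum.distrib sum_class_lead card_residues_box power_mult_distrib algebra_simps)

text \<open>In units of the period, the box reaches at most \<open>m\<close> below the corner
  \<open>m a\<close> and \<open>2 m\<close> above it. Divided by the scale this is at most
  \<open>2 / D\<close> in each coordinate, hence the term with \<open>CARD('s)\<close>.\<close>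

lemma ibox_near:
  fixes x :: "real^'s"
  assumes D: "D > 0" and m: "m > 0" and x: "dist x (cube_lo D a) + 2 * real CARD('s) / D < \<eta>"
    and b: "\<And>i. real period * (real m * a $ i - real m) \<le> b $ i"
      "\<And>i. b $ i + real period * real l \<le> real period * (real m * a $ i + 2 * real m)"
    and \<alpha>: "\<alpha> \<in> ibox period b l"
  shows "dist x ((1 / (real period * real D * real m)) *\<^sub>R rvec \<alpha>) < \<eta>"
proof -
  let ?c = "real period * real D * real m"
  have c: "?c > 0" using D m period_pos by simp
  have "\<bar>((1/?c) *\<^sub>R rvec \<alpha> - cube_lo D a) $ i\<bar> \<le> 2 / D" for i
  proof -
    have "b $ i \<le> \<alpha> $ i" "\<alpha> $ i < b $ i + int period * int l" using \<alpha> by (auto simp: ibox_def)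
    then have "real_of_int (b $ i) \<le> real_of_int (\<alpha> $ i)" "real_of_int (\<alpha> $ i) < real_of_int (b $ i + int period * int l)"
      by (simp_all only: of_int_le_iff of_int_less_iff)
    then have le: "real period * (real m * a $ i - real m) \<le> \<alpha> $ i"
      "\<alpha> $ i \<le> real period * (real m * a $ i + 2 * real m)"
      using b[of i] by auto
    have "((1/?c) *\<^sub>R rvec \<alpha> - cube_lo D a) $ i = (\<alpha> $ i - real period * real m * a $ i) / ?c"
      using D m period_pos by (simp add: cube_lo_def field_simps)
    also have "\<bar>\<dots>\<bar> = \<bar>\<alpha> $ i - real period * real m * a $ i\<bar> / ?c" using c by (simp add: abs_divide)
    also have "\<dots> \<le> (2 * (real period * real m)) / ?c"
    proof (rule divide_right_mono)
      have "0 < real period * real m" using m period_pos by simp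
      then show "\<bar>\<alpha> $ i - real period * real m * a $ i\<bar> \<le> 2 * (real period * real m)"
        using le by (simp add: algebra_simps abs_le_iff)
    qed (use c in simp)
    also have "\<dots> = 2 / D" using D m period_pos by simp
    finally show ?thesis .
  qed
  note comp = this
  have "norm ((1/?c) *\<^sub>R rvec \<alpha> - cube_lo D a) \<le> (\<Sum>i\<in>(UNIV::'s set). 2 / D)"
    using order.trans[OF norm_le_l1_cart sum_bounded_above[of UNIV, OF comp]] by simp
  then have "dist (cube_lo D a) ((1/?c) *\<^sub>R rvec \<alpha>) \<le> 2 * real CARD('s) / D"
    by (simp add: dist_norm norm_minus_commute mult.commute)
  then show ?thesis using x dist_triangle[of x "(1/?c) *\<^sub>R rvec \<alpha>" "cube_lo D a"] by simp
qed

lemma emeasure_cubes: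
  assumes "D > 0"
  shows "emeasure lborel (box (cube_lo D a) (cube_hi D a) :: (real^'s) set) = ennreal ((1 / real D) ^ CARD('s))"
    "emeasure lborel (cbox (cube_lo D a) (cube_hi D a) :: (real^'s) set) = ennreal ((1 / real D) ^ CARD('s))"
  by (rule emeasure_cube; use assms in \<open>simp add: cube_lo_def cube_hi_def field_simps\<close>)+

lemma eventual_le:
  fixes t A :: real
  assumes "\<And>m. m > m0 \<Longrightarrow> t \<le> (1 + K / real m) ^ s * A"
  shows "t \<le> A"
proof -
  have "(\<lambda>m. (1 + K / real m) ^ s * A) \<longlonglongrightarrow> (1 + 0) ^ s * A"
    by (intro tendsto_intros lim_const_over_n)
  then have "(\<lambda>m. (1 + K / real m) ^ s * A) \<longlonglongrightarrow> A" by simp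
  then show ?thesis
    by (rule LIMSEQ_le_const) (use assms in \<open>auto intro!: exI[of _ "Suc m0"]\<close>)
qed

lemma eventual_ge:
  fixes t A :: real
  assumes "\<And>m. m > m0 \<Longrightarrow> (1 + K / real m) ^ s * A \<le> t"
  shows "A \<le> t"
  using eventual_le[of m0 "-t" K s "-A"] assms by simp

text \<open>Of the \<open>n\<close>-th power of the scale, \<open>top_deg\<close> factors cancel the
  growth of the counts and the other \<open>s\<close> the number of lattice points; the volume of
  the cube and the ratio of the box sizes remain.\<close>

lemma power_quotient:
  fixes c :: real
  assumes D: "D > 0" and m: "m > 0"
  shows "(real period * real D * real m) ^ top_deg * ((l * real period) ^ CARD('s) * A) / (real period * real D * real m) ^ CARD('n)
    = (l / real m) ^ CARD('s) * A * (1 / real D) ^ CARD('s)"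
proof -
  have p: "real period > 0" using period_pos by simp
  have "(real period * real D * real m) ^ CARD('n) = (real period * real D * real m) ^ top_deg * (real period * real D * real m) ^ CARD('s)"
    by (simp only: card_split power_add)
  then show ?thesis using p D m by (simp add: power_mult_distrib power_divide field_simps)
qed

lemma scale_ge:
  assumes D: "D > 0" and m: "m > nat \<lceil>c0\<rceil>"
  shows "real period * real D * real m \<ge> c0"
proof -
  have "1 \<le> real period * real D"
    using D period_pos by (metis One_nat_def Suc_leI nat_0_less_mult_iff of_nat_1 of_nat_le_iff of_nat_mult)
  then have "real m \<le> real period * real D * real m"
    using mult_right_mono[of 1 "real period * real D" "real m"] by simp
  moreover have "c0 \<le> real m" using m by linarith
  ultimately show ?thesis by simp
qed

text \<open>The volume over a cube on which \<open>T\<close> is at least \<open>T x\<close> exceeds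
  \<open>T x\<close> times the volume of the cube, and is at most a count over an enlarged box,
  where each value is close to that of its class. As \<open>m\<close> grows, the relative margin
  disappears.\<close>

lemma T_le_lead:
  assumes x: "x \<in> \<Omega>" and \<epsilon>: "\<epsilon> > 0"
    and est: "\<And>\<alpha> c. c \<ge> c0 \<Longrightarrow> dist x ((1/c) *\<^sub>R rvec \<alpha>) < \<eta> \<Longrightarrow>
      \<bar>real (discrete_truncated_power M \<alpha>) / c ^ top_deg - class_lead x (residue period \<alpha>)\<bar> < \<epsilon>"
    and D: "D > 0" and near: "dist x (cube_lo D a) + 2 * real CARD('s) / D < \<eta>"
    and mono: "\<And>y. y \<in> cbox (cube_lo D a) (cube_hi D a) \<Longrightarrow> T x \<le> T y"
  shows "T x \<le> lead x + \<epsilon>"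
proof (rule eventual_le[where K = "2 * real (entry_bound M)" and s = "CARD('s)"])
  fix m assume m: "m > max (entry_bound M) (nat \<lceil>c0\<rceil>)"
  let ?c = "real period * real D * real m"
  let ?b = "\<chi> i. int period * (int m * a $ i - int (entry_bound M))"
  let ?l = "m + 2 * entry_bound M"
  have mpos: "m > 0" using m by simp
  have c0: "?c \<ge> c0" by (rule scale_ge[OF D]) (use m in simp)
  have c: "?c > 0" using D mpos period_pos by simp
  have E: "(cbox (cube_lo D a) (cube_hi D a) :: (real^'s) set) \<in> sets borel" "bounded (cbox (cube_lo D a) (cube_hi D a) :: (real^'s) set)" by auto
  have t: "real (discrete_truncated_power M \<alpha>) \<le> ?c ^ top_deg * (class_lead x (residue period \<alpha>) + \<epsilon>)" if \<alpha>: "\<alpha> \<in> ibox period ?b ?l" for \<alpha>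
  proof -
    have Mm: "real (entry_bound M) \<le> real m" using m by simp
    have "dist x ((1/?c) *\<^sub>R rvec \<alpha>) < \<eta>"
    proof (rule ibox_near[OF D mpos near _ _ \<alpha>])
      fix i
      have "real period * (real m * a $ i - real m) \<le> real period * (real m * a $ i - real (entry_bound M))"
        using Mm by (intro mult_left_mono) auto
      then show "real period * (real m * a $ i - real m) \<le> ?b $ i" by simp
      have "real period * (real m * a $ i - real (entry_bound M) + (real m + 2 * real (entry_bound M))) \<le> real period * (real m * a $ i + 2 * real m)"
        using Mm by (intro mult_left_mono) auto
      then show "?b $ i + real period * real ?l \<le> real period * (real m * a $ i + 2 * real m)" by (simp add: algebra_simps)
    qed
    from est[OF c0 this] have "real (discrete_truncated_power M \<alpha>) / ?c ^ top_deg \<le> class_lead x (residue period \<alpha>) + \<epsilon>" by linarith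
    then show ?thesis using c by (simp add: pos_divide_le_eq mult.commute)
  qed
  have "ennreal (T x * (1 / real D) ^ CARD('s)) = ennreal (T x) * emeasure lborel (cbox (cube_lo D a) (cube_hi D a) :: (real^'s) set)"
    by (simp add: emeasure_cubes[OF D] ennreal_mult truncated_power_nonneg)
  also have "\<dots> \<le> emeasure lborel (vol_set (cbox (cube_lo D a) (cube_hi D a)))"
    by (rule vol_lower[OF E mono truncated_power_nonneg])
  also have "\<dots> \<le> ennreal ((\<Sum>\<alpha>\<in>ibox period ?b ?l. real (discrete_truncated_power M \<alpha>)) / ?c ^ CARD('n))"
    by (rule count_upper[OF period_pos D mpos])
  also have "\<dots> \<le> ennreal ((\<Sum>\<alpha>\<in>ibox period ?b ?l. ?c ^ top_deg * (class_lead x (residue period \<alpha>) + \<epsilon>)) / ?c ^ CARD('n))"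
    by (intro ennreal_leI divide_right_mono sum_mono t) (use c in auto)
  also have "(\<Sum>\<alpha>\<in>ibox period ?b ?l. ?c ^ top_deg * (class_lead x (residue period \<alpha>) + \<epsilon>)) / ?c ^ CARD('n)
    = (real ?l / real m) ^ CARD('s) * (lead x + \<epsilon>) * (1 / real D) ^ CARD('s)"
    by (simp only: sum_distrib_left[symmetric] sum_residue power_quotient[OF D mpos])
  finally have "T x * (1 / real D) ^ CARD('s) \<le> (real ?l / real m) ^ CARD('s) * (lead x + \<epsilon>) * (1 / real D) ^ CARD('s)"
    using e_part_lead(2)[OF x] \<epsilon> by (subst (asm) ennreal_le_iff) (auto intro!: mult_nonneg_nonneg)
  moreover have "(1 / real D) ^ CARD('s) > 0" using D by simp
  ultimately have "T x \<le> (real ?l / real m) ^ CARD('s) * (lead x + \<epsilon>)" by (simp only: mult_le_cancel_right_pos)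
  moreover have "real ?l / real m = 1 + 2 * real (entry_bound M) / real m" using mpos by (simp add: field_simps)
  ultimately show "T x \<le> (1 + 2 * real (entry_bound M) / real m) ^ CARD('s) * (lead x + \<epsilon>)" by simp
qed

lemma lead_le_T:
  assumes x: "x \<in> \<Omega>" and \<epsilon>: "\<epsilon> > 0"
    and est: "\<And>\<alpha> c. c \<ge> c0 \<Longrightarrow> dist x ((1/c) *\<^sub>R rvec \<alpha>) < \<eta> \<Longrightarrow>
      \<bar>real (discrete_truncated_power M \<alpha>) / c ^ top_deg - class_lead x (residue period \<alpha>)\<bar> < \<epsilon>"
    and D: "D > 0" and near: "dist x (cube_lo D a) + 2 * real CARD('s) / D < \<eta>"
    and mono: "\<And>y. y \<in> box (cube_lo D a) (cube_hi D a) \<Longrightarrow> T y \<le> T x"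
  shows "lead x - \<epsilon> \<le> T x"
proof (rule eventual_ge[where K = "- 2 * real (entry_bound M)" and s = "CARD('s)"])
  fix m assume m: "m > max (2 * entry_bound M) (nat \<lceil>c0\<rceil>)"
  let ?c = "real period * real D * real m"
  let ?b = "\<chi> i. int period * (int m * a $ i + int (entry_bound M))"
  let ?l = "m - 2 * entry_bound M"
  have mpos: "m > 0" using m by simp
  have c0: "?c \<ge> c0" by (rule scale_ge[OF D]) (use m in simp)
  have c: "?c > 0" using D mpos period_pos by simp
  have E: "(box (cube_lo D a) (cube_hi D a) :: (real^'s) set) \<in> sets borel" "bounded (box (cube_lo D a) (cube_hi D a) :: (real^'s) set)" by auto
  have lr: "real ?l = real m - 2 * real (entry_bound M)" using m by (simp add: of_nat_diff)
  have t: "?c ^ top_deg * (class_lead x (residue period \<alpha>) + (- \<epsilon>)) \<le> real (discrete_truncated_power M \<alpha>)" if \<alpha>: "\<alpha> \<in> ibox period ?b ?l" for \<alpha>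
  proof -
    have "dist x ((1/?c) *\<^sub>R rvec \<alpha>) < \<eta>"
    proof (rule ibox_near[OF D mpos near _ _ \<alpha>])
      fix i
      have "real period * (real m * a $ i - real m) \<le> real period * (real m * a $ i + real (entry_bound M))"
        by (intro mult_left_mono) auto
      then show "real period * (real m * a $ i - real m) \<le> ?b $ i" by simp
      have "real period * (real m * a $ i + real (entry_bound M) + (real m - 2 * real (entry_bound M))) \<le> real period * (real m * a $ i + 2 * real m)"
        by (intro mult_left_mono) auto
      then show "?b $ i + real period * real ?l \<le> real period * (real m * a $ i + 2 * real m)"
        unfolding lr by (simp add: algebra_simps)
    qed
    from est[OF c0 this] have "class_lead x (residue period \<alpha>) + (- \<epsilon>) \<le> real (discrete_truncated_power M \<alpha>) / ?c ^ top_deg" by linarith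
    then show ?thesis using c by (simp add: pos_le_divide_eq mult.commute)
  qed
  \<comment> \<open>\<open>lead x - \<epsilon>\<close> may be negative, so this comparison is
    between reals; only the nonnegative count passes through \<open>ennreal\<close>.\<close>
  have "(?c ^ top_deg * ((real ?l * real period) ^ CARD('s) * (lead x + (- \<epsilon>)))) / ?c ^ CARD('n)
    \<le> (\<Sum>\<alpha>\<in>ibox period ?b ?l. real (discrete_truncated_power M \<alpha>)) / ?c ^ CARD('n)"
    unfolding sum_residue[where b = ?b and m = ?l and x = x and \<epsilon> = "- \<epsilon>", symmetric] sum_distrib_left
    by (intro divide_right_mono sum_mono t) (use c in auto)
  also have "\<dots> \<le> T x * (1 / real D) ^ CARD('s)"
  proof -
    have "ennreal ((\<Sum>\<alpha>\<in>ibox period ?b ?l. real (discrete_truncated_power M \<alpha>)) / ?c ^ CARD('n))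
      \<le> emeasure lborel (vol_set (box (cube_lo D a) (cube_hi D a)))"
      by (rule count_lower[OF period_pos D]) (use m in simp)
    also have "\<dots> \<le> ennreal (T x) * emeasure lborel (box (cube_lo D a) (cube_hi D a) :: (real^'s) set)"
      by (rule vol_upper[OF E mono truncated_power_nonneg])
    also have "\<dots> = ennreal (T x * (1 / real D) ^ CARD('s))"
      by (simp add: emeasure_cubes[OF D] ennreal_mult truncated_power_nonneg)
    finally show ?thesis by (subst (asm) ennreal_le_iff) (auto intro!: mult_nonneg_nonneg truncated_power_nonneg)
  qed
  finally have "(real ?l / real m) ^ CARD('s) * (lead x + (- \<epsilon>)) * (1 / real D) ^ CARD('s) \<le> T x * (1 / real D) ^ CARD('s)"
    by (simp only: power_quotient[OF D mpos])
  moreover have "(1 / real D) ^ CARD('s) > 0" using D by simp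
  ultimately have "(real ?l / real m) ^ CARD('s) * (lead x + (- \<epsilon>)) \<le> T x" by (simp only: mult_le_cancel_right_pos)
  moreover have "real ?l / real m = 1 + - 2 * real (entry_bound M) / real m" unfolding lr using mpos by (simp add: field_simps)
  ultimately show "(1 + - 2 * real (entry_bound M) / real m) ^ CARD('s) * (lead x - \<epsilon>) \<le> T x" by simp
qed

section \<open>Squeezing by monotonicity\<close>

lemma T_mono: "y - x \<in> subcone M UNIV \<Longrightarrow> T x \<le> T y"
proof -
  assume "y - x \<in> subcone M UNIV"
  then obtain u where u: "y - x = rmat M *v u" "\<forall>j. 0 \<le> u $ j" by (auto simp: subcone_UNIV)
  then have "T x \<le> T (x + rmat M *v u)" using gram_det_pos by (intro truncated_power_mono) (auto simp: nonneg_def)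
  then show ?thesis by (simp add: u(1)[symmetric])
qed

lemma small_cube:
  fixes z :: "real^'s"
  assumes "\<delta> > 0"
  obtains D a where "D > 0" "2 * real CARD('s) / real D < \<delta>" "dist z (cube_lo D a) < \<delta>"
    "\<forall>y\<in>cbox (cube_lo D a) (cube_hi D a). dist z y < \<delta>"
proof -
  obtain D :: nat where D: "2 * real CARD('s) / \<delta> < real D" using reals_Archimedean2 by blast
  moreover have "0 < 2 * real CARD('s) / \<delta>" using assms by simp
  ultimately have Dpos: "real D > 0" by linarith
  have small: "2 * real CARD('s) / real D < \<delta>" using D Dpos assms by (simp add: field_simps)
  \<comment> \<open>Rounding down puts \<open>z\<close> into the cube, whose extent is at most
    \<open>1 / D\<close> in each coordinate.\<close>
  define a where "a = (\<chi> i. \<lfloor>real D * z $ i\<rfloor>)"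
  have dy: "dist z y < \<delta>" if y: "y \<in> cbox (cube_lo D a) (cube_hi D a)" for y
  proof -
    have "\<bar>(z - y) $ i\<bar> \<le> 1 / real D" for i
    proof -
      define v where "v = real D * z $ i"
      have "real_of_int \<lfloor>v\<rfloor> / real D \<le> y $ i" "y $ i \<le> (real_of_int \<lfloor>v\<rfloor> + 1) / real D"
        using y by (auto simp: mem_box_cart cube_lo_def cube_hi_def a_def v_def)
      then have "real_of_int \<lfloor>v\<rfloor> \<le> real D * y $ i" "real D * y $ i \<le> real_of_int \<lfloor>v\<rfloor> + 1"
        using Dpos by (auto simp: field_simps)
      then have "\<bar>real D * (z - y) $ i\<bar> \<le> 1"
        unfolding vector_minus_component right_diff_distrib v_def[symmetric] by linarith
      then have "real D * \<bar>(z - y) $ i\<bar> \<le> 1" by (simp only: abs_mult abs_of_nat)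
      then show ?thesis using Dpos by (simp only: pos_le_divide_eq mult.commute)
    qed
    note comp = this
    have "norm (z - y) \<le> (\<Sum>i\<in>(UNIV::'s set). 1 / real D)"
    proof (rule order.trans[OF norm_le_l1_cart])
      show "(\<Sum>i\<in>UNIV. \<bar>(z - y) $ i\<bar>) \<le> (\<Sum>i\<in>(UNIV::'s set). 1 / real D)"
        by (rule sum_mono) (rule comp)
    qed
    also have "\<dots> < \<delta>" using small Dpos assms by (simp add: field_simps)
    finally show ?thesis by (simp add: dist_norm)
  qed
  have "cube_lo D a \<in> cbox (cube_lo D a) (cube_hi D a)"
    using Dpos by (auto simp: mem_box_cart cube_lo_def cube_hi_def field_simps)
  then show ?thesis using that[of D a] Dpos small dy by auto
qed

text \<open>Since \<open>x\<close> is interior to the cone, so is \<open>\<sigma> x\<close>: a small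
  cube around \<open>x + \<sigma> x\<close> lies in \<open>x\<close> plus the cone, and there
  \<open>T\<close> is at least \<open>T x\<close>; around \<open>x - \<sigma> x\<close> it is at
  most \<open>T x\<close>. Both cubes are close enough to \<open>x\<close> for the local
  estimate.\<close>

lemma T_eq_lead:
  assumes x: "x \<in> \<Omega>" shows "T x = lead x"
proof (rule antisym)
  obtain \<rho> where \<rho>: "\<rho> > 0" "ball x \<rho> \<subseteq> \<Omega>"
    using fundamental_cone_open[OF Omega] x open_contains_ball by blast
  have cone: "\<sigma> *\<^sub>R y \<in> subcone M UNIV" if "dist x y < \<rho>" "\<sigma> > 0" for y \<sigma>
  proof -
    have "y \<in> subcone M UNIV"
      using that(1) \<rho>(2) fundamental_cone_subset[OF Omega] interior_subset by (auto simp: subset_iff)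
    then show ?thesis using that(2) by (intro scaleR_subcone) auto
  qed
  have *: "T x \<le> lead x + \<epsilon> \<and> lead x - \<epsilon> \<le> T x" if \<epsilon>: "\<epsilon> > 0" for \<epsilon>
  proof -
    obtain c0 \<eta> where c0: "c0 > 0" "\<eta> > 0"
      and est: "\<And>\<alpha> c. c \<ge> c0 \<Longrightarrow> dist x ((1/c) *\<^sub>R rvec \<alpha>) < \<eta> \<Longrightarrow>
        \<bar>real (discrete_truncated_power M \<alpha>) / c ^ top_deg - class_lead x (residue period \<alpha>)\<bar> < \<epsilon>"
      using local_estimate[OF x \<epsilon>] by metis
    define \<sigma> where "\<sigma> = \<eta> / (4 * (norm x + 1))"
    have \<sigma>: "\<sigma> > 0" unfolding \<sigma>_def using c0 by (simp add: add_nonneg_pos)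
    have \<sigma>x: "norm (\<sigma> *\<^sub>R x) \<le> \<eta> / 4"
    proof -
      have "norm (\<sigma> *\<^sub>R x) = \<eta> / 4 * (norm x / (norm x + 1))" using \<sigma> c0 by (simp add: \<sigma>_def)
      also have "\<dots> \<le> \<eta> / 4 * 1" using c0 by (intro mult_left_mono) (auto simp: divide_le_eq_1 add_nonneg_pos)
      finally show ?thesis by simp
    qed
    \<comment> \<open>The first bound keeps \<open>(y - x) / \<sigma>\<close> in the ball of radius
      \<rho> around \<open>x\<close>. The second makes the displacement, the distance to the corner
      and the margin add up to at most three quarters of \<eta>.\<close>
    define \<delta> where "\<delta> = min (\<sigma> * \<rho>) (\<eta> / 4)"
    have \<delta>: "\<delta> > 0" using \<sigma> \<rho> c0 by (simp add: \<delta>_def)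
    have up: "T x \<le> lead x + \<epsilon>"
    proof -
      obtain D a where Da: "D > 0" "2 * real CARD('s) / real D < \<delta>" "dist (x + \<sigma> *\<^sub>R x) (cube_lo D a) < \<delta>"
        "\<forall>y\<in>cbox (cube_lo D a) (cube_hi D a). dist (x + \<sigma> *\<^sub>R x) y < \<delta>"
        by (rule small_cube[OF \<delta>])
      show ?thesis
      proof (rule T_le_lead[OF x \<epsilon> est Da(1)])
        have "dist x (x + \<sigma> *\<^sub>R x) \<le> \<eta> / 4" using \<sigma>x by (simp add: dist_norm)
        then have "dist x (cube_lo D a) \<le> \<eta> / 4 + \<delta>"
          using dist_triangle[of x "cube_lo D a" "x + \<sigma> *\<^sub>R x"] Da(3) by linarith
        then show "dist x (cube_lo D a) + 2 * real CARD('s) / real D < \<eta>" using Da(2) c0 unfolding \<delta>_def by linarith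
        fix y assume "y \<in> cbox (cube_lo D a) (cube_hi D a)"
        then have "norm (x + \<sigma> *\<^sub>R x - y) < \<sigma> * \<rho>" using Da(4)[rule_format, of y] by (simp add: \<delta>_def dist_norm)
        moreover have "x + \<sigma> *\<^sub>R x - y = \<sigma> *\<^sub>R (x - (1/\<sigma>) *\<^sub>R (y - x))"
          using \<sigma> by (simp add: scaleR_diff_right algebra_simps)
        ultimately have "dist x ((1/\<sigma>) *\<^sub>R (y - x)) < \<rho>" using \<sigma> by (simp add: dist_norm)
        from cone[OF this \<sigma>] show "T x \<le> T y" using \<sigma> by (intro T_mono) simp
      qed
    qed
    have lo: "lead x - \<epsilon> \<le> T x"
    proof -
      obtain D a where Da: "D > 0" "2 * real CARD('s) / real D < \<delta>" "dist (x - \<sigma> *\<^sub>R x) (cube_lo D a) < \<delta>"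
        "\<forall>y\<in>cbox (cube_lo D a) (cube_hi D a). dist (x - \<sigma> *\<^sub>R x) y < \<delta>"
        by (rule small_cube[OF \<delta>])
      show ?thesis
      proof (rule lead_le_T[OF x \<epsilon> est Da(1)])
        have "dist x (x - \<sigma> *\<^sub>R x) \<le> \<eta> / 4" using \<sigma>x by (simp add: dist_norm)
        then have "dist x (cube_lo D a) \<le> \<eta> / 4 + \<delta>"
          using dist_triangle[of x "cube_lo D a" "x - \<sigma> *\<^sub>R x"] Da(3) by linarith
        then show "dist x (cube_lo D a) + 2 * real CARD('s) / real D < \<eta>" using Da(2) c0 unfolding \<delta>_def by linarith
        fix y assume "y \<in> box (cube_lo D a) (cube_hi D a)"
        then have "norm (x - \<sigma> *\<^sub>R x - y) < \<sigma> * \<rho>"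
          using Da(4)[rule_format, of y] box_subset_cbox by (auto simp: \<delta>_def dist_norm)
        moreover have "x - \<sigma> *\<^sub>R x - y = - (\<sigma> *\<^sub>R (x - (1/\<sigma>) *\<^sub>R (x - y)))"
          using \<sigma> by (simp add: scaleR_diff_right algebra_simps)
        ultimately have "dist x ((1/\<sigma>) *\<^sub>R (x - y)) < \<rho>" using \<sigma> by (simp add: dist_norm)
        from cone[OF this \<sigma>] show "T y \<le> T x" using \<sigma> by (intro T_mono) simp
      qed
    qed
    show ?thesis using up lo ..
  qed
  show "T x \<le> lead x" by (rule field_le_epsilon) (use * in blast)
  show "lead x \<le> T x" by (rule field_le_epsilon) (use * in force)
qed

lemma leading_part: "x \<in> \<Omega> \<Longrightarrow> hom_part (CARD('n) - CARD('s)) (P one_vec) (cvec x) = of_real (T x)"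
  using e_part_lead(1)[of x] T_eq_lead[of x] by (simp add: hom_part_e_part top_deg_def)

end

theorem theorem4p1:
  fixes M :: "int^'n^'s"
    and \<Omega> :: "(real^'s) set"
    and f :: "int^'s \<Rightarrow> complex"
    and P :: "complex^'s \<Rightarrow> 's cpoly"
    and p :: "nat \<Rightarrow> complex^'s \<Rightarrow> complex"
  assumes spanning: "span (range (rcol M)) = UNIV"
    and hull: "0 \<notin> convex hull (range (rcol M))"
    and Omega: "\<Omega> \<in> fundamental_cones M"
    and f_space: "f \<in> nabla_space M"
    and f_agrees: "\<forall>\<alpha>\<in>v_set M \<Omega>. f \<alpha> = of_nat (discrete_truncated_power M \<alpha>)"
    and f_decomp: "\<forall>\<alpha>. f \<alpha> = (\<Sum>\<theta>\<in>A_set M. vpowi \<theta> \<alpha> * peval (P \<theta>) (cvec (rvec \<alpha>)))"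
    and p_def: "\<forall>\<mu>\<le>CARD('n) - CARD('s). p \<mu> = hom_part (CARD('n) - CARD('s) - \<mu>) (P (\<chi> i. 1))"
  shows "(\<forall>x\<in>\<Omega>. p 0 (cvec x) = of_real (truncated_power M x)) \<and>
    (\<forall>x\<in>\<Omega>. \<forall>\<mu>. 1 \<le> \<mu> \<and> \<mu> \<le> CARD('n) - CARD('s) \<longrightarrow>
      p \<mu> (cvec x) =
        - (\<Sum>j=0..\<mu>-1. \<Sum>u\<in>{u :: nat^'s. mabs u = \<mu> - j}.
             mderiv u (p j) (cvec x) * (- \<i>) ^ mabs u
               * mderiv u (box_spline_transform M) 0 / of_nat (mfact u)))"
proof -
  interpret chamber M \<Omega> f P
    by unfold_locales (rule spanning hull Omega f_agrees f_decomp)+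
  have "p 0 (cvec x) = of_real (truncated_power M x)" if "x \<in> \<Omega>" for x
    using p_def leading_part[OF that] by (simp add: one_vec_def)
  then show ?thesis using recursion[OF p_def] by blast
qed

end
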